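(* Let $R$ be an indecomposable commutative unital ring, and let $\theta=(\{X_s\}_{s\in S},\{\theta_s\}_{s\in S})$ and $\gamma=(\{Y_t\}_{t\in T},\{\gamma_t\}_{t\in T})$ be almost ample, topologically principal topological partial actions of inverse semigroups $S$ and $T$ on spaces $X$ and $Y$, such that the groupoids of germs $S\ltimes X$ and $T\ltimes Y$ are Hausdorff. Then the following are equivalent: (1) $\theta$ and $\gamma$ are continuously orbit equivalent; (2) $S\ltimes X$ and $T\ltimes Y$ are isomorphic as topological groupoids; (3) the inverse semigroups $(S\ltimes X)^a$ and $(T\ltimes Y)^a$ are isomorphic; (4) the inverse semigroups $[[S\ltimes X]]$ and $[[T\ltimes Y]]$ are isomorphic; (5) there is a diagonal-preserving (ring or $R$-algebra) isomorphism between the Steinberg algebras $A_R(S\ltimes X)$ and $A_R(T\ltimes Y)$; (6) there is a diagonal-preserving (ring or $R$-algebra) isomorphism between the crossed products $A_R(X)\rtimes S$ and $A_R(Y)\rtimes T$ (with respect to the dual partial actions).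
   Context: Inverse semigroup notation: $E(S)$ idempotents, $s\le t$ iff $s=ts^*s$. A topological partial action $\theta$ of $S$ on $X$: open $X_s$, homeomorphisms $\theta_s:X_{s^*}\to X_s$, $s\mapsto\theta_s$ a partial homomorphism into the inverse semigroup $\mathcal{I}(X)$ of partial bijections ($\theta_{s^*}=\theta_s^{-1}$, $\theta_s\theta_t\le\theta_{st}$, $s\le t\Rightarrow\theta_s\le\theta_t$), and $X=\bigcup_{e\in E(S)}X_e$. Write $S_x=\{s:x\in X_{s^*}\}$, $S*X=\{(s,x):x\in X_{s^*}\}$. Almost ample: $X$ locally compact Hausdorff and each $X_s$ ultraparacompact (every open cover has a refinement by pairwise disjoint clopen sets). Topologically principal: the set $\Lambda(\theta)$ of $x$ such that every $s\in S_x$ with $\theta_s(x)=x$ has some $e\in E(S)\cap S_x$ with $e\le s$ is dense in $X$. Continuous orbit equivalence: a homeomorphism $\varphi:X\to Y$ and continuous $a:S*X\to T$, $b:T*Y\to S$ ($S,T$ discrete) with $a(s,x)\in T_{\varphi(x)}$, $b(t,y)\in S_{\varphi^{-1}(y)}$, $\varphi(\theta_s(x))=\gamma_{a(s,x)}(\varphi(x))$, $\varphi^{-1}(\gamma_t(y))=\theta_{b(t,y)}(\varphi^{-1}(y))$. Groupoid of germs $S\ltimes X$: germs $[s,x]$, $(s,x)\sim(t,y)$ iff $x=y$ and some $u\le s,t$ has $x\in X_{u^*}$; source $x$, range $\theta_s(x)$, product $[s,x][t,y]=[st,y]$, inverse $[s^*,\theta_s(x)]$, unit space $X$, topology with basis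 $[s,U]$, $U\subseteq X_{s^*}$ open. For an ample groupoid $\mathcal{G}$: $\mathcal{G}^a$ is the inverse semigroup of compact-open bisections under $UV=\{uv\}$; for $U\in\mathcal{G}^a$, $\tau_U=r\circ(s|_U)^{-1}:s(U)\to r(U)$; the topological full pseudogroup is $[[\mathcal{G}]]=\{\tau_U:U\in\mathcal{G}^a\}\subseteq\mathcal{I}(\mathcal{G}^{(0)})$. $A_R(\mathcal{G})$ is the $R$-span of characteristic functions of compact-open bisections with convolution; its diagonal is $\{f\in A_R(\mathcal{G}):\operatorname{supp}f\subseteq\mathcal{G}^{(0)}\}$. Dual partial action of $\theta$ on $A_R(X)$ (locally constant compactly supported functions): $D_s=\{f:\operatorname{supp}f\subseteq X_s\}$, $\alpha_s(f)=f\circ\theta_{s^*}$ extended by zero. Crossed product $A\rtimes S=\mathscr{L}/\mathscr{N}$ where $\mathscr{L}$ = finite sums $\sum a_s\delta_s$ ($a_s\in D_s$) with $(a_s\delta_s)(b_t\delta_t)=\alpha_s(\alpha_{s^*}(a_s)b_t)\delta_{st}$, $\mathscr{N}$ generated by $a\delta_r-a\delta_s$, $r\le s$, $a\in D_r$; its diagonal is the additive subgroup generated by the classes of $a\delta_e$, $e\in E(S)$, $a\in D_e$. A diagonal-preserving isomorphism maps diagonal onto diagonal. *)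

theory Defs
  imports "HOL-Analysis.Analysis"
begin

definition inverse_semigroup :: "('s \<Rightarrow> 's \<Rightarrow> 's) \<Rightarrow> bool" where
  "inverse_semigroup m \<longleftrightarrow>
     (\<forall>a b c. m (m a b) c = m a (m b c)) \<and>
     (\<forall>s. \<exists>!t. m (m s t) s = s \<and> m (m t s) t = t)"

definition istar :: "('s \<Rightarrow> 's \<Rightarrow> 's) \<Rightarrow> 's \<Rightarrow> 's" where
  "istar m s = (THE t. m (m s t) s = s \<and> m (m t s) t = t)"

definition idems :: "('s \<Rightarrow> 's \<Rightarrow> 's) \<Rightarrow> 's set" where
  "idems m = {e. m e e = e}"

definition ile :: "('s \<Rightarrow> 's \<Rightarrow> 's) \<Rightarrow> 's \<Rightarrow> 's \<Rightarrow> bool" where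
  "ile m s t \<longleftrightarrow> s = m (m t (istar m s)) s"

definition sg_isomorphic :: "'a set \<Rightarrow> ('a \<Rightarrow> 'a \<Rightarrow> 'a) \<Rightarrow> 'b set \<Rightarrow> ('b \<Rightarrow> 'b \<Rightarrow> 'b) \<Rightarrow> bool" where
  "sg_isomorphic A ma B mb \<longleftrightarrow>
     (\<exists>\<phi>. bij_betw \<phi> A B \<and> (\<forall>x\<in>A. \<forall>y\<in>A. \<phi> (ma x y) = mb (\<phi> x) (\<phi> y)))"

text \<open>An inverse semigroup S (the type 's with multiplication smul), a space X (ptop),
  the domains X_s (pdom s) and the maps theta_s : X_{s*} \<rightarrow> X_s (pmap s).\<close>
record ('s, 'x) pact =
  smul :: "'s \<Rightarrow> 's \<Rightarrow> 's"
  ptop :: "'x topology"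
  pdom :: "'s \<Rightarrow> 'x set"
  pmap :: "'s \<Rightarrow> 'x \<Rightarrow> 'x"

abbreviation pstar :: "('s, 'x) pact \<Rightarrow> 's \<Rightarrow> 's" where
  "pstar P s \<equiv> istar (smul P) s"

definition partial_action :: "('s, 'x) pact \<Rightarrow> bool" where
  "partial_action P \<longleftrightarrow>
     inverse_semigroup (smul P) \<and>
     (\<forall>s. openin (ptop P) (pdom P s)) \<and>
     (\<forall>s. homeomorphic_map (subtopology (ptop P) (pdom P (pstar P s)))
                             (subtopology (ptop P) (pdom P s)) (pmap P s)) \<and>
     \<comment> \<open>theta_{s*} = theta_s^{-1}\<close>
     (\<forall>s. \<forall>x\<in>pdom P (pstar P s). pmap P (pstar P s) (pmap P s x) = x) \<and>
     \<comment> \<open>theta_s theta_t \<le> theta_{st}\<close>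
     (\<forall>s t. \<forall>x\<in>pdom P (pstar P t). pmap P t x \<in> pdom P (pstar P s) \<longrightarrow>
          x \<in> pdom P (pstar P (smul P s t)) \<and> pmap P (smul P s t) x = pmap P s (pmap P t x)) \<and>
     \<comment> \<open>s \<le> t implies theta_s \<le> theta_t\<close>
     (\<forall>s t. ile (smul P) s t \<longrightarrow> pdom P (pstar P s) \<subseteq> pdom P (pstar P t) \<and>
          (\<forall>x\<in>pdom P (pstar P s). pmap P s x = pmap P t x)) \<and>
     topspace (ptop P) = (\<Union>e\<in>idems (smul P). pdom P e)"

definition ultraparacompact :: "'a topology \<Rightarrow> bool" where
  "ultraparacompact X \<longleftrightarrow>
     (\<forall>\<U>. (\<forall>U\<in>\<U>. openin X U) \<and> topspace X \<subseteq> \<Union>\<U> \<longrightarrow>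
        (\<exists>\<V>. (\<forall>V\<in>\<V>. openin X V \<and> closedin X V \<and> (\<exists>U\<in>\<U>. V \<subseteq> U)) \<and>
              pairwise disjnt \<V> \<and> topspace X \<subseteq> \<Union>\<V>))"

definition almost_ample :: "('s, 'x) pact \<Rightarrow> bool" where
  "almost_ample P \<longleftrightarrow>
     locally_compact_space (ptop P) \<and> Hausdorff_space (ptop P) \<and>
     (\<forall>s. ultraparacompact (subtopology (ptop P) (pdom P s)))"

definition stab_dom :: "('s, 'x) pact \<Rightarrow> 'x \<Rightarrow> 's set" where
  "stab_dom P x = {s. x \<in> pdom P (pstar P s)}"

definition Lambda_set :: "('s, 'x) pact \<Rightarrow> 'x set" where
  "Lambda_set P = {x \<in> topspace (ptop P).
     \<forall>s\<in>stab_dom P x. pmap P s x = x \<longrightarrow>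
        (\<exists>e\<in>idems (smul P) \<inter> stab_dom P x. ile (smul P) e s)}"

definition top_principal :: "('s, 'x) pact \<Rightarrow> bool" where
  "top_principal P \<longleftrightarrow> ptop P closure_of Lambda_set P = topspace (ptop P)"

definition SX :: "('s, 'x) pact \<Rightarrow> ('s \<times> 'x) set" where
  "SX P = {(s, x). x \<in> pdom P (pstar P s)}"

definition coe :: "('s, 'x) pact \<Rightarrow> ('t, 'y) pact \<Rightarrow> bool" where
  "coe P Q \<longleftrightarrow>
     (\<exists>\<phi> \<psi> a b.
        homeomorphic_maps (ptop P) (ptop Q) \<phi> \<psi> \<and>
        continuous_map (subtopology (prod_topology (discrete_topology UNIV) (ptop P)) (SX P))
                       (discrete_topology UNIV) a \<and>
        continuous_map (subtopology (prod_topology (discrete_topology UNIV) (ptop Q)) (SX Q))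
                       (discrete_topology UNIV) b \<and>
        (\<forall>(s, x)\<in>SX P. a (s, x) \<in> stab_dom Q (\<phi> x) \<and>
                        \<phi> (pmap P s x) = pmap Q (a (s, x)) (\<phi> x)) \<and>
        (\<forall>(t, y)\<in>SX Q. b (t, y) \<in> stab_dom P (\<psi> y) \<and>
                        \<psi> (pmap Q t y) = pmap P (b (t, y)) (\<psi> y)))"

record 'g tgpd =
  garr :: "'g set"
  gmul :: "'g \<Rightarrow> 'g \<Rightarrow> 'g"
  ginv :: "'g \<Rightarrow> 'g"
  gtop :: "'g topology"

definition gsrc :: "'g tgpd \<Rightarrow> 'g \<Rightarrow> 'g" where
  "gsrc G g = gmul G (ginv G g) g"

definition grng :: "'g tgpd \<Rightarrow> 'g \<Rightarrow> 'g" where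
  "grng G g = gmul G g (ginv G g)"

definition composable :: "'g tgpd \<Rightarrow> 'g \<Rightarrow> 'g \<Rightarrow> bool" where
  "composable G g h \<longleftrightarrow> g \<in> garr G \<and> h \<in> garr G \<and> gsrc G g = grng G h"

definition gunits :: "'g tgpd \<Rightarrow> 'g set" where
  "gunits G = gsrc G ` garr G"

definition gpd_isomorphic :: "'g tgpd \<Rightarrow> 'h tgpd \<Rightarrow> bool" where
  "gpd_isomorphic G H \<longleftrightarrow>
     (\<exists>\<phi>. bij_betw \<phi> (garr G) (garr H) \<and> homeomorphic_map (gtop G) (gtop H) \<phi> \<and>
          (\<forall>g\<in>garr G. \<forall>h\<in>garr G.
              (composable G g h \<longleftrightarrow> composable H (\<phi> g) (\<phi> h)) \<and>
              (composable G g h \<longrightarrow> \<phi> (gmul G g h) = gmul H (\<phi> g) (\<phi> h))))"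

definition germ_rel :: "('s, 'x) pact \<Rightarrow> 's \<times> 'x \<Rightarrow> 's \<times> 'x \<Rightarrow> bool" where
  "germ_rel P p q \<longleftrightarrow> snd p = snd q \<and>
     (\<exists>u. ile (smul P) u (fst p) \<and> ile (smul P) u (fst q) \<and> snd p \<in> pdom P (pstar P u))"

definition germ :: "('s, 'x) pact \<Rightarrow> 's \<Rightarrow> 'x \<Rightarrow> ('s \<times> 'x) set" where
  "germ P s x = {q \<in> SX P. germ_rel P (s, x) q}"

definition germ_gpd :: "('s, 'x) pact \<Rightarrow> ('s \<times> 'x) set tgpd" where
  "germ_gpd P =
    \<lparr> garr = {germ P s x | s x. (s, x) \<in> SX P},
      gmul = (\<lambda>g h. germ P (smul P (fst (SOME p. p \<in> g)) (fst (SOME q. q \<in> h)))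
                           (snd (SOME q. q \<in> h))),
      ginv = (\<lambda>g. germ P (pstar P (fst (SOME p. p \<in> g)))
                         (pmap P (fst (SOME p. p \<in> g)) (snd (SOME p. p \<in> g)))),
      gtop = topology_generated_by
               {{germ P s x | x. x \<in> U} | s U. openin (ptop P) U \<and> U \<subseteq> pdom P (pstar P s)} \<rparr>"

definition bisection :: "'g tgpd \<Rightarrow> 'g set \<Rightarrow> bool" where
  "bisection G U \<longleftrightarrow> U \<subseteq> garr G \<and> inj_on (gsrc G) U \<and> inj_on (grng G) U"

definition Ga :: "'g tgpd \<Rightarrow> 'g set set" where
  "Ga G = {U. bisection G U \<and> openin (gtop G) U \<and> compactin (gtop G) U}"

definition bis_mul :: "'g tgpd \<Rightarrow> 'g set \<Rightarrow> 'g set \<Rightarrow> 'g set" where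
  "bis_mul G U V = {gmul G u v | u v. u \<in> U \<and> v \<in> V \<and> composable G u v}"

text \<open>tau_U = r o (s|_U)^{-1}, represented by its graph (a partial bijection of the unit space)\<close>
definition tau :: "'g tgpd \<Rightarrow> 'g set \<Rightarrow> ('g \<times> 'g) set" where
  "tau G U = {(gsrc G u, grng G u) | u. u \<in> U}"

definition full_pseudogroup :: "'g tgpd \<Rightarrow> ('g \<times> 'g) set set" where
  "full_pseudogroup G = tau G ` Ga G"

text \<open>product in I(G^(0)): (f g)(x) = f (g x), i.e. graph of g followed by graph of f\<close>
definition pb_mul :: "('a \<times> 'a) set \<Rightarrow> ('a \<times> 'a) set \<Rightarrow> ('a \<times> 'a) set" where
  "pb_mul f g = g O f"

record ('a, 'r) dalg =
  acar :: "'a set"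
  aadd :: "'a \<Rightarrow> 'a \<Rightarrow> 'a"
  amul :: "'a \<Rightarrow> 'a \<Rightarrow> 'a"
  asmul :: "'r \<Rightarrow> 'a \<Rightarrow> 'a"
  adiag :: "'a set"

definition ring_iso :: "('a, 'r) dalg \<Rightarrow> ('b, 'r) dalg \<Rightarrow> ('a \<Rightarrow> 'b) \<Rightarrow> bool" where
  "ring_iso A B \<Phi> \<longleftrightarrow> bij_betw \<Phi> (acar A) (acar B) \<and>
     (\<forall>x\<in>acar A. \<forall>y\<in>acar A. \<Phi> (aadd A x y) = aadd B (\<Phi> x) (\<Phi> y) \<and>
                            \<Phi> (amul A x y) = amul B (\<Phi> x) (\<Phi> y))"

definition alg_iso :: "('a, 'r) dalg \<Rightarrow> ('b, 'r) dalg \<Rightarrow> ('a \<Rightarrow> 'b) \<Rightarrow> bool" where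
  "alg_iso A B \<Phi> \<longleftrightarrow> ring_iso A B \<Phi> \<and>
     (\<forall>r. \<forall>x\<in>acar A. \<Phi> (asmul A r x) = asmul B r (\<Phi> x))"

definition diag_preserving :: "('a, 'r) dalg \<Rightarrow> ('b, 'r) dalg \<Rightarrow> ('a \<Rightarrow> 'b) \<Rightarrow> bool" where
  "diag_preserving A B \<Phi> \<longleftrightarrow> \<Phi> ` adiag A = adiag B"

definition chi :: "'g set \<Rightarrow> 'g \<Rightarrow> 'r::comm_ring_1" where
  "chi U g = (if g \<in> U then 1 else 0)"

definition steinberg_set :: "'g tgpd \<Rightarrow> ('g \<Rightarrow> 'r::comm_ring_1) set" where
  "steinberg_set G = {f. \<exists>(n::nat) c U. (\<forall>i<n. U i \<in> Ga G) \<and>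
                          f = (\<lambda>g. \<Sum>i<n. c i * chi (U i) g)}"

definition convolution :: "'g tgpd \<Rightarrow> ('g \<Rightarrow> 'r::comm_ring_1) \<Rightarrow> ('g \<Rightarrow> 'r) \<Rightarrow> 'g \<Rightarrow> 'r" where
  "convolution G f h = (\<lambda>\<gamma>. if \<gamma> \<in> garr G then
       (\<Sum>\<alpha>\<in>{\<alpha> \<in> garr G. grng G \<alpha> = grng G \<gamma> \<and> f \<alpha> \<noteq> 0}.
            f \<alpha> * h (gmul G (ginv G \<alpha>) \<gamma>))
     else 0)"

definition steinberg :: "'g tgpd \<Rightarrow> ('g \<Rightarrow> 'r::comm_ring_1, 'r) dalg" where
  "steinberg G =
    \<lparr> acar = steinberg_set G,
      aadd = (\<lambda>f h g. f g + h g),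
      amul = convolution G,
      asmul = (\<lambda>r f g. r * f g),
      adiag = {f \<in> steinberg_set G. \<forall>g. f g \<noteq> 0 \<longrightarrow> g \<in> gunits G} \<rparr>"

definition AR_space :: "'x topology \<Rightarrow> ('x \<Rightarrow> 'r::comm_ring_1) set" where
  "AR_space X = {f. (\<forall>x. f x \<noteq> 0 \<longrightarrow> x \<in> topspace X) \<and>
                    continuous_map X (discrete_topology UNIV) f \<and>
                    compactin X (X closure_of {x \<in> topspace X. f x \<noteq> 0})}"

definition Dsp :: "('s, 'x) pact \<Rightarrow> 's \<Rightarrow> ('x \<Rightarrow> 'r::comm_ring_1) set" where
  "Dsp P s = {f \<in> AR_space (ptop P). \<forall>x. f x \<noteq> 0 \<longrightarrow> x \<in> pdom P s}"

definition dual_alpha :: "('s, 'x) pact \<Rightarrow> 's \<Rightarrow> ('x \<Rightarrow> 'r::comm_ring_1) \<Rightarrow> 'x \<Rightarrow> 'r" where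
  "dual_alpha P s f = (\<lambda>x. if x \<in> pdom P s then f (pmap P (pstar P s) x) else 0)"

text \<open>elements of script-L: finitely supported families (a_s)_s with a_s \<in> D_s,
  standing for the finite sum of a_s delta_s\<close>
definition Lset :: "('s, 'x) pact \<Rightarrow> ('s \<Rightarrow> 'x \<Rightarrow> 'r::comm_ring_1) set" where
  "Lset P = {F. finite {s. F s \<noteq> (\<lambda>_. 0)} \<and> (\<forall>s. F s \<in> Dsp P s)}"

definition Ladd :: "('s \<Rightarrow> 'x \<Rightarrow> 'r::comm_ring_1) \<Rightarrow> ('s \<Rightarrow> 'x \<Rightarrow> 'r) \<Rightarrow> 's \<Rightarrow> 'x \<Rightarrow> 'r" where
  "Ladd F G = (\<lambda>s x. F s x + G s x)"

definition Lneg :: "('s \<Rightarrow> 'x \<Rightarrow> 'r::comm_ring_1) \<Rightarrow> 's \<Rightarrow> 'x \<Rightarrow> 'r" where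
  "Lneg F = (\<lambda>s x. - F s x)"

definition Lsmul :: "'r::comm_ring_1 \<Rightarrow> ('s \<Rightarrow> 'x \<Rightarrow> 'r) \<Rightarrow> 's \<Rightarrow> 'x \<Rightarrow> 'r" where
  "Lsmul r F = (\<lambda>s x. r * F s x)"

text \<open>(a_s delta_s)(b_t delta_t) = alpha_s(alpha_{s*}(a_s) b_t) delta_{st}, extended bilinearly\<close>
definition Lmul :: "('s, 'x) pact \<Rightarrow> ('s \<Rightarrow> 'x \<Rightarrow> 'r::comm_ring_1) \<Rightarrow> ('s \<Rightarrow> 'x \<Rightarrow> 'r) \<Rightarrow> 's \<Rightarrow> 'x \<Rightarrow> 'r" where
  "Lmul P F G = (\<lambda>u x. \<Sum>(s, t)\<in>{(s, t). smul P s t = u \<and> F s \<noteq> (\<lambda>_. 0) \<and> G t \<noteq> (\<lambda>_. 0)}.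
       dual_alpha P s (\<lambda>y. dual_alpha P (pstar P s) (F s) y * G t y) x)"

definition Ldelta :: "('x \<Rightarrow> 'r::comm_ring_1) \<Rightarrow> 's \<Rightarrow> 's \<Rightarrow> 'x \<Rightarrow> 'r" where
  "Ldelta a s = (\<lambda>t. if t = s then a else (\<lambda>_. 0))"

inductive_set Nset :: "('s, 'x) pact \<Rightarrow> ('s \<Rightarrow> 'x \<Rightarrow> 'r::comm_ring_1) set" for P where
  gen: "ile (smul P) r s \<Longrightarrow> a \<in> Dsp P r \<Longrightarrow> Ladd (Ldelta a r) (Lneg (Ldelta a s)) \<in> Nset P"
| zero: "(\<lambda>_ _. 0) \<in> Nset P"
| add: "F \<in> Nset P \<Longrightarrow> G \<in> Nset P \<Longrightarrow> Ladd F G \<in> Nset P"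
| neg: "F \<in> Nset P \<Longrightarrow> Lneg F \<in> Nset P"
| lmul: "F \<in> Lset P \<Longrightarrow> G \<in> Nset P \<Longrightarrow> Lmul P F G \<in> Nset P"
| rmul: "F \<in> Nset P \<Longrightarrow> G \<in> Lset P \<Longrightarrow> Lmul P F G \<in> Nset P"

definition cls :: "('s, 'x) pact \<Rightarrow> ('s \<Rightarrow> 'x \<Rightarrow> 'r::comm_ring_1) \<Rightarrow> ('s \<Rightarrow> 'x \<Rightarrow> 'r) set" where
  "cls P F = {G \<in> Lset P. Ladd F (Lneg G) \<in> Nset P}"

definition crep :: "('s \<Rightarrow> 'x \<Rightarrow> 'r) set \<Rightarrow> 's \<Rightarrow> 'x \<Rightarrow> 'r" where
  "crep C = (SOME F. F \<in> C)"

inductive_set crossed_diag :: "('s, 'x) pact \<Rightarrow> ('s \<Rightarrow> 'x \<Rightarrow> 'r::comm_ring_1) set set" for P where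
  gen: "e \<in> idems (smul P) \<Longrightarrow> a \<in> Dsp P e \<Longrightarrow> cls P (Ldelta a e) \<in> crossed_diag P"
| zero: "cls P (\<lambda>_ _. 0) \<in> crossed_diag P"
| add: "C \<in> crossed_diag P \<Longrightarrow> D \<in> crossed_diag P \<Longrightarrow>
          cls P (Ladd (crep C) (crep D)) \<in> crossed_diag P"
| neg: "C \<in> crossed_diag P \<Longrightarrow> cls P (Lneg (crep C)) \<in> crossed_diag P"

definition crossed_product :: "('s, 'x) pact \<Rightarrow> (('s \<Rightarrow> 'x \<Rightarrow> 'r::comm_ring_1) set, 'r) dalg" where
  "crossed_product P =
    \<lparr> acar = cls P ` Lset P,
      aadd = (\<lambda>C D. cls P (Ladd (crep C) (crep D))),
      amul = (\<lambda>C D. cls P (Lmul P (crep C) (crep D))),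
      asmul = (\<lambda>r C. cls P (Lsmul r (crep C))),
      adiag = crossed_diag P \<rparr>"

definition indecomposable_ring :: "'r::comm_ring_1 itself \<Rightarrow> bool" where
  "indecomposable_ring TYPE('r) \<longleftrightarrow> (\<forall>e::'r. e * e = e \<longrightarrow> e = 0 \<or> e = 1)"

end

theory Submission
  imports Defs
begin

text \<open>Write \<open>G = S \<ltimes> X\<close> and \<open>H = T \<ltimes> Y\<close>. These are Hausdorff ample groupoids in which arrows
  without isotropy are dense, hence \<open>U \<mapsto> \<tau>\<^sub>U\<close> is injective on compact open bisections and (3) is
  equivalent to (4). An orbit equivalence conjugates \<open>[[G]]\<close> onto \<open>[[H]]\<close>, because the cocycles
  are locally constant. An isomorphism of the semigroups of bisections preserves inclusion, so it
  moves the points of \<open>G\<close>, which are prime filters of bisections, to points of \<open>H\<close>; this is an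
  isomorphism of topological groupoids. From such an isomorphism the cocycles are recovered by
  choosing representatives of germs, and ultraparacompactness makes the choice locally constant.

  A diagonal-preserving ring isomorphism preserves normalizers of the diagonal. Over an
  indecomposable ring their supports are exactly the compact open bisections: this is checked at
  arrows without isotropy, where convolution is matrix multiplication, and extended by density.
  Inclusion of supports and multiplication of normalizers are algebraic, so one obtains (3).
  Finally \<open>a \<delta>\<^sub>s \<mapsto> a \<circ> r\<close> on \<open>[s, X\<^sub>s\<^sub>*]\<close> identifies the crossed product with the Steinberg
  algebra of \<open>G\<close>; its kernel is \<open>\<N>\<close> because germs that agree at a point have a common lower bound
  there.\<close>

section \<open>Inverse semigroups\<close>

text \<open>An orbit equivalence does not say that \<open>a\<close> and \<open>b\<close> are
  cocycles, or that they invert each other on arrows; only \<open>\<phi>\<close> and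
  \<open>\<psi>\<close> are known to be mutually inverse. This is why (1) leads to (4) and not
  directly to (2): conjugation by \<open>\<phi>\<close> on units is invertible from the outset, and
  the arrow map built from \<open>a\<close> serves to show that it carries one pseudogroup into the
  other. The implications through (4), (3), (2) close a cycle, and (5) joins it between (2) and (3).

  Hausdorffness makes compact open bisections closed, so they admit relative complements. This is
  what lets filters of bisections separate points. It also turns the Steinberg algebra into the
  space \<open>lcc\<close> of locally constant functions with compact support, the class from which
  the coefficients of the crossed product are drawn, so one induction over such functions serves
  both sides.

  The ring may have zero divisors. Indecomposability makes every nonzero value of a normalizer
  invertible, and after that supports multiply without cancellation.\<close>

locale inv_semigroup =
  fixes m :: "'s \<Rightarrow> 's \<Rightarrow> 's" (infixl "\<cdot>" 70)
  assumes inverse_semigroup: "inverse_semigroup m"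
begin

abbreviation star :: "'s \<Rightarrow> 's" where "star \<equiv> istar m"

lemma assoc: "(a \<cdot> b) \<cdot> c = a \<cdot> (b \<cdot> c)"
  using inverse_semigroup unfolding inverse_semigroup_def by blast

lemma star_props: "s \<cdot> star s \<cdot> s = s \<and> star s \<cdot> s \<cdot> star s = star s"
proof -
  have "\<exists>!t. s \<cdot> t \<cdot> s = s \<and> t \<cdot> s \<cdot> t = t"
    using inverse_semigroup unfolding inverse_semigroup_def by blast
  then show ?thesis unfolding istar_def by (rule theI')
qed

lemma star1: "s \<cdot> (star s \<cdot> s) = s"
  and star2: "star s \<cdot> (s \<cdot> star s) = star s"
  using star_props[of s] by (simp_all add: assoc)

lemma star1': "s \<cdot> (star s \<cdot> (s \<cdot> x)) = s \<cdot> x"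
  and star2': "star s \<cdot> (s \<cdot> (star s \<cdot> x)) = star s \<cdot> x"
  using star1[of s] star2[of s] by (metis assoc)+

lemma star_unique: "s \<cdot> (t \<cdot> s) = s \<Longrightarrow> t \<cdot> (s \<cdot> t) = t \<Longrightarrow> t = star s"
proof -
  assume a: "s \<cdot> (t \<cdot> s) = s" "t \<cdot> (s \<cdot> t) = t"
  have "\<exists>!t. s \<cdot> t \<cdot> s = s \<and> t \<cdot> s \<cdot> t = t"
    using inverse_semigroup unfolding inverse_semigroup_def by blast
  then show ?thesis using a star_props[of s] by (metis assoc)
qed

lemma star_star [simp]: "star (star s) = s"
  by (rule star_unique[symmetric]) (simp_all add: star1 star2)

lemma idems_iff: "e \<in> idems m \<longleftrightarrow> e \<cdot> e = e"
  by (simp add: idems_def)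

lemma idem_star: "e \<in> idems m \<Longrightarrow> star e = e"
  by (rule star_unique[symmetric]) (simp_all add: idems_iff)

text \<open>With \<open>x\<close> the inverse of \<open>e \<cdot> f\<close>, the element
  \<open>f \<cdot> (x \<cdot> e)\<close> is an inverse of \<open>e \<cdot> f\<close> as well.
  Uniqueness identifies it with \<open>x\<close>, which makes \<open>x\<close> idempotent and hence
  its own inverse, so \<open>e \<cdot> f\<close> equals \<open>x\<close>.\<close>

lemma idem_mult: assumes e: "e \<in> idems m" and f: "f \<in> idems m" shows "e \<cdot> f \<in> idems m"
proof -
  have ee: "e \<cdot> e = e" "f \<cdot> f = f" using e f by (simp_all add: idems_iff)
  have ee': "e \<cdot> (e \<cdot> x) = e \<cdot> x" "f \<cdot> (f \<cdot> x) = f \<cdot> x" for x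
    using ee by (metis assoc)+
  define x where "x = star (e \<cdot> f)"
  have x1: "e \<cdot> (f \<cdot> (x \<cdot> (e \<cdot> f))) = e \<cdot> f"
    using star1[of "e \<cdot> f"] by (simp add: x_def assoc)
  have x2: "x \<cdot> (e \<cdot> (f \<cdot> x)) = x"
    using star2[of "e \<cdot> f"] by (simp add: x_def assoc)
  have x2': "x \<cdot> (e \<cdot> (f \<cdot> (x \<cdot> y))) = x \<cdot> y" for y
    using x2 by (metis assoc)
  have fx: "f \<cdot> (x \<cdot> e) = x" unfolding x_def
    by (rule star_unique) (use x1 x2' in \<open>simp_all add: assoc ee' x_def\<close>)
  have "x \<cdot> x = (f \<cdot> (x \<cdot> e)) \<cdot> (f \<cdot> (x \<cdot> e))" by (simp only: fx)
  also have "\<dots> = f \<cdot> (x \<cdot> e)" by (simp add: assoc x2')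
  finally have "x \<in> idems m" by (simp add: fx idems_iff)
  then have "star x = x" by (rule idem_star)
  then show ?thesis using \<open>x \<in> idems m\<close> by (simp add: x_def)
qed

text \<open>Both products are idempotent, so \<open>f \<cdot> e\<close> satisfies the equations of
  an inverse of \<open>e \<cdot> f\<close>, while the latter, being idempotent, is its own
  inverse.\<close>

lemma idem_comm: assumes e: "e \<in> idems m" and f: "f \<in> idems m" shows "e \<cdot> f = f \<cdot> e"
proof -
  have ee: "e \<cdot> e = e" "f \<cdot> f = f" using e f by (simp_all add: idems_iff)
  have ee': "e \<cdot> (e \<cdot> x) = e \<cdot> x" "f \<cdot> (f \<cdot> x) = f \<cdot> x" for x
    using ee by (metis assoc)+
  have i: "e \<cdot> (f \<cdot> (e \<cdot> f)) = e \<cdot> f" "f \<cdot> (e \<cdot> (f \<cdot> e)) = f \<cdot> e"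
    using idem_mult[OF e f] idem_mult[OF f e] by (simp_all add: idems_iff assoc)
  have "f \<cdot> e = star (e \<cdot> f)"
    by (rule star_unique) (use i in \<open>simp_all add: assoc ee'\<close>)
  then show ?thesis using idem_star[OF idem_mult[OF e f]] by simp
qed

lemma idem_src: "star s \<cdot> s \<in> idems m" and idem_rng: "s \<cdot> star s \<in> idems m"
  by (simp_all add: idems_iff assoc star1 star2)

lemma star_mult: "star (s \<cdot> t) = star t \<cdot> star s"
proof (rule star_unique[symmetric])
  have c: "t \<cdot> star t \<cdot> (star s \<cdot> s) = star s \<cdot> s \<cdot> (t \<cdot> star t)"
    by (rule idem_comm[OF idem_rng idem_src])
  have "s \<cdot> t \<cdot> (star t \<cdot> star s \<cdot> (s \<cdot> t)) = s \<cdot> (t \<cdot> star t \<cdot> (star s \<cdot> s)) \<cdot> t"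
    by (simp add: assoc)
  also have "\<dots> = s \<cdot> t" unfolding c by (simp add: assoc star1 star1')
  finally show "s \<cdot> t \<cdot> (star t \<cdot> star s \<cdot> (s \<cdot> t)) = s \<cdot> t" .
  have "star t \<cdot> star s \<cdot> (s \<cdot> t \<cdot> (star t \<cdot> star s)) =
    star t \<cdot> (star s \<cdot> s \<cdot> (t \<cdot> star t)) \<cdot> star s"
    by (simp add: assoc)
  also have "\<dots> = star t \<cdot> star s" unfolding c[symmetric] by (simp add: assoc star2 star2')
  finally show "star t \<cdot> star s \<cdot> (s \<cdot> t \<cdot> (star t \<cdot> star s)) = star t \<cdot> star s" .
qed

lemma conj_idem: assumes "e \<in> idems m" shows "star t \<cdot> (e \<cdot> t) \<in> idems m"
proof -
  have "star t \<cdot> (e \<cdot> t) \<cdot> (star t \<cdot> (e \<cdot> t)) = star t \<cdot> (e \<cdot> (t \<cdot> star t) \<cdot> (e \<cdot> t))"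
    by (simp add: assoc)
  also have "\<dots> = star t \<cdot> (t \<cdot> star t \<cdot> e \<cdot> (e \<cdot> t))"
    by (simp only: idem_comm[OF assms idem_rng])
  also have "\<dots> = star t \<cdot> (e \<cdot> t)" using assms by (metis assoc idems_iff star2')
  finally show ?thesis by (simp add: idems_iff)
qed

text \<open>The natural order is restriction by an idempotent; the definition supplies
  \<open>star s \<cdot> s\<close> as that idempotent.\<close>

lemma ile_right_idem: "ile m s t \<longleftrightarrow> (\<exists>e\<in>idems m. s = t \<cdot> e)"
proof
  assume "ile m s t"
  then show "\<exists>e\<in>idems m. s = t \<cdot> e"
    by (intro bexI[of _ "star s \<cdot> s"] idem_src) (simp add: ile_def assoc)
next
  assume "\<exists>e\<in>idems m. s = t \<cdot> e"
  then obtain e where e: "e \<in> idems m" and s: "s = t \<cdot> e" by blast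
  have "t \<cdot> star s \<cdot> s = t \<cdot> (e \<cdot> (star t \<cdot> t)) \<cdot> e"
    by (simp add: s star_mult idem_star[OF e] assoc)
  also have "\<dots> = t \<cdot> (star t \<cdot> t \<cdot> e) \<cdot> e" by (simp only: idem_comm[OF e idem_src])
  also have "\<dots> = s" using e by (simp add: s assoc star1' idems_iff)
  finally show "ile m s t" by (simp add: ile_def)
qed

text \<open>An idempotent moves across \<open>t\<close> at the price of a conjugation:
  \<open>t \<cdot> e\<close> equals \<open>(t \<cdot> e \<cdot> star t) \<cdot> t\<close>, and
  \<open>e \<cdot> t\<close> equals \<open>t \<cdot> (star t \<cdot> e \<cdot> t)\<close>.\<close>

lemma ile_left_idem: "ile m s t \<longleftrightarrow> (\<exists>e\<in>idems m. s = e \<cdot> t)"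
proof
  assume "ile m s t"
  then obtain e where e: "e \<in> idems m" and s: "s = t \<cdot> e" by (auto simp: ile_right_idem)
  have "s = t \<cdot> (star t \<cdot> t \<cdot> e)" by (simp add: s assoc star1')
  also have "\<dots> = t \<cdot> (e \<cdot> (star t \<cdot> t))" by (simp only: idem_comm[OF idem_src e])
  also have "\<dots> = t \<cdot> (e \<cdot> star t) \<cdot> t" by (simp add: assoc)
  finally have "s = star (star t) \<cdot> (e \<cdot> star t) \<cdot> t" by simp
  then show "\<exists>e\<in>idems m. s = e \<cdot> t" using conj_idem[OF e, of "star t"] by blast
next
  assume "\<exists>e\<in>idems m. s = e \<cdot> t"
  then obtain e where e: "e \<in> idems m" and s: "s = e \<cdot> t" by blast
  have "s = e \<cdot> (t \<cdot> star t) \<cdot> t" by (simp add: s assoc star1)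
  also have "\<dots> = t \<cdot> (star t \<cdot> (e \<cdot> t))" by (simp add: idem_comm[OF e idem_rng] assoc)
  finally show "ile m s t" using conj_idem[OF e] by (auto simp: ile_right_idem)
qed

lemma ile_refl: "ile m s s"
  by (simp add: ile_def assoc star1)

lemma ile_trans: assumes "ile m r s" "ile m s t" shows "ile m r t"
proof -
  obtain e f where "e \<in> idems m" "r = s \<cdot> e" "f \<in> idems m" "s = t \<cdot> f"
    using assms by (auto simp: ile_right_idem)
  then show ?thesis using idem_mult[of f e] by (auto simp: ile_right_idem assoc)
qed

lemma ile_mult_idem: "e \<in> idems m \<Longrightarrow> ile m (s \<cdot> e) s"
  by (auto simp: ile_right_idem)

lemma ile_idem_mult: "e \<in> idems m \<Longrightarrow> ile m (e \<cdot> s) s"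
  by (auto simp: ile_left_idem)

lemma ile_mult: assumes "ile m s s'" "ile m t t'" shows "ile m (s \<cdot> t) (s' \<cdot> t')"
proof -
  \<comment> \<open>The left form for \<open>s\<close> and the right form for \<open>t\<close> put
    both idempotents on the outside of the product.\<close>
  obtain e f where "e \<in> idems m" "s = e \<cdot> s'" "f \<in> idems m" "t = t' \<cdot> f"
    using assms unfolding ile_left_idem[of s] ile_right_idem[of t] by blast
  then have "s \<cdot> t = e \<cdot> (s' \<cdot> t' \<cdot> f)" by (simp add: assoc)
  then show ?thesis
    using ile_trans[OF ile_idem_mult[OF \<open>e \<in> _\<close>] ile_mult_idem[OF \<open>f \<in> _\<close>]] by simp
qed

lemma ile_star: assumes "ile m s t" shows "ile m (star s) (star t)"
proof -
  obtain e where e: "e \<in> idems m" "s = t \<cdot> e" using assms by (auto simp: ile_right_idem)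
  then show ?thesis by (simp add: star_mult idem_star ile_idem_mult)
qed

end

section \<open>Partial actions and germs\<close>

locale paction =
  fixes P :: "('s, 'x) pact"
  assumes partial_action: "partial_action P"
begin

sublocale inv_semigroup "smul P"
  using partial_action by unfold_locales (simp add: partial_action_def)

abbreviation prod_s (infixl "\<cdot>" 70) where "s \<cdot> t \<equiv> smul P s t"
abbreviation idm where "idm \<equiv> idems (smul P)"
abbreviation le where "le \<equiv> ile (smul P)"
abbreviation dom where "dom s \<equiv> pdom P (star s)"
abbreviation act where "act \<equiv> pmap P"
abbreviation X where "X \<equiv> ptop P"
abbreviation gm where "gm \<equiv> germ P"
abbreviation G where "G \<equiv> germ_gpd P"

lemma openin_pdom: "openin X (pdom P s)"
  and act_homeo: "homeomorphic_map (subtopology X (dom s)) (subtopology X (pdom P s)) (act s)"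
  and act_star: "x \<in> dom s \<Longrightarrow> act (star s) (act s x) = x"
  and topspace_X: "topspace X = (\<Union>e\<in>idm. pdom P e)"
  using partial_action by (simp_all add: partial_action_def)

lemma le_dom: "le s t \<Longrightarrow> x \<in> dom s \<Longrightarrow> x \<in> dom t"
  and le_act: "le s t \<Longrightarrow> x \<in> dom s \<Longrightarrow> act s x = act t x"
  using partial_action unfolding partial_action_def by (meson subsetD)+

lemma dom_mult: "x \<in> dom t \<Longrightarrow> act t x \<in> dom s \<Longrightarrow> x \<in> dom (s \<cdot> t)"
  and act_mult: "x \<in> dom t \<Longrightarrow> act t x \<in> dom s \<Longrightarrow> act (s \<cdot> t) x = act s (act t x)"
  using partial_action unfolding partial_action_def by meson+

lemma pdom_topspace: "x \<in> pdom P s \<Longrightarrow> x \<in> topspace X"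
  using openin_pdom openin_subset by blast

lemma act_image: "act s ` dom s = pdom P s"
proof -
  have "act s ` topspace (subtopology X (dom s)) = topspace (subtopology X (pdom P s))"
    using act_homeo homeomorphic_imp_surjective_map by blast
  moreover have "topspace X \<inter> pdom P r = pdom P r" for r using pdom_topspace by blast
  ultimately show ?thesis by simp
qed

lemma act_dom: "x \<in> dom s \<Longrightarrow> act s x \<in> pdom P s"
  using act_image by blast

lemma act_dom': "x \<in> pdom P s \<Longrightarrow> act (star s) x \<in> dom s"
  using act_dom[of x "star s"] by simp

lemma act_star': "x \<in> pdom P s \<Longrightarrow> act s (act (star s) x) = x"
  using act_star[of x "star s"] by simp

lemma le_pdom: "le s t \<Longrightarrow> x \<in> pdom P s \<Longrightarrow> x \<in> pdom P t"
  using le_dom[OF ile_star, of s t x] by simp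

lemma idem_dom: "e \<in> idm \<Longrightarrow> dom e = pdom P e"
  by (simp add: idem_star)

text \<open>The map of \<open>e\<close> is its own inverse, and composed with itself it agrees with
  itself, so it fixes every point.\<close>

lemma act_idem: assumes "e \<in> idm" "x \<in> pdom P e" shows "act e x = x"
proof -
  have x: "x \<in> dom e" using assms by (simp add: idem_dom)
  have y: "act e x \<in> dom e" using act_dom[OF x] assms by (simp add: idem_dom)
  have "act e (act e x) = act e x" using act_mult[OF x y] assms(1) by (simp add: idems_iff)
  then show ?thesis using act_star[OF x] assms(1) by (simp add: idem_star)
qed

lemma src_dom: "x \<in> dom s \<Longrightarrow> x \<in> pdom P (star s \<cdot> s)"
  using dom_mult[of x s "star s"] act_dom[of x s] by (simp add: star_mult)

lemma rng_dom: "x \<in> dom s \<Longrightarrow> act s x \<in> pdom P (s \<cdot> star s)"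
  using src_dom[of "act s x" "star s"] act_dom[of x s] by simp

lemma dom_mult_idem: "x \<in> dom s \<Longrightarrow> e \<in> idm \<Longrightarrow> x \<in> pdom P e \<Longrightarrow> x \<in> dom (s \<cdot> e)"
  using dom_mult[of x e s] by (simp add: idem_dom act_idem)

text \<open>Elements below the same \<open>t\<close> are compatible:
  \<open>u \<cdot> (star v \<cdot> v)\<close> and \<open>v \<cdot> (star u \<cdot> u)\<close> are
  both \<open>t\<close> cut down by the two source idempotents, which commute. This makes the germ
  relation transitive.\<close>

lemma ile_common: assumes "le u t" "le v t" "x \<in> dom u" "x \<in> dom v"
  shows "\<exists>w. le w u \<and> le w v \<and> x \<in> dom w"
proof (intro exI conjI)
  let ?w = "u \<cdot> (star v \<cdot> v)"
  show "le ?w u" by (rule ile_mult_idem[OF idem_src])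
  have u: "u = t \<cdot> (star u \<cdot> u)" and v: "v = t \<cdot> (star v \<cdot> v)"
    using assms by (simp_all add: ile_def assoc)
  have "?w = t \<cdot> (star u \<cdot> u) \<cdot> (star v \<cdot> v)" by (simp only: u[symmetric])
  also have "\<dots> = t \<cdot> (star u \<cdot> u \<cdot> (star v \<cdot> v))" by (simp only: assoc)
  also have "\<dots> = t \<cdot> (star v \<cdot> v \<cdot> (star u \<cdot> u))" by (simp only: idem_comm[OF idem_src idem_src])
  also have "\<dots> = t \<cdot> (star v \<cdot> v) \<cdot> (star u \<cdot> u)" by (simp only: assoc)
  also have "\<dots> = v \<cdot> (star u \<cdot> u)" by (simp only: v[symmetric])
  finally show "le ?w v" by (simp only: ile_mult_idem[OF idem_src])
  show "x \<in> dom ?w" using assms by (intro dom_mult_idem idem_src src_dom)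
qed

lemma germ_rel_trans: assumes "germ_rel P p q" "germ_rel P q r" shows "germ_rel P p r"
proof -
  obtain u v where uv: "le u (fst p)" "le u (fst q)" "snd p \<in> dom u"
      "le v (fst q)" "le v (fst r)" "snd p \<in> dom v" and eq: "snd p = snd r"
    using assms by (auto simp: germ_rel_def)
  obtain w where "le w u" "le w v" "snd p \<in> dom w"
    using ile_common[OF uv(2,4,3,6)] by blast
  then show ?thesis using ile_trans uv eq unfolding germ_rel_def by blast
qed

lemma germ_rel_sym: "germ_rel P p q \<Longrightarrow> germ_rel P q p"
  unfolding germ_rel_def by auto

lemma germ_self: "x \<in> dom s \<Longrightarrow> (s, x) \<in> gm s x"
  unfolding germ_def SX_def germ_rel_def using ile_refl by auto

lemma germ_eq_iff: assumes "x \<in> dom s" "y \<in> dom t"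
  shows "gm s x = gm t y \<longleftrightarrow> x = y \<and> (\<exists>u. le u s \<and> le u t \<and> x \<in> dom u)"
proof -
  have "gm s x = gm t y \<longleftrightarrow> germ_rel P (s, x) (t, y)"
  proof
    assume "gm s x = gm t y"
    then have "(t, y) \<in> gm s x" using germ_self[OF assms(2)] by simp
    then show "germ_rel P (s, x) (t, y)" by (simp add: germ_def)
  next
    assume "germ_rel P (s, x) (t, y)"
    then show "gm s x = gm t y"
      unfolding germ_def using germ_rel_trans germ_rel_sym by blast
  qed
  then show ?thesis by (auto simp: germ_rel_def)
qed

lemma germ_le: "le u s \<Longrightarrow> x \<in> dom u \<Longrightarrow> gm u x = gm s x"
  using germ_eq_iff[of x u x s] le_dom ile_refl by blast

text \<open>All pairs in a germ share their second component; this is that point of the space,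
  whereas \<open>gsrc\<close> returns a germ.\<close>

definition pt :: "('s \<times> 'x) set \<Rightarrow> 'x" where "pt g = snd (SOME p. p \<in> g)"

text \<open>The groupoid operations evaluate a representative chosen by \<open>SOME\<close>; the
  formulas \<open>gmul_germ\<close> and \<open>ginv_germ\<close> rest on this description of the
  choice.\<close>

lemma germ_rep: assumes "x \<in> dom s"
  obtains r where "(SOME p. p \<in> gm s x) = (r, x)" "x \<in> dom r" "gm r x = gm s x"
proof -
  have "(SOME p. p \<in> gm s x) \<in> gm s x" using someI[of "\<lambda>p. p \<in> gm s x"] germ_self[OF assms] by blast
  then have *: "(SOME p. p \<in> gm s x) \<in> SX P" "germ_rel P (s, x) (SOME p. p \<in> gm s x)"
    by (simp_all add: germ_def)
  then obtain r where r: "(SOME p. p \<in> gm s x) = (r, x)"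
    by (metis germ_rel_def prod.collapse snd_conv)
  then show thesis using that[of r] * assms germ_eq_iff[of x r x s]
    by (auto simp: SX_def germ_rel_def)
qed

lemma pt_germ [simp]: "x \<in> dom s \<Longrightarrow> pt (gm s x) = x"
  unfolding pt_def by (rule germ_rep[of x s]) auto

lemma garr_iff: "g \<in> garr G \<longleftrightarrow> (\<exists>s x. x \<in> dom s \<and> g = gm s x)"
  by (auto simp: germ_gpd_def SX_def)

lemma germ_garr: "x \<in> dom s \<Longrightarrow> gm s x \<in> garr G"
  by (auto simp: garr_iff)

lemma germ_act_eq: "x \<in> dom s \<Longrightarrow> x \<in> dom t \<Longrightarrow> gm s x = gm t x \<Longrightarrow> act s x = act t x"
  using germ_eq_iff[of x s x t] le_act by metis

text \<open>The lower bounds \<open>v\<close> and \<open>u\<close> that witness the two equalities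
  multiply to a lower bound of both products, defined at \<open>x\<close> because
  \<open>act u x\<close> is \<open>act t x\<close>.\<close>

lemma germ_mult_cong:
  assumes "x \<in> dom t" "x \<in> dom t'" "gm t x = gm t' x" "act t x \<in> dom s" "act t x \<in> dom s'"
    "gm s (act t x) = gm s' (act t x)"
  shows "gm (s \<cdot> t) x = gm (s' \<cdot> t') x"
proof -
  obtain u where u: "le u t" "le u t'" "x \<in> dom u" using assms germ_eq_iff[of x t x t'] by blast
  obtain v where v: "le v s" "le v s'" "act t x \<in> dom v"
    using assms germ_eq_iff[of "act t x" s "act t x" s'] by blast
  have "x \<in> dom (v \<cdot> u)" using u v by (intro dom_mult) (simp_all add: le_act[of u t])
  then show ?thesis using germ_le[of "v \<cdot> u"] ile_mult u v by metis
qed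

lemma germ_star_cong: assumes "x \<in> dom s" "x \<in> dom t" "gm s x = gm t x"
  shows "gm (star s) (act s x) = gm (star t) (act t x)"
proof -
  obtain u where u: "le u s" "le u t" "x \<in> dom u" using assms germ_eq_iff[of x s x t] by blast
  then have "act u x \<in> dom (star u)" using act_dom by simp
  then have "gm (star s) (act u x) = gm (star t) (act u x)"
    using germ_le[OF ile_star] u by metis
  then show ?thesis using le_act u by metis
qed

lemma gmul_germ: assumes "x \<in> dom t" "act t x \<in> dom s"
  shows "gmul G (gm s (act t x)) (gm t x) = gm (s \<cdot> t) x"
proof -
  obtain r where r: "(SOME p. p \<in> gm t x) = (r, x)" "x \<in> dom r" "gm r x = gm t x"
    by (rule germ_rep[OF assms(1)])
  obtain q where q: "(SOME p. p \<in> gm s (act t x)) = (q, act t x)" "act t x \<in> dom q"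
      "gm q (act t x) = gm s (act t x)"
    by (rule germ_rep[OF assms(2)])
  have "gmul G (gm s (act t x)) (gm t x) = gm (q \<cdot> r) x"
    by (simp add: germ_gpd_def r(1) q(1))
  also have "\<dots> = gm (s \<cdot> t) x"
    using germ_act_eq[OF r(2) assms(1) r(3)] r(2,3) q(2,3) assms by (intro germ_mult_cong) auto
  finally show ?thesis .
qed

lemma ginv_germ: assumes "x \<in> dom s" shows "ginv G (gm s x) = gm (star s) (act s x)"
proof -
  obtain r where r: "(SOME p. p \<in> gm s x) = (r, x)" "x \<in> dom r" "gm r x = gm s x"
    by (rule germ_rep[OF assms])
  have "ginv G (gm s x) = gm (star r) (act r x)" by (simp add: germ_gpd_def r(1))
  also have "\<dots> = gm (star s) (act s x)" using r assms by (intro germ_star_cong)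
  finally show ?thesis .
qed

text \<open>The unit of the germ groupoid at the point \<open>x\<close>. The choice of idempotent is
  immaterial, since the product of two of them lies below both.\<close>

definition un :: "'x \<Rightarrow> ('s \<times> 'x) set" where "un x = gm (SOME e. e \<in> idm \<and> x \<in> pdom P e) x"

lemma un_eq: assumes "e \<in> idm" "x \<in> pdom P e" shows "gm e x = un x"
proof -
  define f where "f = (SOME f. f \<in> idm \<and> x \<in> pdom P f)"
  have f: "f \<in> idm" "x \<in> pdom P f"
    using someI[of "\<lambda>f. f \<in> idm \<and> x \<in> pdom P f" e] assms by (auto simp: f_def)
  have "x \<in> dom (e \<cdot> f)" using assms f by (intro dom_mult_idem) (auto simp: idem_dom)
  then have "gm (e \<cdot> f) x = gm e x" "gm (e \<cdot> f) x = gm f x"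
    using germ_le ile_mult_idem ile_idem_mult assms f by blast+
  then show ?thesis by (simp add: un_def f_def)
qed

lemma topspace_idem: assumes "x \<in> topspace X"
  obtains e where "e \<in> idm" "x \<in> pdom P e" "x \<in> dom e" "un x = gm e x"
  using assms topspace_X un_eq idem_dom by auto

lemma pt_un [simp]: "x \<in> topspace X \<Longrightarrow> pt (un x) = x"
  by (metis topspace_idem pt_germ)

lemma un_garr: "x \<in> topspace X \<Longrightarrow> un x \<in> garr G"
  by (metis topspace_idem germ_garr)

lemma gsrc_germ: assumes "x \<in> dom s" shows "gsrc G (gm s x) = un x"
proof -
  have "gsrc G (gm s x) = gmul G (gm (star s) (act s x)) (gm s x)"
    using assms by (simp add: gsrc_def ginv_germ)
  also have "\<dots> = gm (star s \<cdot> s) x" using assms by (intro gmul_germ) (simp_all add: act_dom)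
  finally show ?thesis using un_eq[OF idem_src src_dom[OF assms]] by simp
qed

lemma grng_germ: assumes "x \<in> dom s" shows "grng G (gm s x) = un (act s x)"
proof -
  let ?y = "act s x"
  have y: "?y \<in> dom (star s)" using act_dom[OF assms] by simp
  have "grng G (gm s x) = gmul G (gm s (act (star s) ?y)) (gm (star s) ?y)"
    using assms by (simp add: grng_def ginv_germ act_star)
  also have "\<dots> = gm (s \<cdot> star s) ?y" using assms y by (intro gmul_germ) (simp_all add: act_star)
  finally show ?thesis using un_eq[OF idem_rng rng_dom[OF assms]] by simp
qed

lemma dom_topspace: "x \<in> dom s \<Longrightarrow> x \<in> topspace X" "x \<in> dom s \<Longrightarrow> act s x \<in> topspace X"
  using pdom_topspace act_dom by blast+

lemma un_inj: "x \<in> topspace X \<Longrightarrow> y \<in> topspace X \<Longrightarrow> un x = un y \<longleftrightarrow> x = y"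
  by (metis pt_un)

lemma composable_germ: "x \<in> dom t \<Longrightarrow> y \<in> dom s \<Longrightarrow>
    composable G (gm s y) (gm t x) \<longleftrightarrow> y = act t x"
  by (simp add: composable_def germ_garr gsrc_germ grng_germ un_inj dom_topspace)

lemma gunits_eq: "gunits G = un ` topspace X"
proof
  show "gunits G \<subseteq> un ` topspace X"
    by (auto simp: gunits_def garr_iff gsrc_germ dom_topspace)
  show "un ` topspace X \<subseteq> gunits G"
  proof
    fix g assume "g \<in> un ` topspace X"
    then obtain x where x: "x \<in> topspace X" "g = un x" by blast
    then obtain e where e: "x \<in> dom e" by (metis topspace_idem)
    then show "g \<in> gunits G" unfolding gunits_def using x gsrc_germ[OF e] germ_garr[OF e] by force
  qed
qed

end

section \<open>Groupoids\<close>

text \<open>The record has total operations and no laws, so associativity and the rules for source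
  and range are stated for composable pairs only.\<close>

locale groupoid =
  fixes G :: "'g tgpd"
  assumes inv_closed: "g \<in> garr G \<Longrightarrow> ginv G g \<in> garr G"
    and inv_inv: "g \<in> garr G \<Longrightarrow> ginv G (ginv G g) = g"
    and mul_closed: "composable G g h \<Longrightarrow> gmul G g h \<in> garr G"
    and mul_assoc: "composable G g h \<Longrightarrow> composable G h k \<Longrightarrow>
      gmul G (gmul G g h) k = gmul G g (gmul G h k)"
    and src_mul: "composable G g h \<Longrightarrow> gsrc G (gmul G g h) = gsrc G h"
    and rng_mul: "composable G g h \<Longrightarrow> grng G (gmul G g h) = grng G g"
    and mul_src: "g \<in> garr G \<Longrightarrow> gmul G g (gsrc G g) = g"
    and rng_mult: "g \<in> garr G \<Longrightarrow> gmul G (grng G g) g = g"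

sublocale paction \<subseteq> groupoid "germ_gpd P"
proof
  fix g h k assume "g \<in> garr G"
  then obtain s x where g: "g = gm s x" "x \<in> dom s" by (auto simp: garr_iff)
  have y: "act s x \<in> dom (star s)" using act_dom[OF g(2)] by simp
  show "ginv G g \<in> garr G" using g y by (simp add: ginv_germ germ_garr)
  show "ginv G (ginv G g) = g" using g y by (simp add: ginv_germ act_star)
  have "gmul G g (gsrc G g) = gmul G (gm s (act (star s \<cdot> s) x)) (gm (star s \<cdot> s) x)"
    using g by (simp add: gsrc_germ un_eq[OF idem_src src_dom] act_idem[OF idem_src src_dom])
  also have "\<dots> = gm (s \<cdot> (star s \<cdot> s)) x"
    using g src_dom[OF g(2)] by (intro gmul_germ)
      (simp_all add: act_idem[OF idem_src src_dom] idem_dom[OF idem_src])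
  finally show "gmul G g (gsrc G g) = g" using g by (simp add: star1)
  have "gmul G (grng G g) g = gmul G (gm (s \<cdot> star s) (act s x)) (gm s x)"
    using g by (simp add: grng_germ un_eq[OF idem_rng rng_dom])
  also have "\<dots> = gm ((s \<cdot> star s) \<cdot> s) x"
    using g rng_dom[OF g(2)] by (intro gmul_germ) (simp_all add: idem_dom[OF idem_rng])
  finally show "gmul G (grng G g) g = g" using g by (simp add: star1 assoc)
next
  fix g h assume c: "composable G g h"
  then obtain s y t x where gh: "g = gm s y" "y \<in> dom s" "h = gm t x" "x \<in> dom t"
    by (auto simp: garr_iff composable_def)
  then have y: "y = act t x" using c composable_germ by blast
  have st: "x \<in> dom (s \<cdot> t)" "act (s \<cdot> t) x = act s y" using gh dom_mult act_mult y by auto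
  have m: "gmul G g h = gm (s \<cdot> t) x" using gh y gmul_germ by simp
  show "gmul G g h \<in> garr G" "gsrc G (gmul G g h) = gsrc G h" "grng G (gmul G g h) = grng G g"
    using st gh m by (simp_all add: germ_garr gsrc_germ grng_germ)
  fix k assume c': "composable G h k"
  then obtain r z where k: "k = gm r z" "z \<in> dom r" by (auto simp: garr_iff composable_def)
  then have x: "x = act r z" using c' gh composable_germ by blast
  have tr: "z \<in> dom (t \<cdot> r)" "act (t \<cdot> r) z = act t x" using gh k dom_mult act_mult x by auto
  have "gmul G (gmul G g h) k = gm (s \<cdot> t \<cdot> r) z" using m k gmul_germ x st(1) by simp
  moreover have "gmul G h k = gm (t \<cdot> r) z" using gh k gmul_germ x by simp
  moreover have "gmul G g (gm (t \<cdot> r) z) = gm (s \<cdot> (t \<cdot> r)) z"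
    using gmul_germ[OF tr(1), of s] tr gh y by simp
  ultimately show "gmul G (gmul G g h) k = gmul G g (gmul G h k)" by (simp add: assoc)
qed

context groupoid
begin

lemma src_inv: "g \<in> garr G \<Longrightarrow> gsrc G (ginv G g) = grng G g"
  and rng_inv: "g \<in> garr G \<Longrightarrow> grng G (ginv G g) = gsrc G g"
  by (simp_all add: gsrc_def grng_def inv_inv)

lemma composable_inv: "g \<in> garr G \<Longrightarrow> composable G g (ginv G g)"
  "g \<in> garr G \<Longrightarrow> composable G (ginv G g) g"
  by (simp_all add: composable_def inv_closed src_inv rng_inv)

lemma src_garr: "g \<in> garr G \<Longrightarrow> gsrc G g \<in> garr G"
  and rng_garr: "g \<in> garr G \<Longrightarrow> grng G g \<in> garr G"
  unfolding gsrc_def grng_def using mul_closed composable_inv by blast+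

lemma src_src: "g \<in> garr G \<Longrightarrow> gsrc G (gsrc G g) = gsrc G g"
  and rng_src: "g \<in> garr G \<Longrightarrow> grng G (gsrc G g) = gsrc G g"
  and src_rng: "g \<in> garr G \<Longrightarrow> gsrc G (grng G g) = grng G g"
  and rng_rng: "g \<in> garr G \<Longrightarrow> grng G (grng G g) = grng G g"
  using src_mul[OF composable_inv(2)] rng_mul[OF composable_inv(2)]
    src_mul[OF composable_inv(1)] rng_mul[OF composable_inv(1)]
  by (simp_all add: gsrc_def[symmetric] grng_def[symmetric] src_inv rng_inv)

lemma src_unit: "g \<in> garr G \<Longrightarrow> gsrc G g \<in> gunits G"
  by (simp add: gunits_def)

lemma unitD: assumes "u \<in> gunits G"
  shows "u \<in> garr G" "gsrc G u = u" "grng G u = u" "ginv G u = u"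
proof -
  show *: "u \<in> garr G" "gsrc G u = u" "grng G u = u"
    using assms by (auto simp: gunits_def src_garr src_src rng_src)
  have "gmul G u (ginv G u) = ginv G u"
    using rng_mult[OF inv_closed[OF *(1)]] rng_inv[OF *(1)] *(2) by simp
  then show "ginv G u = u" using *(3) by (simp add: grng_def)
qed

lemma unit_iff: "u \<in> gunits G \<longleftrightarrow> u \<in> garr G \<and> gsrc G u = u"
  using unitD src_unit by metis

lemma rng_unit: "g \<in> garr G \<Longrightarrow> grng G g \<in> gunits G"
  by (simp add: unit_iff rng_garr src_rng)

lemma mul_unit_right: "u \<in> gunits G \<Longrightarrow> composable G g u \<Longrightarrow> gmul G g u = g"
  using mul_src[of g] unitD(3) by (simp add: composable_def)

lemma inv_mul_cancel: assumes "composable G g h" shows "gmul G (ginv G g) (gmul G g h) = h"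
proof -
  have g: "g \<in> garr G" and h: "h \<in> garr G" "gsrc G g = grng G h"
    using assms by (auto simp: composable_def)
  have "gmul G (ginv G g) (gmul G g h) = gmul G (gsrc G g) h"
    using mul_assoc[OF composable_inv(2)[OF g] assms] by (simp add: gsrc_def)
  then show ?thesis using rng_mult h by simp
qed

lemma mul_inv_cancel: assumes "composable G g h" shows "gmul G (gmul G g h) (ginv G h) = g"
proof -
  have g: "g \<in> garr G" and h: "h \<in> garr G" "gsrc G g = grng G h"
    using assms by (auto simp: composable_def)
  have "gmul G (gmul G g h) (ginv G h) = gmul G g (grng G h)"
    using mul_assoc[OF assms composable_inv(1)[OF h(1)]] by (simp add: grng_def)
  then show ?thesis using mul_src[OF g] h by simp
qed

lemma composable_inv_left: "g \<in> garr G \<Longrightarrow> h \<in> garr G \<Longrightarrow> grng G g = grng G h \<Longrightarrow>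
  composable G (ginv G g) h"
  by (simp add: composable_def inv_closed src_inv)

lemma mul_inv_mul: assumes "g \<in> garr G" "h \<in> garr G" "grng G g = grng G h"
  shows "gmul G g (gmul G (ginv G g) h) = h"
  using inv_mul_cancel[OF composable_inv_left[OF assms]] assms(1) by (simp add: inv_inv)

lemma inv_mul_facts: assumes "g \<in> garr G" "h \<in> garr G" "grng G g = grng G h"
  shows "gmul G (ginv G g) h \<in> garr G" "gsrc G (gmul G (ginv G g) h) = gsrc G h"
    "grng G (gmul G (ginv G g) h) = gsrc G g"
  using composable_inv_left[OF assms] mul_closed src_mul rng_mul assms by (auto simp: rng_inv)

text \<open>Multiplying \<open>gmul G (ginv G g) h\<close> on the left by \<open>g\<close> gives
  \<open>h\<close> by cancellation, and gives \<open>g\<close> if the factor is a unit. This is the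
  test for equality of arrows with a common range.\<close>

lemma inv_mul_unit_iff: assumes "g \<in> garr G" "h \<in> garr G" "grng G g = grng G h"
  shows "gmul G (ginv G g) h \<in> gunits G \<longleftrightarrow> g = h"
proof
  assume u: "gmul G (ginv G g) h \<in> gunits G"
  have c: "composable G g (gmul G (ginv G g) h)"
    using inv_mul_facts[OF assms] assms by (simp add: composable_def)
  show "g = h" using mul_unit_right[OF u c] mul_inv_mul[OF assms] by simp
next
  assume "g = h"
  then show "gmul G (ginv G g) h \<in> gunits G" using assms src_unit by (auto simp: gsrc_def)
qed

lemma mul_idem_unit: assumes "composable G g g" "gmul G g g = g" shows "g \<in> gunits G"
  using inv_mul_cancel[OF assms(1)] assms src_unit[of g] by (simp add: gsrc_def composable_def)

lemma inv_inj: "g \<in> garr G \<Longrightarrow> h \<in> garr G \<Longrightarrow> ginv G g = ginv G h \<Longrightarrow> g = h"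
  using inv_inv by metis

end

section \<open>Ample Hausdorff groupoids and their compact open bisections\<close>

text \<open>Continuity of the operations enters through \<open>mul_Ga\<close> and
  \<open>inv_Ga\<close>: compact open bisections are stable under products and inversion. By
  \<open>base\<close> there are enough of them.\<close>

locale hausdorff_ample = groupoid +
  assumes topspace_garr: "topspace (gtop G) = garr G"
    and hausdorff: "Hausdorff_space (gtop G)"
    and base: "openin (gtop G) W \<Longrightarrow> g \<in> W \<Longrightarrow> \<exists>U\<in>Ga G. g \<in> U \<and> U \<subseteq> W"
    and mul_Ga: "U \<in> Ga G \<Longrightarrow> V \<in> Ga G \<Longrightarrow> bis_mul G U V \<in> Ga G"
    and inv_Ga: "U \<in> Ga G \<Longrightarrow> ginv G ` U \<in> Ga G"
begin

lemma GaD: assumes "U \<in> Ga G"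
  shows "U \<subseteq> garr G" "inj_on (gsrc G) U" "inj_on (grng G) U" "openin (gtop G) U"
    "compactin (gtop G) U" "closedin (gtop G) U"
  using assms compactin_imp_closedin[OF hausdorff] by (auto simp: Ga_def bisection_def)

lemma Ga_subset: "U \<in> Ga G \<Longrightarrow> V \<subseteq> U \<Longrightarrow> openin (gtop G) V \<Longrightarrow> compactin (gtop G) V \<Longrightarrow> V \<in> Ga G"
  unfolding Ga_def bisection_def using inj_on_subset by blast

lemma Ga_Int_clopen: assumes "U \<in> Ga G" "openin (gtop G) V" "closedin (gtop G) V"
  shows "U \<inter> V \<in> Ga G"
proof (rule Ga_subset[OF assms(1)])
  show "openin (gtop G) (U \<inter> V)" using GaD[OF assms(1)] assms by blast
  show "compactin (gtop G) (U \<inter> V)"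
    using closed_Int_compactin[OF assms(3) GaD(5)[OF assms(1)]] by (simp add: Int_commute)
qed simp

lemma Ga_Int: "U \<in> Ga G \<Longrightarrow> V \<in> Ga G \<Longrightarrow> U \<inter> V \<in> Ga G"
  by (rule Ga_Int_clopen) (auto intro: GaD(4,6))

lemma Ga_Diff_clopen: assumes "U \<in> Ga G" "openin (gtop G) V" "closedin (gtop G) V"
  shows "U - V \<in> Ga G"
proof -
  have "U \<inter> (topspace (gtop G) - V) \<in> Ga G"
    by (rule Ga_Int_clopen) (use assms in auto)
  moreover have "U \<inter> (topspace (gtop G) - V) = U - V" using GaD(1)[OF assms(1)] topspace_garr
    by auto
  ultimately show ?thesis by simp
qed

lemma Ga_Diff: "U \<in> Ga G \<Longrightarrow> V \<in> Ga G \<Longrightarrow> U - V \<in> Ga G"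
  by (rule Ga_Diff_clopen) (auto intro: GaD(4,6))

lemma Ga_empty: "{} \<in> Ga G"
  by (auto simp: Ga_def bisection_def)

lemma bis_mulI: "u \<in> U \<Longrightarrow> v \<in> V \<Longrightarrow> composable G u v \<Longrightarrow> gmul G u v \<in> bis_mul G U V"
  by (auto simp: bis_mul_def)

lemma bis_mulE: assumes "g \<in> bis_mul G U V"
  obtains u v where "u \<in> U" "v \<in> V" "composable G u v" "g = gmul G u v"
  using assms by (auto simp: bis_mul_def)

text \<open>Written as a product, the source image is seen to be a compact open bisection again.
  Injectivity of the range on \<open>U\<close> forces the two factors to come from the same
  arrow.\<close>

lemma bis_mul_inv_left: assumes "U \<in> Ga G" shows "bis_mul G (ginv G ` U) U = gsrc G ` U"
proof
  show "bis_mul G (ginv G ` U) U \<subseteq> gsrc G ` U"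
  proof
    fix g assume "g \<in> bis_mul G (ginv G ` U) U"
    then obtain u v where uv: "u \<in> U" "v \<in> U" "composable G (ginv G u) v" "g = gmul G (ginv G u) v"
      by (auto elim: bis_mulE)
    then have "grng G u = grng G v" using GaD[OF assms] by (auto simp: composable_def src_inv)
    then have "u = v" using GaD(3)[OF assms] uv by (auto dest: inj_onD)
    then show "g \<in> gsrc G ` U" using uv by (auto simp: gsrc_def)
  qed
  show "gsrc G ` U \<subseteq> bis_mul G (ginv G ` U) U"
  proof
    fix g assume "g \<in> gsrc G ` U"
    then obtain u where "u \<in> U" "g = gmul G (ginv G u) u" by (auto simp: gsrc_def)
    then show "g \<in> bis_mul G (ginv G ` U) U"
      using GaD(1)[OF assms] by (simp add: bis_mulI composable_inv(2) subsetD)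
  qed
qed

lemma bis_mul_inv_right: assumes "U \<in> Ga G" shows "bis_mul G U (ginv G ` U) = grng G ` U"
proof
  show "bis_mul G U (ginv G ` U) \<subseteq> grng G ` U"
  proof
    fix g assume "g \<in> bis_mul G U (ginv G ` U)"
    then obtain u v where uv: "u \<in> U" "v \<in> U" "composable G u (ginv G v)" "g = gmul G u (ginv G v)"
      by (auto elim: bis_mulE)
    then have "gsrc G u = gsrc G v" using GaD[OF assms] by (auto simp: composable_def rng_inv)
    then have "u = v" using GaD(2)[OF assms] uv by (auto dest: inj_onD)
    then show "g \<in> grng G ` U" using uv by (auto simp: grng_def)
  qed
  show "grng G ` U \<subseteq> bis_mul G U (ginv G ` U)"
  proof
    fix g assume "g \<in> grng G ` U"
    then obtain u where "u \<in> U" "g = gmul G u (ginv G u)" by (auto simp: grng_def)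
    then show "g \<in> bis_mul G U (ginv G ` U)"
      using GaD(1)[OF assms] by (simp add: bis_mulI composable_inv(1) subsetD)
  qed
qed

lemma Ga_src: "U \<in> Ga G \<Longrightarrow> gsrc G ` U \<in> Ga G"
  using mul_Ga[OF inv_Ga] bis_mul_inv_left by metis

lemma Ga_rng: "U \<in> Ga G \<Longrightarrow> grng G ` U \<in> Ga G"
  using mul_Ga[OF _ inv_Ga] bis_mul_inv_right by metis

lemma bis_mul_units: assumes "U \<subseteq> garr G" "E \<subseteq> gunits G"
  shows "bis_mul G U E = {u \<in> U. gsrc G u \<in> E}"
proof
  show "bis_mul G U E \<subseteq> {u \<in> U. gsrc G u \<in> E}"
    using mul_unit_right assms by (force elim!: bis_mulE simp: composable_def unitD)
  show "{u \<in> U. gsrc G u \<in> E} \<subseteq> bis_mul G U E"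
  proof
    fix u assume u: "u \<in> {u \<in> U. gsrc G u \<in> E}"
    then have "composable G u (gsrc G u)" using assms
      by (auto simp: composable_def src_garr rng_src)
    then have "gmul G u (gsrc G u) \<in> bis_mul G U E" using u by (intro bis_mulI) auto
    then show "u \<in> bis_mul G U E" using u assms mul_src by auto
  qed
qed

lemma Ga_restrict_src: assumes "U \<in> Ga G" "V \<in> Ga G"
  shows "{u \<in> U. gsrc G u \<in> gsrc G ` V} \<in> Ga G"
proof -
  have "gsrc G ` V \<subseteq> gunits G" using GaD(1)[OF assms(2)] src_unit by auto
  then show ?thesis
    using bis_mul_units[OF GaD(1)[OF assms(1)]] mul_Ga[OF assms(1) Ga_src[OF assms(2)]] by simp
qed

text \<open>An arrow \<open>g\<close> of \<open>E\<close> is a product of some \<open>a\<close> and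
  \<open>b\<close> in \<open>E\<close>. It shares its range with \<open>a\<close> and its source
  with \<open>b\<close>, so both are equal to \<open>g\<close>, and \<open>g\<close> is its own
  square.\<close>

lemma Ga_idem_units: assumes "E \<in> Ga G" "bis_mul G E E = E" shows "E \<subseteq> gunits G"
proof
  fix g assume g: "g \<in> E"
  then obtain a b where ab: "a \<in> E" "b \<in> E" "composable G a b" "g = gmul G a b"
    using assms(2) bis_mulE by metis
  have "a = g" using GaD(3)[OF assms(1)] g ab by (metis inj_onD rng_mul)
  moreover have "b = g" using GaD(2)[OF assms(1)] g ab by (metis inj_onD src_mul)
  ultimately show "g \<in> gunits G" using ab mul_idem_unit by metis
qed

lemma bis_mul_unit_idem: assumes "E \<subseteq> gunits G" shows "bis_mul G E E = E"
proof -
  have "E \<subseteq> garr G" using assms unitD(1) by blast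
  then have "bis_mul G E E = {u \<in> E. gsrc G u \<in> E}" by (rule bis_mul_units[OF _ assms])
  also have "\<dots> = E" using assms unitD(2) by force
  finally show ?thesis .
qed

text \<open>Inclusion is the natural partial order of the semigroup: restricting \<open>V\<close> to
  the sources of \<open>U\<close> recovers \<open>U\<close>. Being expressed by the product alone,
  it is preserved by every multiplicative bijection.\<close>

lemma Ga_subset_iff: assumes "U \<in> Ga G" "V \<in> Ga G"
  shows "U \<subseteq> V \<longleftrightarrow> (\<exists>E\<in>Ga G. bis_mul G E E = E \<and> U = bis_mul G V E)"
proof
  assume s: "U \<subseteq> V"
  have e: "gsrc G ` U \<subseteq> gunits G" using GaD(1)[OF assms(1)] src_unit by auto
  have "bis_mul G V (gsrc G ` U) = {v \<in> V. gsrc G v \<in> gsrc G ` U}"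
    using bis_mul_units[OF GaD(1)[OF assms(2)] e] .
  also have "\<dots> = U" using s GaD(2)[OF assms(2)] by (auto dest: inj_onD)
  finally show "\<exists>E\<in>Ga G. bis_mul G E E = E \<and> U = bis_mul G V E"
    using Ga_src[OF assms(1)] bis_mul_unit_idem[OF e] by blast
next
  assume "\<exists>E\<in>Ga G. bis_mul G E E = E \<and> U = bis_mul G V E"
  then show "U \<subseteq> V" using bis_mul_units[OF GaD(1)[OF assms(2)] Ga_idem_units] by auto
qed

end

lemma sg_isomorphic_trans: "sg_isomorphic A ma B mb \<Longrightarrow> sg_isomorphic B mb C mc \<Longrightarrow>
  sg_isomorphic A ma C mc"
proof -
  assume "sg_isomorphic A ma B mb" "sg_isomorphic B mb C mc"
  then obtain \<phi> \<psi> where *: "bij_betw \<phi> A B" "\<forall>x\<in>A. \<forall>y\<in>A. \<phi> (ma x y) = mb (\<phi> x) (\<phi> y)"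
    "bij_betw \<psi> B C" "\<forall>x\<in>B. \<forall>y\<in>B. \<psi> (mb x y) = mc (\<psi> x) (\<psi> y)"
    unfolding sg_isomorphic_def by blast
  then have "bij_betw (\<psi> \<circ> \<phi>) A C" using bij_betw_trans by blast
  moreover have "\<forall>x\<in>A. \<forall>y\<in>A. (\<psi> \<circ> \<phi>) (ma x y) = mc ((\<psi> \<circ> \<phi>) x) ((\<psi> \<circ> \<phi>) y)"
    using * bij_betwE[OF *(1)] by simp
  ultimately show ?thesis unfolding sg_isomorphic_def by blast
qed

lemma sg_isomorphic_sym:
  assumes closed: "\<And>x y. x \<in> A \<Longrightarrow> y \<in> A \<Longrightarrow> ma x y \<in> A" and iso: "sg_isomorphic A ma B mb"
  shows "sg_isomorphic B mb A ma"
proof -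
  obtain \<phi> where \<phi>: "bij_betw \<phi> A B" "\<forall>x\<in>A. \<forall>y\<in>A. \<phi> (ma x y) = mb (\<phi> x) (\<phi> y)"
    using iso unfolding sg_isomorphic_def by blast
  let ?\<psi> = "inv_into A \<phi>"
  have "?\<psi> (mb x y) = ma (?\<psi> x) (?\<psi> y)" if "x \<in> B" "y \<in> B" for x y
  proof -
    have m: "?\<psi> x \<in> A" "?\<psi> y \<in> A" using that \<phi>(1) bij_betwE bij_betw_inv_into by metis+
    have "\<phi> (ma (?\<psi> x) (?\<psi> y)) = mb x y"
      using \<phi> m that by (simp add: bij_betw_inv_into_right)
    then show ?thesis using closed[OF m] \<phi>(1) by (metis bij_betw_inv_into_left)
  qed
  then show ?thesis unfolding sg_isomorphic_def using bij_betw_inv_into[OF \<phi>(1)] by blast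
qed

section \<open>The groupoid from its inverse semigroup of bisections\<close>

text \<open>Points of \<open>G\<close> are the prime filters of compact open bisections, so an order isomorphism
  between these moves points.\<close>

lemma order_iso_points:
  assumes G: "hausdorff_ample G" and H: "hausdorff_ample H"
    and bij: "bij_betw \<phi> (Ga G) (Ga H)"
    and ord: "\<And>U V. U \<in> Ga G \<Longrightarrow> V \<in> Ga G \<Longrightarrow> U \<subseteq> V \<longleftrightarrow> \<phi> U \<subseteq> \<phi> V"
    and g: "g \<in> garr G"
  shows "\<exists>!h. h \<in> garr H \<and> (\<forall>U\<in>Ga G. g \<in> U \<longleftrightarrow> h \<in> \<phi> U)"
proof -
  interpret G: hausdorff_ample G by fact
  interpret H: hausdorff_ample H by fact
  have mem: "\<phi> U \<in> Ga H" if "U \<in> Ga G" for U using bij that bij_betwE by blast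
  have surj: "\<exists>U\<in>Ga G. V = \<phi> U" if "V \<in> Ga H" for V using bij that
    by (metis bij_betw_imp_surj_on imageE)
  have empty: "\<phi> {} = {}"
    using surj[OF H.Ga_empty] ord[OF G.Ga_empty] by (metis empty_subsetI subset_empty)
  have disj: "\<phi> U \<inter> \<phi> V = {}" if UV: "U \<in> Ga G" "V \<in> Ga G" "U \<inter> V = {}" for U V
  proof -
    \<comment> \<open>The intersection is itself of the form \<open>\<phi> W\<close>, and reflecting
      the order puts \<open>W\<close> inside the empty set.\<close>
    obtain W where W: "W \<in> Ga G" "\<phi> U \<inter> \<phi> V = \<phi> W" using surj H.Ga_Int mem UV by metis
    then have "W \<subseteq> U" "W \<subseteq> V" using ord UV by blast+
    then show ?thesis using W UV empty by (metis le_inf_iff subset_empty)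
  qed
  \<comment> \<open>The images of the neighbourhoods of \<open>g\<close>. The point sought lies in
    all of them, and compactness of \<open>\<phi> U0\<close> provides it through finite
    intersections.\<close>
  let ?F = "{\<phi> U | U. U \<in> Ga G \<and> g \<in> U}"
  obtain U0 where U0: "U0 \<in> Ga G" "g \<in> U0" using G.base[of "garr G" g] g G.topspace_garr
    by (metis openin_topspace)
  have fin: "\<exists>U\<in>Ga G. g \<in> U \<and> \<phi> U \<subseteq> \<phi> U0 \<inter> \<Inter>\<F>" if "finite \<F>" "\<F> \<subseteq> ?F" for \<F>
    using that
  proof (induction \<F>)
    case empty then show ?case using U0 by auto
  next
    case (insert V \<F>)
    then obtain U U' where U: "U \<in> Ga G" "g \<in> U" "\<phi> U \<subseteq> \<phi> U0 \<inter> \<Inter>\<F>" "U' \<in> Ga G" "g \<in> U'" "V = \<phi> U'"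
      by auto
    have "\<phi> (U \<inter> U') \<subseteq> \<phi> U" "\<phi> (U \<inter> U') \<subseteq> \<phi> U'"
      using ord[OF G.Ga_Int[OF U(1,4)] U(1)] ord[OF G.Ga_Int[OF U(1,4)] U(4)] by auto
    then show ?case using U G.Ga_Int[of U U'] by (intro bexI[of _ "U \<inter> U'"]) auto
  qed
  have "\<phi> U0 \<inter> \<Inter>?F \<noteq> {}"
  proof -
    have "compactin (gtop H) (\<phi> U0)" using H.GaD(5) mem U0 by blast
    moreover have "\<forall>C\<in>?F. closedin (gtop H) C" using H.GaD(6) mem by blast
    moreover have "\<phi> U0 \<inter> \<Inter>\<F> \<noteq> {}" if "finite \<F>" "\<F> \<subseteq> ?F" for \<F>
    proof -
      from fin[OF that] obtain U where "U \<in> Ga G" "g \<in> U" "\<phi> U \<subseteq> \<phi> U0 \<inter> \<Inter>\<F>" by blast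
      moreover have "\<phi> U \<noteq> {}" using ord[OF \<open>U \<in> Ga G\<close> G.Ga_empty] empty \<open>g \<in> U\<close> by auto
      ultimately show ?thesis by (metis subset_empty)
    qed
    ultimately show ?thesis unfolding compactin_fip by (metis (no_types, lifting))
  qed
  then obtain h where h: "h \<in> \<phi> U0" "h \<in> \<Inter>?F" by auto
  have hg: "h \<in> garr H" using h mem[OF U0(1)] H.GaD(1) by blast
  have hU: "g \<in> U \<longleftrightarrow> h \<in> \<phi> U" if U: "U \<in> Ga G" for U
  proof
    assume "g \<in> U" then show "h \<in> \<phi> U" using h U by blast
  next
    assume hU: "h \<in> \<phi> U"
    show "g \<in> U"
    proof (rule ccontr)
      assume "g \<notin> U"
      \<comment> \<open>Primality of the filter at \<open>g\<close>: it contains \<open>U\<close> or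
        the complement \<open>U0 - U\<close>, and these have disjoint images.\<close>
      then have "U0 - U \<in> Ga G" "g \<in> U0 - U" using U U0 G.Ga_Diff by auto
      then have "h \<in> \<phi> (U0 - U)" using h by blast
      then show False using disj[OF \<open>U0 - U \<in> Ga G\<close> U] hU by blast
    qed
  qed
  show ?thesis
  proof (rule ex1I[of _ h])
    show "h \<in> garr H \<and> (\<forall>U\<in>Ga G. g \<in> U \<longleftrightarrow> h \<in> \<phi> U)" using hg hU by blast
    fix k assume k: "k \<in> garr H \<and> (\<forall>U\<in>Ga G. g \<in> U \<longleftrightarrow> k \<in> \<phi> U)"
    show "k = h"
    proof (rule ccontr)
      assume "k \<noteq> h"
      then obtain A B where AB: "openin (gtop H) A" "openin (gtop H) B" "k \<in> A" "h \<in> B" "disjnt A B"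
        using H.hausdorff k hg H.topspace_garr unfolding Hausdorff_space_def by metis
      then obtain V where V: "V \<in> Ga H" "k \<in> V" "V \<subseteq> A" using H.base by blast
      then obtain U where "U \<in> Ga G" "V = \<phi> U" using surj by blast
      then show False using k hU V AB by (auto simp: disjnt_iff)
    qed
  qed
qed

lemma order_iso_homeo:
  assumes G: "hausdorff_ample G" and H: "hausdorff_ample H"
    and bij: "bij_betw \<phi> (Ga G) (Ga H)"
    and ord: "\<And>U V. U \<in> Ga G \<Longrightarrow> V \<in> Ga G \<Longrightarrow> U \<subseteq> V \<longleftrightarrow> \<phi> U \<subseteq> \<phi> V"
  obtains \<Phi> where "bij_betw \<Phi> (garr G) (garr H)" "homeomorphic_map (gtop G) (gtop H) \<Phi>"
    "\<And>U g. U \<in> Ga G \<Longrightarrow> g \<in> garr G \<Longrightarrow> \<Phi> g \<in> \<phi> U \<longleftrightarrow> g \<in> U"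
proof -
  interpret G: hausdorff_ample G by fact
  interpret H: hausdorff_ample H by fact
  let ?\<psi> = "inv_into (Ga G) \<phi>"
  have bij': "bij_betw ?\<psi> (Ga H) (Ga G)" using bij by (rule bij_betw_inv_into)
  have \<psi>\<phi>: "?\<psi> (\<phi> U) = U" if "U \<in> Ga G" for U using bij that by (rule bij_betw_inv_into_left)
  have \<phi>\<psi>: "\<phi> (?\<psi> U) = U" "?\<psi> U \<in> Ga G" if "U \<in> Ga H" for U
    using bij bij' that bij_betw_inv_into_right bij_betwE by metis+
  have mem: "\<phi> U \<in> Ga H" if "U \<in> Ga G" for U using bij that bij_betwE by blast
  have ord': "U \<subseteq> V \<longleftrightarrow> ?\<psi> U \<subseteq> ?\<psi> V" if "U \<in> Ga H" "V \<in> Ga H" for U V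
    using ord[OF \<phi>\<psi>(2) \<phi>\<psi>(2)] \<phi>\<psi>(1) that by simp
  define \<Phi> where "\<Phi> g = (THE h. h \<in> garr H \<and> (\<forall>U\<in>Ga G. g \<in> U \<longleftrightarrow> h \<in> \<phi> U))" for g
  have \<Phi>: "\<Phi> g \<in> garr H \<and> (\<forall>U\<in>Ga G. g \<in> U \<longleftrightarrow> \<Phi> g \<in> \<phi> U)" if "g \<in> garr G" for g
    unfolding \<Phi>_def using theI'[OF order_iso_points[OF G H bij ord that]] by blast
  have inj: "inj_on \<Phi> (garr G)"
  proof (rule inj_onI)
    fix g k assume gk: "g \<in> garr G" "k \<in> garr G" "\<Phi> g = \<Phi> k"
    have "g \<in> ?\<psi> V \<longleftrightarrow> \<Phi> k \<in> V" "k \<in> ?\<psi> V \<longleftrightarrow> \<Phi> k \<in> V" if "V \<in> Ga H" for V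
      using \<Phi>[OF gk(1)] \<Phi>[OF gk(2)] \<phi>\<psi>[OF that] gk(3) by auto
    moreover have "\<Phi> k \<in> garr H" using \<Phi> gk by blast
    ultimately show "g = k" using order_iso_points[OF H G bij' ord'] gk by blast
  qed
  have surj: "\<exists>g\<in>garr G. \<Phi> g = h" if h: "h \<in> garr H" for h
  proof -
    obtain g where g: "g \<in> garr G" "\<forall>V\<in>Ga H. h \<in> V \<longleftrightarrow> g \<in> ?\<psi> V"
      using order_iso_points[OF H G bij' ord' h] by blast
    then have "\<forall>U\<in>Ga G. g \<in> U \<longleftrightarrow> h \<in> \<phi> U" using mem \<psi>\<phi> by metis
    then show ?thesis using order_iso_points[OF G H bij ord g(1)] \<Phi>[OF g(1)] h g(1) by metis
  qed
  have img: "\<Phi> ` garr G = garr H" using \<Phi> surj by blast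
  \<comment> \<open>Basic sets go to basic sets; continuity and openness of \<open>\<Phi>\<close>
    both follow from this.\<close>
  have imU: "\<Phi> ` U = \<phi> U" if U: "U \<in> Ga G" for U
  proof
    show "\<Phi> ` U \<subseteq> \<phi> U" using \<Phi> U G.GaD(1)[OF U] by blast
    show "\<phi> U \<subseteq> \<Phi> ` U"
    proof
      fix h assume h: "h \<in> \<phi> U"
      then have "h \<in> garr H" using H.GaD(1)[OF mem[OF U]] by blast
      then obtain g where "g \<in> garr G" "\<Phi> g = h" using surj by blast
      then show "h \<in> \<Phi> ` U" using \<Phi>[of g] U h by blast
    qed
  qed
  have "continuous_map (gtop G) (gtop H) \<Phi>"
    unfolding continuous_map_def G.topspace_garr H.topspace_garr
  proof (intro conjI allI impI)
    show "\<Phi> \<in> garr G \<rightarrow> garr H" using \<Phi> by blast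
    fix W assume W: "openin (gtop H) W"
    show "openin (gtop G) {x \<in> garr G. \<Phi> x \<in> W}"
    proof (subst openin_subopen, intro ballI)
      fix g assume g: "g \<in> {x \<in> garr G. \<Phi> x \<in> W}"
      then obtain V where V: "V \<in> Ga H" "\<Phi> g \<in> V" "V \<subseteq> W" using H.base[OF W] by blast
      have "g \<in> ?\<psi> V" "\<Phi> ` ?\<psi> V \<subseteq> W" "?\<psi> V \<in> Ga G"
        using V g \<phi>\<psi>[OF V(1)] \<Phi> imU by auto
      then show "\<exists>T. openin (gtop G) T \<and> g \<in> T \<and> T \<subseteq> {x \<in> garr G. \<Phi> x \<in> W}"
        using G.GaD(1,4) by (intro exI[of _ "?\<psi> V"]) blast
    qed
  qed
  moreover have "open_map (gtop G) (gtop H) \<Phi>"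
    unfolding open_map_def
  proof (intro allI impI)
    fix W assume W: "openin (gtop G) W"
    show "openin (gtop H) (\<Phi> ` W)"
    proof (subst openin_subopen, intro ballI)
      fix h assume "h \<in> \<Phi> ` W"
      then obtain g U where "g \<in> W" "h = \<Phi> g" "U \<in> Ga G" "g \<in> U" "U \<subseteq> W" using G.base[OF W] by blast
      then show "\<exists>T. openin (gtop H) T \<and> h \<in> T \<and> T \<subseteq> \<Phi> ` W"
        using imU mem H.GaD(4) by (intro exI[of _ "\<phi> U"]) blast
    qed
  qed
  ultimately have "homeomorphic_map (gtop G) (gtop H) \<Phi>"
    using inj img G.topspace_garr H.topspace_garr
      by (intro bijective_open_imp_homeomorphic_map) auto
  moreover have "bij_betw \<Phi> (garr G) (garr H)" using inj img by (simp add: bij_betw_def)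
  ultimately show thesis using that \<Phi> by blast
qed

lemma sg_iso_Ga_order:
  assumes G: "hausdorff_ample G" and H: "hausdorff_ample H"
    and bij: "bij_betw \<phi> (Ga G) (Ga H)"
    and mult: "\<And>U V. U \<in> Ga G \<Longrightarrow> V \<in> Ga G \<Longrightarrow> \<phi> (bis_mul G U V) = bis_mul H (\<phi> U) (\<phi> V)"
    and UV: "U \<in> Ga G" "V \<in> Ga G"
  shows "U \<subseteq> V \<longleftrightarrow> \<phi> U \<subseteq> \<phi> V"
proof -
  interpret G: hausdorff_ample G by fact
  interpret H: hausdorff_ample H by fact
  have mem: "\<phi> U \<in> Ga H" if "U \<in> Ga G" for U using bij that bij_betwE by blast
  have inj: "\<phi> A = \<phi> B \<longleftrightarrow> A = B" if "A \<in> Ga G" "B \<in> Ga G" for A B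
    using bij that unfolding bij_betw_def inj_on_def by blast
  have img: "Ga H = \<phi> ` Ga G" using bij by (simp add: bij_betw_def)
  have "\<phi> U \<subseteq> \<phi> V \<longleftrightarrow> (\<exists>E\<in>Ga G. bis_mul H (\<phi> E) (\<phi> E) = \<phi> E \<and> \<phi> U = bis_mul H (\<phi> V) (\<phi> E))"
    unfolding H.Ga_subset_iff[OF mem[OF UV(1)] mem[OF UV(2)]] img by blast
  also have "\<dots> \<longleftrightarrow> (\<exists>E\<in>Ga G. bis_mul G E E = E \<and> U = bis_mul G V E)"
    using UV by (simp add: mult[symmetric] inj G.mul_Ga cong: bex_cong)
  finally show ?thesis using G.Ga_subset_iff[OF UV] by blast
qed

text \<open>The image of \<open>gmul G g h\<close> factors into \<open>u \<in> \<phi> U\<close> and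
  \<open>v \<in> \<phi> V\<close>. Shrinking the neighbourhoods of \<open>g\<close> and
  \<open>h\<close> cannot change the factors, since inside bisections they are determined by the
  range and source of the product. So \<open>u\<close> and \<open>v\<close> lie in the images of all
  neighbourhoods of \<open>g\<close> and \<open>h\<close>, which pins them down to
  \<open>\<Phi> g\<close> and \<open>\<Phi> h\<close>.\<close>

lemma sg_iso_points_mult:
  assumes G: "hausdorff_ample G" and H: "hausdorff_ample H"
    and mem: "\<And>U. U \<in> Ga G \<Longrightarrow> \<phi> U \<in> Ga H"
    and mult: "\<And>U V. U \<in> Ga G \<Longrightarrow> V \<in> Ga G \<Longrightarrow> \<phi> (bis_mul G U V) = bis_mul H (\<phi> U) (\<phi> V)"
    and \<Phi>: "\<And>g. g \<in> garr G \<Longrightarrow> \<Phi> g \<in> garr H"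
    and inj: "inj_on \<Phi> (garr G)" and surj: "\<Phi> ` garr G = garr H"
    and pts: "\<And>U g. U \<in> Ga G \<Longrightarrow> g \<in> garr G \<Longrightarrow> \<Phi> g \<in> \<phi> U \<longleftrightarrow> g \<in> U"
    and gh: "composable G g h"
  shows "composable H (\<Phi> g) (\<Phi> h) \<and> \<Phi> (gmul G g h) = gmul H (\<Phi> g) (\<Phi> h)"
proof -
  interpret G: hausdorff_ample G by fact
  interpret H: hausdorff_ample H by fact
  have g: "g \<in> garr G" and h: "h \<in> garr G" and m: "gmul G g h \<in> garr G"
    using gh G.mul_closed by (auto simp: composable_def)
  obtain U where U: "U \<in> Ga G" "g \<in> U"
    using G.base[of "garr G" g] g G.topspace_garr by (metis openin_topspace)
  obtain V where V: "V \<in> Ga G" "h \<in> V"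
    using G.base[of "garr G" h] h G.topspace_garr by (metis openin_topspace)
  have prod: "\<Phi> (gmul G g h) \<in> bis_mul H (\<phi> U') (\<phi> V')"
    if "U' \<in> Ga G" "V' \<in> Ga G" "g \<in> U'" "h \<in> V'" for U' V'
    using pts[OF G.mul_Ga[OF that(1,2)] m] G.bis_mulI[OF that(3,4) gh] mult[OF that(1,2)] by simp
  obtain u v where uv: "u \<in> \<phi> U" "v \<in> \<phi> V" "composable H u v" "\<Phi> (gmul G g h) = gmul H u v"
    using prod[OF U(1) V(1) U(2) V(2)] H.bis_mulE by metis
  have fix': "u \<in> \<phi> U' \<and> v \<in> \<phi> V'"
    if *: "U' \<in> Ga G" "V' \<in> Ga G" "g \<in> U'" "h \<in> V'" for U' V'
  proof -
    have "\<Phi> (gmul G g h) \<in> bis_mul H (\<phi> (U \<inter> U')) (\<phi> (V \<inter> V'))"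
      using prod[OF G.Ga_Int G.Ga_Int] U V * by auto
    then obtain a b where ab: "a \<in> \<phi> (U \<inter> U')" "b \<in> \<phi> (V \<inter> V')" "composable H a b"
      "\<Phi> (gmul G g h) = gmul H a b" using H.bis_mulE by metis
    have sub: "a \<in> \<phi> U" "a \<in> \<phi> U'" "b \<in> \<phi> V" "b \<in> \<phi> V'"
    proof -
      have "a \<in> \<Phi> ` garr G" "b \<in> \<Phi> ` garr G" using ab(3) surj by (auto simp: composable_def)
      then obtain a' b' where a': "a' \<in> garr G" "a = \<Phi> a'" "b' \<in> garr G" "b = \<Phi> b'" by blast
      then have "a' \<in> U \<inter> U'" "b' \<in> V \<inter> V'"
        using ab pts G.Ga_Int U V * by blast+
      then show "a \<in> \<phi> U" "a \<in> \<phi> U'" "b \<in> \<phi> V" "b \<in> \<phi> V'" using a' pts U V * by blast+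
    qed
    have "a = u" using H.GaD(3)[OF mem[OF U(1)]] sub uv ab H.rng_mul by (metis inj_onD)
    moreover have "b = v" using H.GaD(2)[OF mem[OF V(1)]] sub uv ab H.src_mul by (metis inj_onD)
    ultimately show ?thesis using sub by simp
  qed
  have eq: "k = \<Phi> g'" if "k \<in> garr H" "g' \<in> garr G" "\<And>U'. U' \<in> Ga G \<Longrightarrow> g' \<in> U' \<Longrightarrow> k \<in> \<phi> U'" for k g'
  proof -
    have "k \<in> \<Phi> ` garr G" using that(1) surj by simp
    then obtain k' where k': "k' \<in> garr G" "k = \<Phi> k'" by blast
    have "k' = g'"
    proof (rule ccontr)
      assume "k' \<noteq> g'"
      with that(2) obtain A B where
        AB: "openin (gtop G) A" "openin (gtop G) B" "k' \<in> A" "g' \<in> B" "disjnt A B"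
        using G.hausdorff k' G.topspace_garr unfolding Hausdorff_space_def by metis
      then obtain W where W: "W \<in> Ga G" "g' \<in> W" "W \<subseteq> B" using G.base by blast
      then have "k' \<in> W" using that(3) pts k' by blast
      then show False using AB W by (auto simp: disjnt_iff)
    qed
    then show ?thesis using k' by simp
  qed
  have "u = \<Phi> g" using eq[of u g] fix' V g uv by (auto simp: composable_def)
  moreover have "v = \<Phi> h" using eq[of v h] fix' U h uv by (auto simp: composable_def)
  ultimately show ?thesis using uv by simp
qed

theorem sg_iso_Ga_imp_gpd_iso:
  assumes G: "hausdorff_ample G" and H: "hausdorff_ample H"
    and iso: "sg_isomorphic (Ga G) (bis_mul G) (Ga H) (bis_mul H)"
  shows "gpd_isomorphic G H"
proof -
  interpret G: hausdorff_ample G by fact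
  interpret H: hausdorff_ample H by fact
  obtain \<phi> where bij: "bij_betw \<phi> (Ga G) (Ga H)"
    and mult: "\<And>U V. U \<in> Ga G \<Longrightarrow> V \<in> Ga G \<Longrightarrow> \<phi> (bis_mul G U V) = bis_mul H (\<phi> U) (\<phi> V)"
    using iso unfolding sg_isomorphic_def by blast
  have mem: "\<phi> U \<in> Ga H" if "U \<in> Ga G" for U using bij that bij_betwE by blast
  let ?\<psi> = "inv_into (Ga G) \<phi>"
  have \<psi>\<phi>: "?\<psi> (\<phi> U) = U" if "U \<in> Ga G" for U using bij that by (rule bij_betw_inv_into_left)
  have \<phi>\<psi>: "\<phi> (?\<psi> U) = U" "?\<psi> U \<in> Ga G" if "U \<in> Ga H" for U
    using bij that bij_betw_inv_into_right bij_betwE[OF bij_betw_inv_into] by metis+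
  have mult': "?\<psi> (bis_mul H U V) = bis_mul G (?\<psi> U) (?\<psi> V)" if "U \<in> Ga H" "V \<in> Ga H" for U V
    using mult[of "?\<psi> U" "?\<psi> V"] \<phi>\<psi> that \<psi>\<phi> G.mul_Ga by metis
  have ord: "U \<subseteq> V \<longleftrightarrow> \<phi> U \<subseteq> \<phi> V" if "U \<in> Ga G" "V \<in> Ga G" for U V
    by (rule sg_iso_Ga_order[OF G H bij mult that])
  obtain \<Phi> where \<Phi>: "bij_betw \<Phi> (garr G) (garr H)" "homeomorphic_map (gtop G) (gtop H) \<Phi>"
    "\<And>U g. U \<in> Ga G \<Longrightarrow> g \<in> garr G \<Longrightarrow> \<Phi> g \<in> \<phi> U \<longleftrightarrow> g \<in> U"
    by (rule order_iso_homeo[OF G H bij ord]) blast+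
  let ?\<Psi> = "inv_into (garr G) \<Phi>"
  have bij\<Psi>: "bij_betw ?\<Psi> (garr H) (garr G)" using \<Phi>(1) by (rule bij_betw_inv_into)
  have \<Phi>\<Psi>: "\<Phi> (?\<Psi> h) = h" "?\<Psi> h \<in> garr G" if "h \<in> garr H" for h
    using \<Phi>(1) bij\<Psi> that bij_betw_inv_into_right bij_betwE by metis+
  have \<Psi>\<Phi>: "?\<Psi> (\<Phi> g) = g" "\<Phi> g \<in> garr H" if "g \<in> garr G" for g
    using \<Phi>(1) that bij_betw_inv_into_left bij_betwE by metis+
  have pts': "?\<Psi> g \<in> ?\<psi> U \<longleftrightarrow> g \<in> U" if "U \<in> Ga H" "g \<in> garr H" for U g
    using \<Phi>(3)[OF \<phi>\<psi>(2) \<Phi>\<Psi>(2)] \<phi>\<psi>(1) \<Phi>\<Psi>(1) that by auto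
  have fwd: "composable H (\<Phi> g) (\<Phi> h) \<and> \<Phi> (gmul G g h) = gmul H (\<Phi> g) (\<Phi> h)"
    if "composable G g h" for g h
    using \<Phi>(1) by (intro sg_iso_points_mult[OF G H mem mult _ _ _ \<Phi>(3) that])
      (auto simp: bij_betw_def)
  \<comment> \<open>\<open>gpd_isomorphic\<close> also asks that composability be reflected; this is
    the same lemma applied to the inverse isomorphism.\<close>
  have bwd: "composable G (?\<Psi> g) (?\<Psi> h)" if "composable H g h" for g h
  proof -
    have "composable G (?\<Psi> g) (?\<Psi> h) \<and> ?\<Psi> (gmul H g h) = gmul G (?\<Psi> g) (?\<Psi> h)"
      by (rule sg_iso_points_mult[OF H G \<phi>\<psi>(2) mult' _ _ _ pts' that])
        (use bij\<Psi> in \<open>auto simp: bij_betw_def\<close>)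
    then show ?thesis by blast
  qed
  have "composable G g h \<longleftrightarrow> composable H (\<Phi> g) (\<Phi> h)" if "g \<in> garr G" "h \<in> garr G" for g h
    using fwd bwd[of "\<Phi> g" "\<Phi> h"] \<Psi>\<Phi> that by auto
  then show ?thesis unfolding gpd_isomorphic_def using \<Phi> fwd by blast
qed

section \<open>The topological full pseudogroup\<close>

text \<open>Arrows whose source has trivial isotropy meet every nonempty open set. Asking this for
  sets of arrows and not just of units allows it to be applied directly to a difference of
  bisections.\<close>

locale generic_ample = hausdorff_ample +
  assumes generic: "openin (gtop G) W \<Longrightarrow> W \<noteq> {} \<Longrightarrow>
    \<exists>g\<in>W. \<forall>h\<in>garr G. gsrc G h = gsrc G g \<longrightarrow> grng G h = gsrc G g \<longrightarrow> h = gsrc G g"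
begin

text \<open>Applied to \<open>gmul G (ginv G h) k\<close>, triviality of the isotropy takes the
  usable form that an arrow starting at the source of \<open>g\<close> is determined by its
  range.\<close>

lemma genericE: assumes "openin (gtop G) W" "W \<noteq> {}"
  obtains g where "g \<in> W" "g \<in> garr G"
    "\<And>h k. h \<in> garr G \<Longrightarrow> k \<in> garr G \<Longrightarrow> gsrc G h = gsrc G g \<Longrightarrow> gsrc G k = gsrc G g \<Longrightarrow>
      grng G h = grng G k \<Longrightarrow> h = k"
proof -
  obtain g where g: "g \<in> W" "\<forall>h\<in>garr G. gsrc G h = gsrc G g \<longrightarrow> grng G h = gsrc G g \<longrightarrow> h = gsrc G g"
    using generic[OF assms] by blast
  have gG: "g \<in> garr G" using assms g topspace_garr openin_subset by blast
  have "h = k" if *: "h \<in> garr G" "k \<in> garr G" "gsrc G h = gsrc G g" "gsrc G k = gsrc G g"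
      "grng G h = grng G k" for h k
  proof -
    have "gmul G (ginv G h) k = gsrc G g"
      using g(2) inv_mul_facts[OF *(1,2,5)] *(3,4) by simp
    then show ?thesis using inv_mul_unit_iff[OF *(1,2,5)] src_unit[OF gG] by simp
  qed
  then show thesis using that g gG by blast
qed

text \<open>The difference \<open>U - V\<close> is open, so if it is nonempty it contains an arrow
  without isotropy at its source. Equality of the partial bijections yields an arrow of
  \<open>V\<close> with the same source and range, which must be the same arrow.\<close>

lemma tau_subset: assumes "U \<in> Ga G" "V \<in> Ga G" "tau G U = tau G V" shows "U \<subseteq> V"
proof (rule ccontr)
  assume "\<not> U \<subseteq> V"
  then have "U - V \<noteq> {}" by blast
  then obtain g where g: "g \<in> U - V" "g \<in> garr G" and
    u: "\<And>h k. h \<in> garr G \<Longrightarrow> k \<in> garr G \<Longrightarrow> gsrc G h = gsrc G g \<Longrightarrow> gsrc G k = gsrc G g \<Longrightarrow>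
      grng G h = grng G k \<Longrightarrow> h = k"
    using genericE[OF GaD(4)[OF Ga_Diff[OF assms(1,2)]]] by blast
  have "(gsrc G g, grng G g) \<in> tau G U" using g by (auto simp: tau_def)
  then have "(gsrc G g, grng G g) \<in> tau G V" using assms(3) by simp
  then obtain v where v: "v \<in> V" "gsrc G g = gsrc G v" "grng G g = grng G v"
    by (auto simp: tau_def)
  then have "v = g" using u[of v g] g GaD(1)[OF assms(2)] by auto
  then show False using v g by blast
qed

lemma tau_mult: assumes "U \<in> Ga G" "V \<in> Ga G"
  shows "tau G (bis_mul G U V) = pb_mul (tau G U) (tau G V)"
proof
  show "tau G (bis_mul G U V) \<subseteq> pb_mul (tau G U) (tau G V)"
  proof
    fix p assume "p \<in> tau G (bis_mul G U V)"
    then obtain u v where uv: "u \<in> U" "v \<in> V" "composable G u v" "p = (gsrc G v, grng G u)"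
      by (auto simp: tau_def elim!: bis_mulE simp: src_mul rng_mul)
    have "(gsrc G v, grng G v) \<in> tau G V" using uv by (auto simp: tau_def)
    moreover have "(gsrc G u, grng G u) \<in> tau G U" using uv(1) by (auto simp: tau_def)
    then have "(grng G v, grng G u) \<in> tau G U" using uv(3) by (simp add: composable_def)
    ultimately show "p \<in> pb_mul (tau G U) (tau G V)" using uv by (auto simp: pb_mul_def)
  qed
  show "pb_mul (tau G U) (tau G V) \<subseteq> tau G (bis_mul G U V)"
  proof
    fix p assume "p \<in> pb_mul (tau G U) (tau G V)"
    then obtain u v where uv: "u \<in> U" "v \<in> V" "grng G v = gsrc G u" "p = (gsrc G v, grng G u)"
      by (auto simp: pb_mul_def tau_def)
    then have "composable G u v" using GaD(1) assms by (auto simp: composable_def)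
    then show "p \<in> tau G (bis_mul G U V)"
      using uv bis_mulI[OF uv(1,2)]
        by (auto simp: tau_def src_mul rng_mul intro!: exI[of _ "gmul G u v"])
  qed
qed

lemma tau_iso: "sg_isomorphic (Ga G) (bis_mul G) (full_pseudogroup G) pb_mul"
proof -
  have "inj_on (tau G) (Ga G)" using tau_subset by (metis inj_onI subset_antisym)
  then have "bij_betw (tau G) (Ga G) (full_pseudogroup G)"
    by (simp add: bij_betw_def full_pseudogroup_def)
  then show ?thesis unfolding sg_isomorphic_def using tau_mult by blast
qed

end

theorem sg_iso_Ga_iff_full_pseudogroup:
  assumes G: "generic_ample G" and H: "generic_ample H"
  shows "sg_isomorphic (Ga G) (bis_mul G) (Ga H) (bis_mul H) \<longleftrightarrow>
    sg_isomorphic (full_pseudogroup G) pb_mul (full_pseudogroup H) pb_mul"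
proof -
  interpret G: generic_ample G by fact
  interpret H: generic_ample H by fact
  note sym = sg_isomorphic_sym[OF G.mul_Ga G.tau_iso] sg_isomorphic_sym[OF H.mul_Ga H.tau_iso]
  show ?thesis using sym G.tau_iso H.tau_iso sg_isomorphic_trans by metis
qed

section \<open>Locally constant functions with compact support\<close>

text \<open>The support is the set of nonzero values without closure, as local constancy makes it
  clopen. On a Hausdorff ample groupoid this is the Steinberg algebra
  (\<open>steinberg_set_lcc\<close>), and over any space it is \<open>AR_space\<close>
  (\<open>AR_space_lcc\<close>).\<close>

definition lcc :: "'a topology \<Rightarrow> ('a \<Rightarrow> 'r::zero) set" where
  "lcc X = {f. (\<forall>x. f x \<noteq> 0 \<longrightarrow> x \<in> topspace X) \<and>
     (\<forall>x\<in>topspace X. \<exists>U. openin X U \<and> x \<in> U \<and> (\<forall>y\<in>U. f y = f x)) \<and>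
     compactin X {x. f x \<noteq> 0}}"

lemma lccD: assumes "f \<in> lcc X"
  shows "f x \<noteq> 0 \<Longrightarrow> x \<in> topspace X"
    "x \<in> topspace X \<Longrightarrow> \<exists>U. openin X U \<and> x \<in> U \<and> (\<forall>y\<in>U. f y = f x)"
    "compactin X {x. f x \<noteq> 0}"
  using assms by (auto simp: lcc_def)

lemma locally_constant_openin:
  assumes "\<And>x. x \<in> topspace X \<Longrightarrow> \<exists>U. openin X U \<and> x \<in> U \<and> (\<forall>y\<in>U. f y = f x)"
  shows "openin X {x \<in> topspace X. P (f x)}"
proof (subst openin_subopen, intro ballI)
  fix x assume x: "x \<in> {x \<in> topspace X. P (f x)}"
  then obtain U where "openin X U" "x \<in> U" "\<forall>y\<in>U. f y = f x" using assms by blast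
  then show "\<exists>T. openin X T \<and> x \<in> T \<and> T \<subseteq> {x \<in> topspace X. P (f x)}"
    using x openin_subset by (intro exI[of _ U]) fastforce
qed

lemma lcc_openin: "f \<in> lcc X \<Longrightarrow> openin X {x \<in> topspace X. P (f x)}"
  by (rule locally_constant_openin) (rule lccD(2))

lemma lcc_support: assumes "f \<in> lcc X"
  shows "openin X {x. f x \<noteq> 0}" "closedin X {x. f x \<noteq> 0}"
proof -
  have "{x. f x \<noteq> 0} = {x \<in> topspace X. f x \<noteq> 0}" using lccD(1)[OF assms] by blast
  then show "openin X {x. f x \<noteq> 0}" using lcc_openin[OF assms, of "\<lambda>r. r \<noteq> 0"] by simp
  have "topspace X - {x. f x \<noteq> 0} = {x \<in> topspace X. f x = 0}" by blast
  then show "closedin X {x. f x \<noteq> 0}"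
    using lcc_openin[OF assms, of "\<lambda>r. r = 0"] lccD(1)[OF assms] by (auto simp: closedin_def)
qed

text \<open>By local constancy the nonzero set is closed, so any compact set containing it makes it
  compact.\<close>

lemma lccI:
  assumes "\<And>x. f x \<noteq> 0 \<Longrightarrow> x \<in> K" "compactin X K"
    "\<And>x. x \<in> topspace X \<Longrightarrow> \<exists>U. openin X U \<and> x \<in> U \<and> (\<forall>y\<in>U. f y = f x)"
  shows "f \<in> lcc X"
proof -
  have K: "K \<subseteq> topspace X" using assms(2) by (rule compactin_subset_topspace)
  have "openin X {x \<in> topspace X. f x = 0}" using assms(3) by (rule locally_constant_openin)
  moreover have "topspace X - {x. f x \<noteq> 0} = {x \<in> topspace X. f x = 0}" by blast
  ultimately have "closedin X {x. f x \<noteq> 0}" using K assms(1) by (auto simp: closedin_def)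
  then have "compactin X {x. f x \<noteq> 0}"
    using assms(1,2) by (intro closed_compactin[OF assms(2)]) auto
  then show ?thesis using K assms by (auto simp: lcc_def)
qed

lemma lcc_zero: "(\<lambda>_. 0) \<in> lcc X"
  by (rule lccI[of _ "{}"]) auto

lemma lcc_combine: assumes f: "f \<in> lcc X" and g: "g \<in> lcc X" and F: "F 0 0 = 0"
  shows "(\<lambda>x. F (f x) (g x)) \<in> lcc X"
proof (rule lccI)
  show "compactin X ({x. f x \<noteq> 0} \<union> {x. g x \<noteq> 0})"
    using lccD(3)[OF f] lccD(3)[OF g] by (rule compactin_Un)
  fix x
  show "F (f x) (g x) \<noteq> 0 \<Longrightarrow> x \<in> {x. f x \<noteq> 0} \<union> {x. g x \<noteq> 0}" using F by auto
  assume x: "x \<in> topspace X"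
  obtain U where U: "openin X U" "x \<in> U" "\<forall>y\<in>U. f y = f x" using lccD(2)[OF f x] by blast
  obtain V where V: "openin X V" "x \<in> V" "\<forall>y\<in>V. g y = g x" using lccD(2)[OF g x] by blast
  show "\<exists>U. openin X U \<and> x \<in> U \<and> (\<forall>y\<in>U. F (f y) (g y) = F (f x) (g x))"
    using U V by (intro exI[of _ "U \<inter> V"]) (metis IntD1 IntD2 IntI openin_Int)
qed

lemma lcc_add: "f \<in> lcc X \<Longrightarrow> g \<in> lcc X \<Longrightarrow> (\<lambda>x. f x + g x :: 'r::comm_ring_1) \<in> lcc X"
  by (rule lcc_combine[where F = "(+)"]) auto

lemma lcc_smul: "f \<in> lcc X \<Longrightarrow> (\<lambda>x. r * f x :: 'r::comm_ring_1) \<in> lcc X"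
  by (rule lcc_combine[where F = "\<lambda>a b. r * a" and g = f]) auto

lemma lcc_uminus: "f \<in> lcc X \<Longrightarrow> (\<lambda>x. - f x :: 'r::comm_ring_1) \<in> lcc X"
  using lcc_smul[of f X "-1"] by simp

lemma lcc_restrict: assumes f: "f \<in> lcc X" and W: "openin X W" "closedin X W"
  shows "(\<lambda>x. if x \<in> W then f x else 0) \<in> lcc X"
proof (rule lccI)
  show "compactin X {x. f x \<noteq> 0}" by (rule lccD(3)[OF f])
  fix x
  show "(if x \<in> W then f x else 0) \<noteq> 0 \<Longrightarrow> x \<in> {x. f x \<noteq> 0}" by (auto split: if_splits)
  assume x: "x \<in> topspace X"
  obtain U where U: "openin X U" "x \<in> U" "\<forall>y\<in>U. f y = f x" using lccD(2)[OF f x] by blast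
  have "openin X (U \<inter> W)" "openin X (U - W)" using U W by auto
  show "\<exists>U. openin X U \<and> x \<in> U \<and> (\<forall>y\<in>U. (if y \<in> W then f y else 0) = (if x \<in> W then f x else 0))"
  proof (cases "x \<in> W")
    case True then show ?thesis using U \<open>openin X (U \<inter> W)\<close>
      by (intro exI[of _ "U \<inter> W"]) (metis IntD1 IntD2 IntI)
  next
    case False then show ?thesis using U \<open>openin X (U - W)\<close>
      by (intro exI[of _ "U - W"]) (metis DiffD1 DiffD2 DiffI)
  qed
qed

definition indc :: "'a set \<Rightarrow> 'r::zero \<Rightarrow> 'a \<Rightarrow> 'r" where
  "indc U c = (\<lambda>x. if x \<in> U then c else 0)"

lemma lcc_indc: assumes "openin X K" "compactin X K" "closedin X K" shows "indc K c \<in> lcc X"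
proof (rule lccI)
  show "compactin X K" by fact
  fix x
  show "indc K c x \<noteq> 0 \<Longrightarrow> x \<in> K" by (auto simp: indc_def split: if_splits)
  assume x: "x \<in> topspace X"
  then show "\<exists>U. openin X U \<and> x \<in> U \<and> (\<forall>y\<in>U. indc K c y = indc K c x)"
    using assms by (intro exI[of _ "if x \<in> K then K else topspace X - K"]) (simp add: indc_def
      openin_diff)
qed

text \<open>Compactness of the support gives finitely many clopen members of \<open>\<B>\<close> on
  each of which \<open>f\<close> is constant. They are added one at a time, with \<open>V\<close>
  the union of those already treated, so that no value is counted twice. A basis is demanded only
  where \<open>f\<close> is nonzero, which lets \<open>\<B>\<close> consist of sets of units when
  \<open>f\<close> is diagonal.\<close>

lemma lcc_induct [consumes 1, case_names basis zero step]:
  fixes f :: "'a \<Rightarrow> 'r::comm_ring_1"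
  assumes f: "f \<in> lcc X"
    and basis: "\<And>x W. f x \<noteq> 0 \<Longrightarrow> openin X W \<Longrightarrow> x \<in> W \<Longrightarrow>
      \<exists>B\<in>\<B>. x \<in> B \<and> B \<subseteq> W \<and> openin X B \<and> closedin X B"
    and zero: "Pr (\<lambda>_. 0)"
    and step: "\<And>g B V c. Pr g \<Longrightarrow> B \<in> \<B> \<Longrightarrow> openin X V \<Longrightarrow> closedin X V \<Longrightarrow>
      g \<in> lcc X \<Longrightarrow> Pr (\<lambda>x. g x + indc (B - V) c x)"
  shows "Pr f"
proof -
  let ?K = "{x. f x \<noteq> 0}"
  let ?C = "{B \<in> \<B>. openin X B \<and> closedin X B \<and> (\<exists>c. \<forall>x\<in>B. f x = c)}"
  have cover: "?K \<subseteq> \<Union>?C"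
  proof
    fix x assume "x \<in> ?K"
    then have x: "f x \<noteq> 0" by simp
    then obtain W where W: "openin X W" "x \<in> W" "\<forall>y\<in>W. f y = f x" using lccD(1,2)[OF f] by blast
    then obtain B where "B \<in> \<B>" "x \<in> B" "B \<subseteq> W" "openin X B" "closedin X B" using basis[OF x]
      by blast
    then show "x \<in> \<Union>?C" using W by blast
  qed
  have op: "\<forall>B\<in>?C. openin X B" by blast
  have fam: "Pr (\<lambda>x. if x \<in> \<Union>\<F> then f x else 0) \<and> openin X (\<Union>\<F>) \<and> closedin X (\<Union>\<F>)"
    if "finite \<F>" "\<F> \<subseteq> ?C" for \<F>
    using that
  proof (induction \<F>)
    case empty then show ?case using zero by simp
  next
    case (insert B \<F>)
    then obtain c where B: "B \<in> \<B>" "openin X B" "closedin X B" "\<forall>x\<in>B. f x = c"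
      and IH: "Pr (\<lambda>x. if x \<in> \<Union>\<F> then f x else 0)" "openin X (\<Union>\<F>)" "closedin X (\<Union>\<F>)" by auto
    have "(\<lambda>x. (if x \<in> \<Union>\<F> then f x else 0) + indc (B - \<Union>\<F>) c x) =
      (\<lambda>x. if x \<in> \<Union>(insert B \<F>) then f x else 0)"
      using B(4) by (auto simp: indc_def)
    moreover have "(\<lambda>x. if x \<in> \<Union>\<F> then f x else 0) \<in> lcc X" using lcc_restrict[OF f IH(2,3)] .
    ultimately have "Pr (\<lambda>x. if x \<in> \<Union>(insert B \<F>) then f x else 0)"
      using step[OF IH(1) B(1) IH(2,3), of c] by (simp only:)
    then show ?case using B IH by auto
  qed
  obtain \<F> where F: "finite \<F>" "\<F> \<subseteq> ?C" "?K \<subseteq> \<Union>\<F>"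
    using lccD(3)[OF f] cover op unfolding compactin_def by meson
  have "(\<lambda>x. if x \<in> \<Union>\<F> then f x else 0) = f" using F(3) by fastforce
  then show ?thesis using fam[OF F(1,2)] by simp
qed

section \<open>Steinberg algebras\<close>

context hausdorff_ample
begin

lemma Ga_src_eqD: "U \<in> Ga G \<Longrightarrow> gsrc G u = gsrc G v \<Longrightarrow> u \<in> U \<Longrightarrow> v \<in> U \<Longrightarrow> u = v"
  and Ga_rng_eqD: "U \<in> Ga G \<Longrightarrow> grng G u = grng G v \<Longrightarrow> u \<in> U \<Longrightarrow> v \<in> U \<Longrightarrow> u = v"
  using GaD(2,3) by (auto dest: inj_onD)

lemma indc_lcc: "U \<in> Ga G \<Longrightarrow> indc U c \<in> lcc (gtop G)"
  using GaD lcc_indc by metis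

lemma lcc_garr: "f \<in> lcc (gtop G) \<Longrightarrow> f g \<noteq> 0 \<Longrightarrow> g \<in> garr G"
  using lccD(1) topspace_garr by metis

lemma lcc_Ga_induct [consumes 1, case_names zero step]:
  fixes f :: "'a \<Rightarrow> 'r::comm_ring_1"
  assumes f: "f \<in> lcc (gtop G)" and zero: "Pr (\<lambda>_. 0)"
    and step: "\<And>g U c. Pr g \<Longrightarrow> U \<in> Ga G \<Longrightarrow> g \<in> lcc (gtop G) \<Longrightarrow> Pr (\<lambda>x. g x + indc U c x)"
  shows "Pr f"
  using f
proof (induction rule: lcc_induct[where \<B> = "Ga G"])
  case (basis x W) then show ?case using base GaD(4,6) by metis
next
  case zero then show ?case by fact
next
  case (step g B V c) then show ?case using assms(3) Ga_Diff_clopen by blast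
qed

lemma steinberg_set_lcc: "steinberg_set G = (lcc (gtop G) :: ('a \<Rightarrow> 'r::comm_ring_1) set)"
proof
  have "(\<lambda>g. \<Sum>i<n. c i * chi (U i) g) \<in> lcc (gtop G)" if "\<forall>i<n. U i \<in> Ga G"
    for n :: nat and c :: "nat \<Rightarrow> 'r" and U
    using that
  proof (induction n)
    case 0 then show ?case by (simp add: lcc_zero)
  next
    case (Suc n)
    have "(\<lambda>g. c n * chi (U n) g) = indc (U n) (c n)" by (auto simp: chi_def indc_def)
    then have "(\<lambda>g. c n * chi (U n) g) \<in> lcc (gtop G)" using Suc.prems indc_lcc by auto
    then show ?case using lcc_add[OF Suc.IH] Suc.prems by simp
  qed
  then show "steinberg_set G \<subseteq> (lcc (gtop G) :: ('a \<Rightarrow> 'r) set)" unfolding steinberg_set_def by blast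
  show "(lcc (gtop G) :: ('a \<Rightarrow> 'r) set) \<subseteq> steinberg_set G"
  proof
    fix f :: "'a \<Rightarrow> 'r" assume "f \<in> lcc (gtop G)"
    then show "f \<in> steinberg_set G"
    proof (induction rule: lcc_Ga_induct)
      case zero then show ?case by (auto simp: steinberg_set_def intro!: exI[of _ "0::nat"])
    next
      case (step g U c)
      obtain n :: nat and d V where g: "\<forall>i<n. V i \<in> Ga G" "g = (\<lambda>g. \<Sum>i<n. d i * chi (V i) g)"
        using step(1) unfolding steinberg_set_def by blast
      show ?case unfolding steinberg_set_def
        by (intro CollectI exI[of _ "Suc n"] exI[of _ "d(n := c)"] exI[of _ "V(n := U)"])
          (use g step in \<open>auto simp: less_Suc_eq fun_eq_iff indc_def chi_def\<close>)
    qed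
  qed
qed

abbreviation conv where "conv \<equiv> convolution G"

text \<open>A bisection meets each range fibre in at most one arrow. Finiteness matters because
  \<open>convolution\<close> would otherwise silently evaluate an infinite sum to
  \<open>0\<close>.\<close>

lemma finite_fiber: fixes f :: "'a \<Rightarrow> 'r::comm_ring_1"
  assumes "f \<in> lcc (gtop G)" shows "finite {\<alpha> \<in> garr G. grng G \<alpha> = y \<and> f \<alpha> \<noteq> 0}"
  using assms
proof (induction rule: lcc_Ga_induct)
  case zero then show ?case by simp
next
  case (step g U c)
  have "finite {\<alpha> \<in> U. grng G \<alpha> = y}"
  proof (cases "\<exists>\<alpha>\<in>U. grng G \<alpha> = y")
    case True
    then obtain \<alpha> where "\<alpha> \<in> U" "grng G \<alpha> = y" by blast
    then have "{\<alpha> \<in> U. grng G \<alpha> = y} \<subseteq> {\<alpha>}" using GaD(3)[OF step(2)] by (auto dest: inj_onD)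
    then show ?thesis using finite_subset by blast
  qed (auto intro: finite_subset[of _ "{}"])
  moreover have "{\<alpha> \<in> garr G. grng G \<alpha> = y \<and> g \<alpha> + indc U c \<alpha> \<noteq> 0} \<subseteq>
    {\<alpha> \<in> garr G. grng G \<alpha> = y \<and> g \<alpha> \<noteq> 0} \<union> {\<alpha> \<in> U. grng G \<alpha> = y}"
    by (auto simp: indc_def split: if_splits)
  ultimately show ?case using step(1) finite_subset by blast
qed

text \<open>Enlarging the index set beyond the support of \<open>f\<close> allows several
  convolutions to be compared over one finite set.\<close>

lemma conv_eq: fixes f :: "'a \<Rightarrow> 'r::comm_ring_1"
  assumes "\<gamma> \<in> garr G" "finite F" "F \<subseteq> {\<alpha> \<in> garr G. grng G \<alpha> = grng G \<gamma>}"
    "{\<alpha> \<in> garr G. grng G \<alpha> = grng G \<gamma> \<and> f \<alpha> \<noteq> 0} \<subseteq> F"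
  shows "conv f h \<gamma> = (\<Sum>\<alpha>\<in>F. f \<alpha> * h (gmul G (ginv G \<alpha>) \<gamma>))"
  unfolding convolution_def using assms
  by (simp, intro sum.mono_neutral_left) auto

lemma conv_outside: "\<gamma> \<notin> garr G \<Longrightarrow> conv f h \<gamma> = 0"
  by (simp add: convolution_def)

lemma conv_single: fixes f :: "'a \<Rightarrow> 'r::comm_ring_1"
  assumes "\<alpha> \<in> garr G" "\<gamma> \<in> garr G" "grng G \<alpha> = grng G \<gamma>"
    "\<And>\<alpha>'. \<alpha>' \<in> garr G \<Longrightarrow> grng G \<alpha>' = grng G \<gamma> \<Longrightarrow> f \<alpha>' \<noteq> 0 \<Longrightarrow> \<alpha>' = \<alpha>"
  shows "conv f h \<gamma> = f \<alpha> * h (gmul G (ginv G \<alpha>) \<gamma>)"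
proof -
  have "conv f h \<gamma> = (\<Sum>\<alpha>\<in>{\<alpha>}. f \<alpha> * h (gmul G (ginv G \<alpha>) \<gamma>))"
    using assms by (intro conv_eq) blast+
  then show ?thesis by simp
qed

lemma conv_none: fixes f :: "'a \<Rightarrow> 'r::comm_ring_1"
  assumes "\<And>\<alpha>. \<alpha> \<in> garr G \<Longrightarrow> grng G \<alpha> = grng G \<gamma> \<Longrightarrow> f \<alpha> = 0"
  shows "conv f h \<gamma> = 0"
proof -
  have "{\<alpha> \<in> garr G. grng G \<alpha> = grng G \<gamma> \<and> f \<alpha> \<noteq> 0} = {}" using assms by blast
  then show ?thesis unfolding convolution_def by (metis sum.empty)
qed

lemma conv_unit_left: fixes d :: "'a \<Rightarrow> 'r::comm_ring_1"
  assumes "\<And>g. d g \<noteq> 0 \<Longrightarrow> g \<in> gunits G" "\<gamma> \<in> garr G"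
  shows "conv d h \<gamma> = d (grng G \<gamma>) * h \<gamma>"
proof -
  have "conv d h \<gamma> = d (grng G \<gamma>) * h (gmul G (ginv G (grng G \<gamma>)) \<gamma>)"
    using assms(1) unitD by (intro conv_single) (auto simp: assms(2) rng_garr rng_rng)
  then show ?thesis using unitD(4)[OF rng_unit[OF assms(2)]] rng_mult[OF assms(2)] by simp
qed

lemma conv_add_left: fixes f g :: "'a \<Rightarrow> 'r::comm_ring_1"
  assumes "f \<in> lcc (gtop G)" "g \<in> lcc (gtop G)"
  shows "conv (\<lambda>x. f x + g x) h = (\<lambda>\<gamma>. conv f h \<gamma> + conv g h \<gamma>)"
proof
  fix \<gamma> show "conv (\<lambda>x. f x + g x) h \<gamma> = conv f h \<gamma> + conv g h \<gamma>"
  proof (cases "\<gamma> \<in> garr G")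
    case True
    define F where "F = {\<alpha> \<in> garr G. grng G \<alpha> = grng G \<gamma> \<and> f \<alpha> \<noteq> 0} \<union>
      {\<alpha> \<in> garr G. grng G \<alpha> = grng G \<gamma> \<and> g \<alpha> \<noteq> 0}"
    have F: "finite F" "F \<subseteq> {\<alpha> \<in> garr G. grng G \<alpha> = grng G \<gamma>}"
      unfolding F_def using finite_fiber assms by auto
    have "conv (\<lambda>x. f x + g x) h \<gamma> = (\<Sum>\<alpha>\<in>F. (f \<alpha> + g \<alpha>) * h (gmul G (ginv G \<alpha>) \<gamma>))"
      using F by (intro conv_eq[OF True]) (auto simp: F_def)
    moreover have "conv f h \<gamma> = (\<Sum>\<alpha>\<in>F. f \<alpha> * h (gmul G (ginv G \<alpha>) \<gamma>))"
      using F by (intro conv_eq[OF True]) (auto simp: F_def)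
    moreover have "conv g h \<gamma> = (\<Sum>\<alpha>\<in>F. g \<alpha> * h (gmul G (ginv G \<alpha>) \<gamma>))"
      using F by (intro conv_eq[OF True]) (auto simp: F_def)
    ultimately show ?thesis by (simp add: distrib_right sum.distrib)
  qed (simp add: conv_outside)
qed

lemma conv_add_right: fixes f g :: "'a \<Rightarrow> 'r::comm_ring_1"
  shows "conv f (\<lambda>x. g x + h x) = (\<lambda>\<gamma>. conv f g \<gamma> + conv f h \<gamma>)"
  by (auto simp: fun_eq_iff convolution_def distrib_left sum.distrib)

lemma conv_zero_left: "conv (\<lambda>_. 0) h = (\<lambda>_. 0)"
  and conv_zero_right: "conv f (\<lambda>_. 0) = (\<lambda>_. 0)"
  by (auto simp: fun_eq_iff convolution_def)

text \<open>At \<open>\<gamma>\<close> the sum has at most one term, from the arrow of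
  \<open>U\<close> with the range of \<open>\<gamma>\<close>; the second factor of that term is
  evaluated inside \<open>V\<close> exactly when \<open>\<gamma>\<close> belongs to the
  product.\<close>

lemma conv_indc: assumes "U \<in> Ga G" "V \<in> Ga G"
  shows "conv (indc U c) (indc V d) = indc (bis_mul G U V) (c * d :: 'r::comm_ring_1)"
proof
  fix \<gamma>
  show "conv (indc U c) (indc V d) \<gamma> = indc (bis_mul G U V) (c * d) \<gamma>"
  proof (cases "\<gamma> \<in> garr G \<and> (\<exists>\<alpha>\<in>U. grng G \<alpha> = grng G \<gamma>)")
    case True
    then obtain \<alpha> where \<alpha>: "\<alpha> \<in> U" "grng G \<alpha> = grng G \<gamma>" "\<gamma> \<in> garr G" "\<alpha> \<in> garr G"
      using GaD(1)[OF assms(1)] by blast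
    have "conv (indc U c) (indc V d) \<gamma> = indc U c \<alpha> * indc V d (gmul G (ginv G \<alpha>) \<gamma>)"
      using \<alpha> by (intro conv_single) (auto simp: indc_def split: if_splits intro: Ga_rng_eqD[OF
        assms(1)])
    moreover have "gmul G (ginv G \<alpha>) \<gamma> \<in> V \<longleftrightarrow> \<gamma> \<in> bis_mul G U V"
    proof
      assume v: "gmul G (ginv G \<alpha>) \<gamma> \<in> V"
      have "composable G \<alpha> (gmul G (ginv G \<alpha>) \<gamma>)"
        using inv_mul_facts[OF \<alpha>(4,3,2)] \<alpha> by (simp add: composable_def)
      from bis_mulI[OF \<alpha>(1) v this] show "\<gamma> \<in> bis_mul G U V" using mul_inv_mul[OF \<alpha>(4,3,2)] by simp
    next
      assume "\<gamma> \<in> bis_mul G U V"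
      then obtain u v where uv: "u \<in> U" "v \<in> V" "composable G u v" "\<gamma> = gmul G u v"
        using bis_mulE by metis
      then have "u = \<alpha>" using \<alpha> GaD(3)[OF assms(1)] by (metis inj_onD rng_mul)
      then show "gmul G (ginv G \<alpha>) \<gamma> \<in> V" using uv inv_mul_cancel by simp
    qed
    ultimately show ?thesis using \<alpha> by (simp add: indc_def)
  next
    case False
    have "\<gamma> \<notin> bis_mul G U V" using False mul_closed rng_mul by (metis bis_mulE)
    moreover have "conv (indc U c) (indc V d) \<gamma> = 0"
    proof (cases "\<gamma> \<in> garr G")
      case True
      then show ?thesis using False by (intro conv_none) (auto simp: indc_def)
    qed (simp add: conv_outside)
    ultimately show ?thesis by (simp add: indc_def)
  qed
qed

lemma conv_closed: fixes f h :: "'a \<Rightarrow> 'r::comm_ring_1"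
  assumes "f \<in> lcc (gtop G)" "h \<in> lcc (gtop G)" shows "conv f h \<in> lcc (gtop G)"
  using assms(1)
proof (induction rule: lcc_Ga_induct)
  case zero then show ?case by (simp add: conv_zero_left lcc_zero)
next
  case (step f U c)
  have "conv (indc U c) h \<in> lcc (gtop G)" using assms(2)
  proof (induction rule: lcc_Ga_induct)
    case zero then show ?case by (simp add: conv_zero_right lcc_zero)
  next
    case (step h V d)
    show ?case
      using lcc_add[OF step(1) indc_lcc[OF mul_Ga[OF \<open>U \<in> Ga G\<close> step(2)]]] step(2)
      by (simp add: conv_add_right conv_indc[OF \<open>U \<in> Ga G\<close>])
  qed
  then show ?case using lcc_add[OF step(1)]
    by (simp add: conv_add_left[OF step(3) indc_lcc[OF step(2)]])
qed

end

section \<open>Normalizers of the diagonal\<close>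

definition alg_closed :: "('a, 'r) dalg \<Rightarrow> bool" where
  "alg_closed A \<longleftrightarrow> adiag A \<subseteq> acar A \<and> (\<forall>x\<in>acar A. \<forall>y\<in>acar A. aadd A x y \<in> acar A \<and>
    amul A x y \<in> acar A)
    \<and> (\<forall>r. \<forall>x\<in>acar A. asmul A r x \<in> acar A)"

text \<open>Normalizers come with a partner \<open>n'\<close> in the role of an inverse; the products are bracketed
  so that associativity of the multiplication is never needed.\<close>

definition normpair :: "('a, 'r) dalg \<Rightarrow> 'a \<Rightarrow> 'a \<Rightarrow> bool" where
  "normpair A n n' \<longleftrightarrow> n \<in> acar A \<and> n' \<in> acar A \<and>
     amul A n (amul A n' n) = n \<and> amul A n' (amul A n n') = n' \<and>
     amul A n' n \<in> adiag A \<and> amul A n n' \<in> adiag A \<and>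
     (\<forall>d\<in>adiag A. amul A n (amul A d n') \<in> adiag A \<and> amul A n' (amul A d n) \<in> adiag A)"

lemma normpair_sym: "normpair A n n' \<Longrightarrow> normpair A n' n"
  unfolding normpair_def by blast

text \<open>Each clause of \<open>normpair\<close> is an equation between products or a membership
  in the diagonal, and diagonal elements of \<open>B\<close> are images of diagonal elements of
  \<open>A\<close>.\<close>

lemma normpair_iso:
  assumes iso: "ring_iso A B \<Phi>" and diag: "diag_preserving A B \<Phi>" and cl: "alg_closed A"
    and n: "normpair A n n'"
  shows "normpair B (\<Phi> n) (\<Phi> n')"
proof -
  have mul: "\<Phi> (amul A x y) = amul B (\<Phi> x) (\<Phi> y)" if "x \<in> acar A" "y \<in> acar A" for x y
    using iso that by (simp add: ring_iso_def)
  have car: "\<Phi> x \<in> acar B" if "x \<in> acar A" for x using iso that bij_betwE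
    by (auto simp: ring_iso_def)
  have clm: "amul A x y \<in> acar A" if "x \<in> acar A" "y \<in> acar A" for x y using cl that
    by (simp add: alg_closed_def)
  have dia: "\<Phi> d \<in> adiag B" if "d \<in> adiag A" for d using diag that
    by (auto simp: diag_preserving_def)
  have sub: "d \<in> acar A" if "d \<in> adiag A" for d using cl that by (auto simp: alg_closed_def)
  have nn: "n \<in> acar A" "n' \<in> acar A" using n by (simp_all add: normpair_def)
  have "amul B (\<Phi> n) (amul B d (\<Phi> n')) \<in> adiag B \<and> amul B (\<Phi> n') (amul B d (\<Phi> n)) \<in> adiag B"
    if "d \<in> adiag B" for d
  proof -
    obtain d' where d': "d' \<in> adiag A" "d = \<Phi> d'" using diag \<open>d \<in> adiag B\<close>
      by (auto simp: diag_preserving_def)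
    have "\<Phi> (amul A n (amul A d' n')) \<in> adiag B" "\<Phi> (amul A n' (amul A d' n)) \<in> adiag B"
      using n d' dia by (simp_all add: normpair_def)
    then show ?thesis using d' nn sub by (simp add: mul clm)
  qed
  moreover have "\<Phi> (amul A n (amul A n' n)) = \<Phi> n" "\<Phi> (amul A n' (amul A n n')) = \<Phi> n'"
    "\<Phi> (amul A n' n) \<in> adiag B" "\<Phi> (amul A n n') \<in> adiag B"
    using n dia by (simp_all add: normpair_def)
  ultimately show ?thesis unfolding normpair_def using nn car by (simp add: mul clm)
qed

context hausdorff_ample
begin

abbreviation stb :: "('a \<Rightarrow> 'r::comm_ring_1, 'r) dalg" where "stb \<equiv> steinberg G"

lemma stb_simps: "acar stb = (lcc (gtop G) :: ('a \<Rightarrow> 'r::comm_ring_1) set)"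
  "amul stb = (conv :: _ \<Rightarrow> _ \<Rightarrow> _ \<Rightarrow> 'r)"
  "aadd stb = (\<lambda>f h g. f g + h g :: 'r)" "asmul stb = (\<lambda>(r::'r) f g. r * f g)"
  "(d :: 'a \<Rightarrow> 'r) \<in> adiag stb \<longleftrightarrow> d \<in> lcc (gtop G) \<and> (\<forall>g. d g \<noteq> 0 \<longrightarrow> g \<in> gunits G)"
  by (simp_all add: steinberg_def steinberg_set_lcc)

lemma stb_closed: "alg_closed (stb :: ('a \<Rightarrow> 'r::comm_ring_1, 'r) dalg)"
  unfolding alg_closed_def by (auto simp: stb_simps conv_closed lcc_add lcc_smul)

text \<open>Intersecting a basic neighbourhood with its own set of sources leaves a compact open set
  of units that still contains \<open>u\<close>.\<close>

lemma unit_nbhd: assumes "u \<in> gunits G" "openin (gtop G) W" "u \<in> W"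
  obtains E where "E \<in> Ga G" "E \<subseteq> gunits G" "u \<in> E" "E \<subseteq> W"
proof -
  obtain U where U: "U \<in> Ga G" "u \<in> U" "U \<subseteq> W" using base[OF assms(2,3)] by blast
  have "gsrc G ` U \<inter> U \<in> Ga G" using U Ga_src Ga_Int by blast
  moreover have "gsrc G ` U \<subseteq> gunits G" using GaD(1)[OF U(1)] src_unit by blast
  moreover have "u \<in> gsrc G ` U" using unitD(2)[OF assms(1)] U(2) by (metis image_eqI)
  ultimately show thesis using that[of "gsrc G ` U \<inter> U"] U by blast
qed

text \<open>A nonzero value at \<open>\<gamma>\<close> needs an \<open>\<alpha>\<close> in
  \<open>U\<close> with the range of \<open>\<gamma>\<close> such that
  \<open>gmul G (ginv G \<alpha>) \<gamma>\<close> is the inverse of some \<open>u\<close> in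
  \<open>U\<close>. Then \<open>u\<close> and \<open>\<alpha>\<close> have the same source, hence
  are equal, and \<open>\<gamma>\<close> is the range of \<open>\<alpha>\<close>.\<close>

lemma conv_indc_conj_diag:
  assumes U: "U \<in> Ga G" and d: "d \<in> adiag (stb :: ('a \<Rightarrow> 'r::comm_ring_1, 'r) dalg)"
  shows "conv (indc U 1) (conv d (indc (ginv G ` U) 1)) \<in> adiag stb"
proof -
  have dl: "d \<in> lcc (gtop G)" "\<And>g. d g \<noteq> 0 \<Longrightarrow> g \<in> gunits G" using d by (auto simp: stb_simps)
  have "\<gamma> \<in> gunits G" if nz: "conv (indc U 1) (conv d (indc (ginv G ` U) 1)) \<gamma> \<noteq> 0" for \<gamma>
  proof -
    have \<gamma>: "\<gamma> \<in> garr G" using nz conv_outside by metis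
    obtain \<alpha> where \<alpha>: "\<alpha> \<in> garr G" "grng G \<alpha> = grng G \<gamma>" "\<alpha> \<in> U"
      using nz conv_none[of \<gamma> "indc U 1"] by (metis indc_def)
    have f: "gmul G (ginv G \<alpha>) \<gamma> \<in> garr G" "gsrc G (gmul G (ginv G \<alpha>) \<gamma>) = gsrc G \<gamma>"
       "grng G (gmul G (ginv G \<alpha>) \<gamma>) = gsrc G \<alpha>"
      using inv_mul_facts[OF \<alpha>(1) \<gamma> \<alpha>(2)] by auto
    have "conv (indc U 1) (conv d (indc (ginv G ` U) 1)) \<gamma> =
        indc U 1 \<alpha> * conv d (indc (ginv G ` U) 1) (gmul G (ginv G \<alpha>) \<gamma>)"
      using \<alpha> by (intro conv_single \<gamma>) (auto simp: indc_def split: if_splits intro: Ga_rng_eqD[OF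
        U])
    then have "indc (ginv G ` U) (1::'r) (gmul G (ginv G \<alpha>) \<gamma>) \<noteq> 0"
      using conv_unit_left[of d, OF dl(2) f(1), of "indc (ginv G ` U) 1"] nz by auto
    then obtain u where u: "u \<in> U" "gmul G (ginv G \<alpha>) \<gamma> = ginv G u"
      by (auto simp: indc_def split: if_splits)
    have "u \<in> garr G" using u GaD(1)[OF U] by blast
    then have "gsrc G u = gsrc G \<alpha>" using f(3) u(2) rng_inv by simp
    then have "u = \<alpha>" using GaD(2)[OF U] u \<alpha> by (auto dest: inj_onD)
    then have "gmul G \<alpha> (ginv G \<alpha>) = \<gamma>" using mul_inv_mul[OF \<alpha>(1) \<gamma> \<alpha>(2)] u by simp
    then show ?thesis using rng_unit[OF \<alpha>(1)] by (simp add: grng_def)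
  qed
  then show ?thesis using dl(1) U by (auto simp: stb_simps conv_closed indc_lcc inv_Ga)
qed

lemma normpair_indc: assumes U: "U \<in> Ga G"
  shows "normpair (stb :: ('a \<Rightarrow> 'r::comm_ring_1, 'r) dalg) (indc U 1) (indc (ginv G ` U) 1)"
proof -
  have U': "ginv G ` U \<in> Ga G" "ginv G ` ginv G ` U = U"
    using inv_Ga[OF U] GaD(1)[OF U] inv_inv by (force simp: image_image)+
  have e: "gsrc G ` U \<subseteq> gunits G" "grng G ` U \<subseteq> gunits G"
    using GaD(1)[OF U] src_unit rng_unit by blast+
  have e': "gsrc G ` ginv G ` U = grng G ` U" using GaD(1)[OF U] src_inv
    by (force simp: image_image)
  have "bis_mul G U (gsrc G ` U) = U" "bis_mul G (ginv G ` U) (gsrc G ` ginv G ` U) = ginv G ` U"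
    using bis_mul_units[OF GaD(1)[OF U] e(1)] bis_mul_units[OF GaD(1)[OF U'(1)]] e e' by auto
  then have "conv (indc U 1) (conv (indc (ginv G ` U) 1) (indc U 1)) = (indc U 1 :: _ \<Rightarrow> 'r)"
    "conv (indc (ginv G ` U) 1) (conv (indc U 1) (indc (ginv G ` U) 1)) =
      (indc (ginv G ` U) 1 :: _ \<Rightarrow> 'r)"
    using U U' e' Ga_src[OF U] Ga_rng[OF U]
    by (simp_all add: conv_indc bis_mul_inv_left bis_mul_inv_right)
  moreover have "conv (indc (ginv G ` U) 1) (indc U 1) \<in> adiag (stb :: ('a \<Rightarrow> 'r, 'r) dalg)"
    "conv (indc U 1) (indc (ginv G ` U) 1) \<in> adiag (stb :: ('a \<Rightarrow> 'r, 'r) dalg)"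
    using U U' e Ga_src[OF U] Ga_rng[OF U]
    by (auto simp: stb_simps conv_indc bis_mul_inv_left bis_mul_inv_right indc_lcc)
      (auto simp: indc_def split: if_splits)
  ultimately show ?thesis
    using U U' conv_indc_conj_diag[OF U] conv_indc_conj_diag[OF U'(1)]
    by (auto simp: normpair_def stb_simps(1,2) indc_lcc)
qed

end

section \<open>Normalizers and arrows without isotropy\<close>

context generic_ample
begin

text \<open>The isotropy group at the unit \<open>x\<close> is trivial.\<close>

definition gen :: "'a \<Rightarrow> bool" where
  "gen x \<longleftrightarrow> (\<forall>h\<in>garr G. \<forall>k\<in>garr G. gsrc G h = x \<longrightarrow> gsrc G k = x \<longrightarrow> grng G h = grng G k \<longrightarrow> h = k)"

lemma genD: "gen x \<Longrightarrow> h \<in> garr G \<Longrightarrow> k \<in> garr G \<Longrightarrow> gsrc G h = x \<Longrightarrow> gsrc G k = x \<Longrightarrow>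
    grng G h = grng G k \<Longrightarrow> h = k"
  unfolding gen_def by blast

lemma gen_dense: assumes "openin (gtop G) W" "W \<noteq> {}"
  obtains g where "g \<in> W" "g \<in> garr G" "gen (gsrc G g)"
  by (rule genericE[OF assms]) (metis gen_def)

text \<open>Composing with \<open>g\<close> on the right turns parallel arrows from the range of
  \<open>g\<close> into parallel arrows from its source.\<close>

lemma gen_orbit: assumes "gen (gsrc G g)" "g \<in> garr G" shows "gen (grng G g)"
  unfolding gen_def
proof (intro ballI impI)
  fix h k assume hk: "h \<in> garr G" "k \<in> garr G" "gsrc G h = grng G g" "gsrc G k = grng G g"
    "grng G h = grng G k"
  have c: "composable G h g" "composable G k g" using hk assms(2) by (auto simp: composable_def)
  have "gmul G h g = gmul G k g"
    using c hk(5) by - (rule genD[OF assms(1)], simp_all add: mul_closed src_mul rng_mul)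
  then show "h = k" using mul_inv_cancel c by metis
qed

text \<open>Shrinking the diagonal element \<open>1\<^sub>E\<close> to a small neighbourhood \<open>E\<close> of the source of \<open>\<alpha>\<close>
  isolates one summand of \<open>n 1\<^sub>E n'\<close> at \<open>\<alpha>\<beta>\<close>.\<close>

lemma normpair_orthogonal:
  fixes n n' :: "'a \<Rightarrow> 'r::comm_ring_1"
  assumes n: "normpair stb n n'" and c: "composable G \<alpha> \<beta>" and gen: "gen (gsrc G \<beta>)"
    and nu: "gmul G \<alpha> \<beta> \<notin> gunits G"
  shows "n \<alpha> * n' \<beta> = 0"
proof -
  let ?\<gamma> = "gmul G \<alpha> \<beta>"
  have \<alpha>\<beta>: "\<alpha> \<in> garr G" "\<beta> \<in> garr G" "gsrc G \<alpha> = grng G \<beta>" using c by (auto simp: composable_def)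
  have \<gamma>: "?\<gamma> \<in> garr G" "gsrc G ?\<gamma> = gsrc G \<beta>" "grng G ?\<gamma> = grng G \<alpha>"
    using c mul_closed src_mul rng_mul by auto
  have nl: "n \<in> lcc (gtop G)" using n by (simp add: normpair_def stb_simps)
  define F where "F = {\<alpha>' \<in> garr G. grng G \<alpha>' = grng G ?\<gamma> \<and> n \<alpha>' \<noteq> 0}"
  have F: "finite F" using finite_fiber[OF nl] by (simp add: F_def)
  \<comment> \<open>Such an \<open>\<alpha>'\<close> and \<open>\<alpha>\<close> give parallel
    arrows from the source of \<open>\<beta>\<close> to the source of \<open>\<alpha>\<close>, which
    trivial isotropy identifies; cancelling \<open>\<beta>\<close> yields equality.\<close>
  have inj: "\<alpha>' = \<alpha>" if "\<alpha>' \<in> F" "gsrc G \<alpha>' = gsrc G \<alpha>" for \<alpha>'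
  proof -
    have \<alpha>': "\<alpha>' \<in> garr G" "grng G \<alpha>' = grng G ?\<gamma>" using that by (auto simp: F_def)
    have "gmul G (ginv G \<alpha>') ?\<gamma> = gmul G (ginv G \<alpha>) ?\<gamma>"
      using inv_mul_facts[OF \<alpha>'(1) \<gamma>(1) \<alpha>'(2)] inv_mul_facts[OF \<alpha>\<beta>(1) \<gamma>(1)] that(2) \<gamma>
      by - (rule genD[OF gen], auto)
    then have b: "gmul G (ginv G \<alpha>') ?\<gamma> = \<beta>" using inv_mul_cancel[OF c] by simp
    then have ga: "gmul G \<alpha>' \<beta> = gmul G \<alpha> \<beta>" using mul_inv_mul[OF \<alpha>'(1) \<gamma>(1) \<alpha>'(2)] by simp
    have c': "composable G \<alpha>' \<beta>" using \<alpha>' \<alpha>\<beta> that(2) by (simp add: composable_def)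
    from mul_inv_cancel[OF c'] have "gmul G ?\<gamma> (ginv G \<beta>) = \<alpha>'" by (simp only: ga)
    with mul_inv_cancel[OF c] show ?thesis by (simp only:)
  qed
  \<comment> \<open>Delete the sources of the finitely many competing arrows; by \<open>inj\<close>
    the source of \<open>\<alpha>\<close> is not among them.\<close>
  let ?W = "topspace (gtop G) - gsrc G ` (F - {\<alpha>})"
  have "gsrc G ` (F - {\<alpha>}) \<subseteq> topspace (gtop G)" by (auto simp: topspace_garr F_def src_garr)
  then have "closedin (gtop G) (gsrc G ` (F - {\<alpha>}))"
    using F by (intro closedin_Hausdorff_finite[OF hausdorff]) auto
  then have "openin (gtop G) ?W" by (simp add: openin_diff)
  moreover have "gsrc G \<alpha> \<in> ?W" using inj src_garr[OF \<alpha>\<beta>(1)] topspace_garr by auto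
  ultimately obtain E where E: "E \<in> Ga G" "E \<subseteq> gunits G" "gsrc G \<alpha> \<in> E" "E \<subseteq> ?W"
    using unit_nbhd[OF src_unit[OF \<alpha>\<beta>(1)]] by blast
  have "indc E 1 \<in> adiag (stb :: ('a \<Rightarrow> 'r, 'r) dalg)"
    using E indc_lcc by (auto simp: stb_simps indc_def split: if_splits)
  then have "conv n (conv (indc E 1) n') \<in> adiag (stb :: ('a \<Rightarrow> 'r, 'r) dalg)"
    using n by (simp add: normpair_def stb_simps(2))
  then have z: "conv n (conv (indc E 1) n') ?\<gamma> = 0" using nu by (auto simp: stb_simps)
  have val: "conv (indc E 1) n' (gmul G (ginv G \<alpha>') ?\<gamma>) =
      (if gsrc G \<alpha>' \<in> E then n' (gmul G (ginv G \<alpha>') ?\<gamma>) else 0)"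
    if \<alpha>': "\<alpha>' \<in> garr G" "grng G \<alpha>' = grng G ?\<gamma>" for \<alpha>'
  proof -
    have "indc E (1::'r) g \<noteq> 0 \<Longrightarrow> g \<in> gunits G" for g using E(2)
      by (auto simp: indc_def split: if_splits)
    from conv_unit_left[of "indc E 1 :: _ \<Rightarrow> 'r", OF this inv_mul_facts(1)[OF \<alpha>'(1) \<gamma>(1) \<alpha>'(2)]]
    show ?thesis using inv_mul_facts(3)[OF \<alpha>'(1) \<gamma>(1) \<alpha>'(2)] by (simp add: indc_def)
  qed
  have "conv n (conv (indc E 1) n') ?\<gamma> =
    (\<Sum>\<alpha>'\<in>insert \<alpha> F. n \<alpha>' * conv (indc E 1) n' (gmul G (ginv G \<alpha>') ?\<gamma>))"
    using F \<alpha>\<beta> \<gamma> by (intro conv_eq \<gamma>(1)) (auto simp: F_def)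
  also have "\<dots> = (\<Sum>\<alpha>'\<in>insert \<alpha> F. if \<alpha>' = \<alpha> then n \<alpha> * n' \<beta> else 0)"
  proof (rule sum.cong)
    fix \<alpha>' assume a: "\<alpha>' \<in> insert \<alpha> F"
    then have \<alpha>': "\<alpha>' \<in> garr G" "grng G \<alpha>' = grng G ?\<gamma>" using \<alpha>\<beta> \<gamma> by (auto simp: F_def)
    show "n \<alpha>' * conv (indc E 1) n' (gmul G (ginv G \<alpha>') ?\<gamma>) = (if \<alpha>' = \<alpha> then n \<alpha> * n' \<beta> else 0)"
    proof (cases "\<alpha>' = \<alpha>")
      case True
      then show ?thesis using val[OF \<alpha>'] E(3) inv_mul_cancel[OF c] by simp
    next
      case False
      then have "gsrc G \<alpha>' \<notin> E" using a E(4) by auto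
      then show ?thesis using val[OF \<alpha>'] False by simp
    qed
  qed simp
  also have "\<dots> = n \<alpha> * n' \<beta>" using F by simp
  finally show ?thesis using z by simp
qed

text \<open>At arrows without isotropy, \<open>n(\<gamma>) n'(\<gamma>\<inverse>)\<close> is an idempotent of the indecomposable ring \<open>R\<close>.\<close>

lemma normpair_inverse_generic:
  fixes n n' :: "'a \<Rightarrow> 'r::comm_ring_1"
  assumes R: "indecomposable_ring TYPE('r)"
    and n: "normpair stb n n'" and g: "\<gamma> \<in> garr G" "gen (gsrc G \<gamma>)" "n \<gamma> \<noteq> 0"
  shows "n \<gamma> * n' (ginv G \<gamma>) = 1"
proof -
  let ?u = "gsrc G \<gamma>"
  have nl: "n \<in> lcc (gtop G)" "n' \<in> lcc (gtop G)" using n by (simp_all add: normpair_def stb_simps)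
  \<comment> \<open>Since \<open>conv n' n\<close> is diagonal, the outer sum reduces to its term at
    \<open>\<gamma>\<close>.\<close>
  have "n \<gamma> = conv n (conv n' n) \<gamma>" using n by (simp add: normpair_def stb_simps(2))
  also have "\<dots> = (\<Sum>\<alpha>\<in>{\<alpha> \<in> garr G. grng G \<alpha> = grng G \<gamma> \<and>
    n \<alpha> \<noteq> 0}. n \<alpha> * conv n' n (gmul G (ginv G \<alpha>) \<gamma>))"
    using finite_fiber[OF nl(1)] by (intro conv_eq g) auto
  also have "\<dots> = (\<Sum>\<alpha>\<in>{\<alpha> \<in> garr G. grng G \<alpha> = grng G \<gamma> \<and> n \<alpha> \<noteq> 0}.
    if \<alpha> = \<gamma> then n \<gamma> * conv n' n ?u else 0)"
  proof (rule sum.cong)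
    fix \<alpha> assume \<alpha>: "\<alpha> \<in> {\<alpha> \<in> garr G. grng G \<alpha> = grng G \<gamma> \<and> n \<alpha> \<noteq> 0}"
    have d: "conv n' n \<in> adiag (stb :: ('a \<Rightarrow> 'r, 'r) dalg)" using n
      by (simp add: normpair_def stb_simps(2))
    show "n \<alpha> * conv n' n (gmul G (ginv G \<alpha>) \<gamma>) = (if \<alpha> = \<gamma> then n \<gamma> * conv n' n ?u else 0)"
    proof (cases "\<alpha> = \<gamma>")
      case False
      then have "gmul G (ginv G \<alpha>) \<gamma> \<notin> gunits G" using inv_mul_unit_iff[of \<alpha> \<gamma>] \<alpha> g(1) by simp
      then have "conv n' n (gmul G (ginv G \<alpha>) \<gamma>) = 0" using d by (auto simp: stb_simps)
      then show ?thesis using False by simp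
    qed (simp add: gsrc_def)
  qed simp
  also have "\<dots> = n \<gamma> * conv n' n ?u" using finite_fiber[OF nl(1)] g by simp
  finally have 1: "n \<gamma> = n \<gamma> * conv n' n ?u" .
  define F where "F = insert (ginv G \<gamma>) {\<beta> \<in> garr G. grng G \<beta> = grng G ?u \<and> n' \<beta> \<noteq> 0}"
  have "conv n' n ?u = (\<Sum>\<beta>\<in>F. n' \<beta> * n (gmul G (ginv G \<beta>) ?u))"
    using finite_fiber[OF nl(2)] g src_garr
    by (intro conv_eq) (auto simp: F_def inv_closed rng_inv rng_src)
  then have "n \<gamma> * conv n' n ?u = (\<Sum>\<beta>\<in>F. n \<gamma> * (n' \<beta> * n (gmul G (ginv G \<beta>) ?u)))"
    by (simp add: sum_distrib_left)
  \<comment> \<open>By \<open>normpair_orthogonal\<close> every \<open>\<beta>\<close> other than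
    the inverse of \<open>\<gamma>\<close> contributes \<open>0\<close>, because
    \<open>gmul G \<gamma> \<beta>\<close> is then not a unit.\<close>
  also have "\<dots> = (\<Sum>\<beta>\<in>F. if \<beta> = ginv G \<gamma> then n \<gamma> * n' (ginv G \<gamma>) * n \<gamma> else 0)"
  proof (rule sum.cong)
    fix \<beta> assume "\<beta> \<in> F"
    then have \<beta>: "\<beta> \<in> garr G" "grng G \<beta> = gsrc G \<gamma>"
      using g(1) by (auto simp: F_def inv_closed rng_inv rng_src)
    show "n \<gamma> * (n' \<beta> * n (gmul G (ginv G \<beta>) ?u)) =
        (if \<beta> = ginv G \<gamma> then n \<gamma> * n' (ginv G \<gamma>) * n \<gamma> else 0)"
    proof (cases "\<beta> = ginv G \<gamma>")
      case True
      then show ?thesis using g(1) by (simp add: inv_inv mul_src mult.assoc)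
    next
      case False
      have c: "composable G \<gamma> \<beta>" using \<beta> g by (simp add: composable_def)
      have "gmul G (ginv G (ginv G \<gamma>)) \<beta> \<in> gunits G \<longleftrightarrow> ginv G \<gamma> = \<beta>"
        using \<beta> g by (intro inv_mul_unit_iff) (auto simp: inv_closed rng_inv)
      then have nu: "gmul G \<gamma> \<beta> \<notin> gunits G" using False g(1) inv_inv by simp
      have "gen (gsrc G \<beta>)"
        using gen_orbit[of "ginv G \<beta>"] \<beta> g(2) by (simp add: src_inv rng_inv inv_closed)
      then have "n \<gamma> * n' \<beta> = 0" by (rule normpair_orthogonal[OF n c _ nu])
      then have "n \<gamma> * n' \<beta> * n (gmul G (ginv G \<beta>) ?u) = 0" by simp
      then show ?thesis using False by (simp add: mult.assoc)
    qed
  qed simp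
  also have "\<dots> = n \<gamma> * n' (ginv G \<gamma>) * n \<gamma>" using finite_fiber[OF nl(2)] by (simp add: F_def)
  finally have 2: "n \<gamma> * n' (ginv G \<gamma>) * n \<gamma> = n \<gamma>" using 1 by simp
  \<comment> \<open>\<open>?e\<close> is idempotent and fixes the nonzero value
    \<open>n \<gamma>\<close>, so it cannot be \<open>0\<close>.\<close>
  let ?e = "n \<gamma> * n' (ginv G \<gamma>)"
  have "?e * ?e = (n \<gamma> * n' (ginv G \<gamma>) * n \<gamma>) * n' (ginv G \<gamma>)" by (simp only: mult.assoc)
  then have "?e * ?e = ?e" by (simp only: 2)
  then have "?e = 0 \<or> ?e = 1" using R by (simp add: indecomposable_ring_def)
  then show ?thesis using 2 g(3) by auto
qed

lemma lcc_const_nbhd: assumes "f \<in> lcc (gtop G)" "g \<in> garr G" "openin (gtop G) W" "g \<in> W"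
  obtains U where "U \<in> Ga G" "g \<in> U" "U \<subseteq> W" "\<And>h. h \<in> U \<Longrightarrow> f h = f g"
proof -
  obtain V where V: "openin (gtop G) V" "g \<in> V" "\<forall>h\<in>V. f h = f g"
    using lccD(2)[OF assms(1)] assms(2) topspace_garr by blast
  obtain U where "U \<in> Ga G" "g \<in> U" "U \<subseteq> V \<inter> W" using base[of "V \<inter> W" g] V assms by blast
  then show thesis using that V(3) by blast
qed

text \<open>Both \<open>n\<close> and \<open>n'\<close> are locally constant, so some arrow without
  isotropy close to \<open>\<gamma>\<close> has the same two values.\<close>

lemma normpair_inverse:
  fixes n n' :: "'a \<Rightarrow> 'r::comm_ring_1"
  assumes R: "indecomposable_ring TYPE('r)"
    and n: "normpair stb n n'" and g: "\<gamma> \<in> garr G" "n \<gamma> \<noteq> 0"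
  shows "n \<gamma> * n' (ginv G \<gamma>) = 1"
proof -
  have nl: "n \<in> lcc (gtop G)" "n' \<in> lcc (gtop G)" using n by (simp_all add: normpair_def stb_simps)
  obtain U where U: "U \<in> Ga G" "\<gamma> \<in> U" "\<And>h. h \<in> U \<Longrightarrow> n h = n \<gamma>"
    using lcc_const_nbhd[OF nl(1) g(1), of "garr G"] g(1) topspace_garr by (metis openin_topspace)
  obtain V where V: "V \<in> Ga G" "ginv G \<gamma> \<in> V" "\<And>h. h \<in> V \<Longrightarrow> n' h = n' (ginv G \<gamma>)"
    using lcc_const_nbhd[OF nl(2) inv_closed[OF g(1)], of
      "garr G"] inv_closed[OF g(1)] topspace_garr
    by (metis openin_topspace)
  have "\<gamma> \<in> U \<inter> ginv G ` V" using U V inv_inv[OF g(1)] by (metis IntI image_eqI)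
  moreover have "openin (gtop G) (U \<inter> ginv G ` V)"
    using GaD(4)[OF Ga_Int[OF U(1) inv_Ga[OF V(1)]]] .
  ultimately obtain \<delta> where \<delta>: "\<delta> \<in> U \<inter> ginv G ` V" "\<delta> \<in> garr G" "gen (gsrc G \<delta>)"
    using gen_dense by blast
  have "ginv G \<delta> \<in> V" using \<delta>(1) inv_inv GaD(1)[OF V(1)] by auto
  then have "n' (ginv G \<delta>) = n' (ginv G \<gamma>)" "n \<delta> = n \<gamma>" using V(3) U(3) \<delta>(1) by blast+
  then show ?thesis using normpair_inverse_generic[OF R n \<delta>(2,3)] g(2) by simp
qed

text \<open>Two distinct arrows of the support with a common source have disjoint neighbourhoods on
  which \<open>n\<close> is constant. Density supplies an arrow without isotropy at its source in
  the first, with a partner of the same source in the second. Orthogonality then makes the product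
  of \<open>n\<close> at one and \<open>n'\<close> at the inverse of the other vanish, although the
  second factor is invertible.\<close>

lemma normpair_inj_src:
  fixes n n' :: "'a \<Rightarrow> 'r::comm_ring_1"
  assumes R: "indecomposable_ring TYPE('r)"
    and n: "normpair stb n n'" and g: "n \<gamma> \<noteq> 0" "n \<gamma>' \<noteq> 0" "gsrc G \<gamma> = gsrc G \<gamma>'"
  shows "\<gamma> = \<gamma>'"
proof (rule ccontr)
  assume ne: "\<gamma> \<noteq> \<gamma>'"
  have nl: "n \<in> lcc (gtop G)" using n by (simp_all add: normpair_def stb_simps)
  have gG: "\<gamma> \<in> garr G" "\<gamma>' \<in> garr G" using g lcc_garr[OF nl] by blast+
  obtain A B where AB: "openin (gtop G) A" "openin (gtop G) B" "\<gamma> \<in> A" "\<gamma>' \<in> B" "disjnt A B"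
    using hausdorff gG ne topspace_garr unfolding Hausdorff_space_def by metis
  obtain U where U: "U \<in> Ga G" "\<gamma> \<in> U" "U \<subseteq> A" "\<And>h. h \<in> U \<Longrightarrow> n h = n \<gamma>"
    using lcc_const_nbhd[OF nl gG(1) AB(1,3)] by blast
  obtain V where V: "V \<in> Ga G" "\<gamma>' \<in> V" "V \<subseteq> B" "\<And>h. h \<in> V \<Longrightarrow> n h = n \<gamma>'"
    using lcc_const_nbhd[OF nl gG(2) AB(2,4)] by blast
  have "\<gamma> \<in> {u \<in> U. gsrc G u \<in> gsrc G ` V}" using U V g(3) by auto
  then obtain \<delta> where \<delta>: "\<delta> \<in> U" "gsrc G \<delta> \<in> gsrc G ` V" "\<delta> \<in> garr G" "gen (gsrc G \<delta>)"
    using gen_dense[OF GaD(4)[OF Ga_restrict_src[OF U(1) V(1)]]] by blast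
  then obtain \<delta>' where \<delta>': "\<delta>' \<in> V" "gsrc G \<delta> = gsrc G \<delta>'" by blast
  have \<delta>'G: "\<delta>' \<in> garr G" using \<delta>' GaD(1)[OF V(1)] by blast
  have ne': "\<delta> \<noteq> \<delta>'" using \<delta> \<delta>' U V AB by (auto simp: disjnt_iff)
  have nz: "n \<delta> \<noteq> 0" "n \<delta>' \<noteq> 0" using U(4)[OF \<delta>(1)] V(4)[OF \<delta>'(1)] g by auto
  have c: "composable G \<delta> (ginv G \<delta>')" using \<delta> \<delta>'G \<delta>'(2)
    by (simp add: composable_def inv_closed rng_inv)
  have "gmul G (ginv G (ginv G \<delta>)) (ginv G \<delta>') \<in> gunits G \<longleftrightarrow> ginv G \<delta> = ginv G \<delta>'"
    using \<delta> \<delta>'G \<delta>'(2) by (intro inv_mul_unit_iff) (auto simp: inv_closed rng_inv)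
  then have nu: "gmul G \<delta> (ginv G \<delta>') \<notin> gunits G" using ne' inv_inj \<delta>(3) \<delta>'G inv_inv by metis
  have "gen (gsrc G (ginv G \<delta>'))" using gen_orbit[of \<delta>'] \<delta>(4) \<delta>' \<delta>'G by (simp add: src_inv)
  then have "n \<delta> * n' (ginv G \<delta>') = 0" by (rule normpair_orthogonal[OF n c _ nu])
  then have "n \<delta> * (n \<delta>' * n' (ginv G \<delta>')) = 0" by (metis mult.left_commute mult_zero_right)
  then show False using normpair_inverse[OF R n \<delta>'G nz(2)] nz(1) by simp
qed

lemma normpair_support:
  fixes n n' :: "'a \<Rightarrow> 'r::comm_ring_1"
  assumes R: "indecomposable_ring TYPE('r)" and n: "normpair stb n n'"
  shows "{g. n g \<noteq> 0} \<in> Ga G"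
proof -
  have nl: "n \<in> lcc (gtop G)" using n by (simp add: normpair_def stb_simps)
  have G: "g \<in> garr G" if "n g \<noteq> 0" for g using that lcc_garr[OF nl] by blast
  have "g = h" if "n g \<noteq> 0" "n h \<noteq> 0" "grng G g = grng G h" for g h
  proof -
    \<comment> \<open>Inverses of arrows in the support of \<open>n\<close> lie in the support of
      \<open>n'\<close>, so injectivity of the range follows from injectivity of the source for the
      partner.\<close>
    have "n' (ginv G g) \<noteq> 0" "n' (ginv G h) \<noteq> 0"
      using normpair_inverse[OF R n] G that by force+
    then have "ginv G g = ginv G h"
      using that(3) G[OF that(1)] G[OF that(2)]
      by - (rule normpair_inj_src[OF R normpair_sym[OF n]], auto simp: src_inv)
    then show ?thesis using inv_inj G that by blast
  qed
  moreover have "g = h" if "n g \<noteq> 0" "n h \<noteq> 0" "gsrc G g = gsrc G h" for g h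
    by (rule normpair_inj_src[OF R n that])
  ultimately have "bisection G {g. n g \<noteq> 0}" using G by (auto simp: bisection_def inj_on_def)
  then show ?thesis using lccD(3)[OF nl] lcc_support(1)[OF nl] by (simp add: Ga_def)
qed

text \<open>Injectivity of the range on the support of \<open>n\<close> leaves a single term in each
  convolution, and this term does not vanish because the values of \<open>m\<close> on its support
  are invertible.\<close>

lemma normpair_support_mult:
  fixes n n' m m' :: "'a \<Rightarrow> 'r::comm_ring_1"
  assumes R: "indecomposable_ring TYPE('r)" and n: "normpair stb n n'" and m: "normpair stb m m'"
  shows "{g. conv n m g \<noteq> 0} = bis_mul G {g. n g \<noteq> 0} {g. m g \<noteq> 0}"
proof
  note Un = normpair_support[OF R n]
  have nG: "g \<in> garr G" if "n g \<noteq> 0" for g using GaD(1)[OF Un] that by blast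
  have mG: "g \<in> garr G" if "m g \<noteq> 0" for g using GaD(1)[OF normpair_support[OF R m]] that by blast
  have val: "conv n m \<gamma> = n \<alpha> * m (gmul G (ginv G \<alpha>) \<gamma>)"
    if "n \<alpha> \<noteq> 0" "\<gamma> \<in> garr G" "grng G \<alpha> = grng G \<gamma>" for \<alpha> \<gamma>
    using that nG by (intro conv_single) (auto intro: Ga_rng_eqD[OF Un])
  show "{g. conv n m g \<noteq> 0} \<subseteq> bis_mul G {g. n g \<noteq> 0} {g. m g \<noteq> 0}"
  proof
    fix \<gamma> assume "\<gamma> \<in> {g. conv n m g \<noteq> 0}"
    then have nz: "conv n m \<gamma> \<noteq> 0" by simp
    have \<gamma>: "\<gamma> \<in> garr G" using nz conv_outside by metis
    obtain \<alpha> where \<alpha>: "\<alpha> \<in> garr G" "grng G \<alpha> = grng G \<gamma>" "n \<alpha> \<noteq> 0" using nz conv_none[of \<gamma> n]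
      by metis
    have "m (gmul G (ginv G \<alpha>) \<gamma>) \<noteq> 0" using val[OF \<alpha>(3) \<gamma> \<alpha>(2)] nz by auto
    moreover have "composable G \<alpha> (gmul G (ginv G \<alpha>) \<gamma>)"
      using inv_mul_facts[OF \<alpha>(1) \<gamma> \<alpha>(2)] \<alpha> by (simp add: composable_def)
    ultimately have "gmul G \<alpha> (gmul G (ginv G \<alpha>) \<gamma>) \<in> bis_mul G {g. n g \<noteq> 0} {g. m g \<noteq> 0}"
      using \<alpha> by (intro bis_mulI) auto
    then show "\<gamma> \<in> bis_mul G {g. n g \<noteq> 0} {g. m g \<noteq> 0}" using mul_inv_mul[OF \<alpha>(1) \<gamma> \<alpha>(2)] by simp
  qed
  show "bis_mul G {g. n g \<noteq> 0} {g. m g \<noteq> 0} \<subseteq> {g. conv n m g \<noteq> 0}"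
  proof
    fix \<gamma> assume "\<gamma> \<in> bis_mul G {g. n g \<noteq> 0} {g. m g \<noteq> 0}"
    then obtain u v where uv: "n u \<noteq> 0" "m v \<noteq> 0" "composable G u v" "\<gamma> = gmul G u v"
      by (auto elim: bis_mulE)
    have "conv n m \<gamma> = n u * m v"
      using val[OF uv(1), of \<gamma>] uv mul_closed[OF uv(3)] rng_mul[OF uv(3)] inv_mul_cancel[OF uv(3)]
        by simp
    moreover have "n u * m v \<noteq> 0"
    proof
      assume "n u * m v = 0"
      then have "n u * (m v * m' (ginv G v)) = 0" by (metis mult.assoc mult_zero_left)
      then show False using normpair_inverse[OF R m mG[OF uv(2)] uv(2)] uv(1) by simp
    qed
    ultimately show "\<gamma> \<in> {g. conv n m g \<noteq> 0}" by simp
  qed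
qed

text \<open>The support order on normalizers is visible to the pair (algebra, diagonal).\<close>

lemma normpair_support_subset_iff:
  fixes n n' m m' :: "'a \<Rightarrow> 'r::comm_ring_1"
  assumes R: "indecomposable_ring TYPE('r)" and n: "normpair stb n n'" and m: "normpair stb m m'"
  shows "{g. n g \<noteq> 0} \<subseteq> {g. m g \<noteq> 0} \<longleftrightarrow> (\<exists>d\<in>adiag stb. n = amul stb d m)"
proof
  assume sub: "{g. n g \<noteq> 0} \<subseteq> {g. m g \<noteq> 0}"
  note Un = normpair_support[OF R n] and Um = normpair_support[OF R m]
  have nG: "g \<in> garr G" if "n g \<noteq> 0" for g using GaD(1)[OF Un] that by blast
  have mG: "g \<in> garr G" if "m g \<noteq> 0" for g using GaD(1)[OF Um] that by blast
  \<comment> \<open>If \<open>n\<close> is \<open>d\<close> times \<open>m\<close> with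
    \<open>d\<close> diagonal, multiplying by the partner of \<open>m\<close> suggests this choice
    of \<open>d\<close>.\<close>
  let ?d = "conv n m'"
  have val: "?d \<gamma> = n \<alpha> * m' (gmul G (ginv G \<alpha>) \<gamma>)"
    if "n \<alpha> \<noteq> 0" "\<gamma> \<in> garr G" "grng G \<alpha> = grng G \<gamma>" for \<alpha> \<gamma>
    using that nG by (intro conv_single) (auto intro: Ga_rng_eqD[OF Un])
  \<comment> \<open>A nonzero value at \<open>\<gamma>\<close> makes the inverse of
    \<open>?\<beta>\<close> an arrow in the support of \<open>m\<close> with the source of
    \<open>\<alpha>\<close>. By \<open>sub\<close> the arrow \<open>\<alpha>\<close> is another, so
    they agree and \<open>\<gamma>\<close> is the range of \<open>\<alpha>\<close>.\<close>
  have du: "\<gamma> \<in> gunits G" if nz: "?d \<gamma> \<noteq> 0" for \<gamma>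
  proof -
    have \<gamma>: "\<gamma> \<in> garr G" using nz conv_outside by metis
    obtain \<alpha> where \<alpha>: "\<alpha> \<in> garr G" "grng G \<alpha> = grng G \<gamma>" "n \<alpha> \<noteq> 0" using nz conv_none[of \<gamma> n]
      by metis
    let ?\<beta> = "gmul G (ginv G \<alpha>) \<gamma>"
    have \<beta>: "m' ?\<beta> \<noteq> 0" "?\<beta> \<in> garr G" "grng G ?\<beta> = gsrc G \<alpha>"
      using val[OF \<alpha>(3) \<gamma> \<alpha>(2)] nz inv_mul_facts[OF \<alpha>(1) \<gamma> \<alpha>(2)] by auto
    have "m (ginv G ?\<beta>) \<noteq> 0" using normpair_inverse[OF R normpair_sym[OF m] \<beta>(2,1)] by auto
    moreover have "m \<alpha> \<noteq> 0" using sub \<alpha> by blast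
    moreover have "gsrc G (ginv G ?\<beta>) = gsrc G \<alpha>" using \<beta> src_inv by simp
    ultimately have "ginv G ?\<beta> = \<alpha>" using Ga_src_eqD[OF Um] by blast
    from arg_cong[OF this, of "ginv G"] have "?\<beta> = ginv G \<alpha>" by (simp only: inv_inv[OF \<beta>(2)])
    with mul_inv_mul[OF \<alpha>(1) \<gamma> \<alpha>(2)] have "grng G \<alpha> = \<gamma>" by (simp only: grng_def)
    then show ?thesis using rng_unit[OF \<alpha>(1)] by simp
  qed
  have "n \<in> lcc (gtop G)" using n by (simp add: normpair_def stb_simps)
  moreover have "m' \<in> lcc (gtop G)" using m by (simp add: normpair_def stb_simps)
  ultimately have "?d \<in> adiag stb" using du by (simp add: stb_simps conv_closed)
  moreover have "n = conv ?d m"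
  proof
    fix \<gamma>
    show "n \<gamma> = conv ?d m \<gamma>"
    proof (cases "m \<gamma> = 0")
      case True
      have "conv ?d m \<gamma> = 0"
        using conv_unit_left[of ?d \<gamma> m] du True conv_outside by (cases "\<gamma> \<in> garr G") auto
      then show ?thesis using True sub by auto
    next
      case False
      have \<gamma>: "\<gamma> \<in> garr G" using mG False .
      have eq: "conv ?d m \<gamma> = ?d (grng G \<gamma>) * m \<gamma>" using conv_unit_left[of ?d \<gamma> m] du \<gamma> by simp
      show ?thesis
      proof (cases "n \<gamma> = 0")
        case True
        have "?d (grng G \<gamma>) = 0"
        proof (rule conv_none, rule ccontr)
          fix \<alpha> assume \<alpha>: "\<alpha> \<in> garr G" "grng G \<alpha> = grng G (grng G \<gamma>)" "n \<alpha> \<noteq> 0"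
          then have "m \<alpha> \<noteq> 0" using sub by blast
          then have "\<alpha> = \<gamma>" using False \<alpha> \<gamma> by - (rule Ga_rng_eqD[OF Um], auto simp: rng_rng)
          then show False using True \<alpha> by simp
        qed
        then show ?thesis using eq True by simp
      next
        case nz: False
        have "?d (grng G \<gamma>) = n \<gamma> * m' (gmul G (ginv G \<gamma>) (grng G \<gamma>))"
          using \<gamma> by (intro val[OF nz]) (auto simp: rng_garr rng_rng)
        also have "gmul G (ginv G \<gamma>) (grng G \<gamma>) = ginv G \<gamma>"
          using mul_src[OF inv_closed[OF \<gamma>]] src_inv[OF \<gamma>] by simp
        finally have "?d (grng G \<gamma>) * m \<gamma> = n \<gamma> * (m \<gamma> * m' (ginv G \<gamma>))" by (simp add: mult_ac)
        then show ?thesis using eq normpair_inverse[OF R m \<gamma> False] by simp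
      qed
    qed
  qed
  ultimately show "\<exists>d\<in>adiag stb. n = amul stb d m" by (auto simp: stb_simps(2))
next
  assume "\<exists>d\<in>adiag stb. n = amul stb d m"
  then obtain d :: "'a \<Rightarrow> 'r" where d': "d \<in> adiag stb" "n = amul stb d m" by blast
  then have d: "\<And>g. d g \<noteq> 0 \<Longrightarrow> g \<in> gunits G" "n = conv d m" by (simp_all add: stb_simps)
  show "{g. n g \<noteq> 0} \<subseteq> {g. m g \<noteq> 0}"
  proof
    fix g assume "g \<in> {g. n g \<noteq> 0}"
    then have nz: "conv d m g \<noteq> 0" using d(2) by simp
    then have "g \<in> garr G" using conv_outside by metis
    then show "g \<in> {g. m g \<noteq> 0}" using conv_unit_left[of d g m] d(1) nz by auto
  qed
qed

end

text \<open>The isomorphism sends \<open>U\<close> to the support of \<open>\<Phi>\<close> of its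
  indicator. Different normalizers can share a support, but
  \<open>normpair_support_subset_iff\<close> expresses comparison of supports through the diagonal,
  so \<open>\<Phi>\<close> descends to supports.\<close>

theorem diagonal_ring_iso_imp_sg_iso:
  fixes G :: "'g tgpd" and H :: "'h tgpd"
  assumes R: "indecomposable_ring TYPE('r::comm_ring_1)"
    and G: "generic_ample G" and H: "generic_ample H"
    and iso: "ring_iso (steinberg G :: (_, 'r) dalg) (steinberg H) \<Phi>"
    and diag: "diag_preserving (steinberg G :: (_, 'r) dalg) (steinberg H) \<Phi>"
  shows "sg_isomorphic (Ga G) (bis_mul G) (Ga H) (bis_mul H)"
proof -
  interpret G: generic_ample G by fact
  interpret H: generic_ample H by fact
  have clG: "alg_closed (steinberg G :: (_, 'r) dalg)" and clH:
    "alg_closed (steinberg H :: (_, 'r) dalg)"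
    by (rule G.stb_closed H.stb_closed)+
  define supp where "supp f = {h. f h \<noteq> 0}" for f :: "'h \<Rightarrow> 'r"
  define suppG where "suppG f = {h. f h \<noteq> 0}" for f :: "'g \<Rightarrow> 'r"
  have suppG_indc: "suppG (indc U 1) = U" for U by (auto simp: suppG_def indc_def)
  have supp_indc: "supp (indc U 1) = U" for U by (auto simp: supp_def indc_def)
  have nG: "normpair (steinberg G) (indc U (1::'r)) (indc (ginv G ` U) 1)" if "U \<in> Ga G" for U
    using G.normpair_indc[OF that] .
  have n\<Phi>: "normpair (steinberg H) (\<Phi> n) (\<Phi> n')" if "normpair (steinberg G) n n'" for n n'
    by (rule normpair_iso[OF iso diag clG that])
  have bij: "bij_betw \<Phi> (acar (steinberg G)) (acar (steinberg H))" using iso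
    by (simp add: ring_iso_def)
  have mul: "\<Phi> (amul (steinberg G) x y) = amul (steinberg H) (\<Phi> x) (\<Phi> y)"
    if "x \<in> acar (steinberg G)" "y \<in> acar (steinberg G)" for x y using iso that
      by (simp add: ring_iso_def)
  have dsub: "d \<in> acar (steinberg G)" if "d \<in> adiag (steinberg G :: (_, 'r) dalg)" for d
    using clG that by (auto simp: alg_closed_def)
  have sub: "suppG n \<subseteq> suppG m \<longleftrightarrow> supp (\<Phi> n) \<subseteq> supp (\<Phi> m)"
    if n: "normpair (steinberg G) n n'" and m: "normpair (steinberg G) m m'" for n n' m m'
  proof -
    have c: "n \<in> acar (steinberg G)" "m \<in> acar (steinberg G)" using n m
      by (simp_all add: normpair_def)
    have "supp (\<Phi> n) \<subseteq> supp (\<Phi> m) \<longleftrightarrow>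
        (\<exists>d\<in>\<Phi> ` adiag (steinberg G). \<Phi> n = amul (steinberg H) d (\<Phi> m))"
      using H.normpair_support_subset_iff[OF R n\<Phi>[OF n] n\<Phi>[OF m]] diag
      by (simp add: supp_def diag_preserving_def)
    also have "\<dots> \<longleftrightarrow> (\<exists>d\<in>adiag (steinberg G). \<Phi> n = \<Phi> (amul (steinberg G) d m))"
      using mul dsub c by auto
    also have "\<dots> \<longleftrightarrow> (\<exists>d\<in>adiag (steinberg G). n = amul (steinberg G) d m)"
    proof -
      have "amul (steinberg G) d m \<in> acar (steinberg G)" if "d \<in> adiag (steinberg G)" for d
        using clG dsub[OF that] c by (simp add: alg_closed_def)
      then show ?thesis using bij c by (metis bij_betw_imp_inj_on inj_onD)
    qed
    finally show ?thesis using G.normpair_support_subset_iff[OF R n m] by (simp add: suppG_def)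
  qed
  let ?\<phi> = "\<lambda>U. supp (\<Phi> (indc U 1))"
  have mem: "?\<phi> U \<in> Ga H" if "U \<in> Ga G" for U
    using H.normpair_support[OF R n\<Phi>[OF nG[OF that]]] by (simp add: supp_def)
  have "inj_on ?\<phi> (Ga G)"
    by (intro inj_onI subset_antisym) (use sub[OF nG nG] suppG_indc in auto)
  moreover have "\<exists>U\<in>Ga G. ?\<phi> U = V" if V: "V \<in> Ga H" for V
  proof -
    \<comment> \<open>Pull the indicator of \<open>V\<close> back to a normalizer \<open>n\<close>
      with support \<open>U\<close>. The indicator of \<open>U\<close> has the same support as
      \<open>n\<close>, so their images have the same support, namely \<open>V\<close>.\<close>
    let ?\<Psi> = "inv_into (acar (steinberg G)) \<Phi>"
    define n where "n = ?\<Psi> (indc V 1)"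
    define n' where "n' = ?\<Psi> (indc (ginv H ` V) 1)"
    have iV: "normpair (steinberg H) (indc V (1::'r)) (indc (ginv H ` V) 1)"
      using H.normpair_indc[OF V] .
    have bk: "?\<Psi> y \<in> acar (steinberg G)" "\<Phi> (?\<Psi> y) = y" if "y \<in> acar (steinberg H)" for y
      using that bij_betw_inv_into_right[OF bij] bij_betwE[OF bij_betw_inv_into[OF bij]] by simp_all
    have c: "n \<in> acar (steinberg G)" "n' \<in> acar (steinberg G)" "\<Phi> n = indc V 1"
      "\<Phi> n' = indc (ginv H ` V) 1"
      using iV unfolding n_def n'_def normpair_def by (blast intro: bk)+
    have inj: "x = y" if "\<Phi> x = \<Phi> y" "x \<in> acar (steinberg G)" "y \<in> acar (steinberg G)" for x y
      using bij that by (meson bij_betw_imp_inj_on inj_onD)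
    have clm: "amul (steinberg G) x y \<in> acar (steinberg G)"
      if "x \<in> acar (steinberg G :: (_, 'r) dalg)" "y \<in> acar (steinberg G)" for x y
      using clG that by (simp add: alg_closed_def)
    have dback: "x \<in> adiag (steinberg G)" if "\<Phi> x \<in> adiag (steinberg H)" "x \<in> acar (steinberg G)"
      for x
    proof -
      have "\<Phi> x \<in> \<Phi> ` adiag (steinberg G)" using diag that(1) by (simp add: diag_preserving_def)
      then show ?thesis using inj that(2) dsub by blast
    qed
    have dfwd: "\<Phi> x \<in> adiag (steinberg H)" if "x \<in> adiag (steinberg G)" for x
      using diag that by (auto simp: diag_preserving_def)
    have np: "normpair (steinberg G) n n'"
      unfolding normpair_def
      by (intro conjI ballI c inj dback clm)
        (use iV c dsub dfwd in \<open>simp_all add: mul clm normpair_def\<close>)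
    define U where "U = suppG n"
    have U: "U \<in> Ga G" using G.normpair_support[OF R np] by (simp add: U_def suppG_def)
    have "?\<phi> U = supp (\<Phi> n)"
      by (intro subset_antisym sub[OF nG[OF U] np, THEN iffD1] sub[OF np nG[OF U], THEN iffD1])
        (simp_all add: suppG_indc U_def)
    then show ?thesis using U c supp_indc by auto
  qed
  ultimately have "bij_betw ?\<phi> (Ga G) (Ga H)"
    unfolding bij_betw_def using mem by blast
  moreover have "?\<phi> (bis_mul G U V) = bis_mul H (?\<phi> U) (?\<phi> V)" if UV: "U \<in> Ga G" "V \<in> Ga G" for U V
  proof -
    have "indc (bis_mul G U V) 1 = amul (steinberg G) (indc U 1) (indc V (1::'r))"
      using G.conv_indc[OF UV, of "1::'r" 1] by (simp add: G.stb_simps(2))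
    then have "\<Phi> (indc (bis_mul G U V) 1) = convolution H (\<Phi> (indc U 1)) (\<Phi> (indc V 1))"
      using mul UV by (simp add: G.stb_simps(1) H.stb_simps(2) G.indc_lcc)
    then show ?thesis
      using H.normpair_support_mult[OF R n\<Phi>[OF nG[OF UV(1)]] n\<Phi>[OF nG[OF UV(2)]]]
        by (simp add: supp_def)
  qed
  ultimately show ?thesis unfolding sg_isomorphic_def by blast
qed

section \<open>Groupoid isomorphisms and Steinberg algebras\<close>

lemma lcc_transport:
  assumes hm: "homeomorphic_maps X Y \<phi> \<psi>" and f: "f \<in> lcc X"
  shows "(\<lambda>y. if y \<in> topspace Y then f (\<psi> y) else 0) \<in> lcc Y"
proof (rule lccI)
  have c: "continuous_map X Y \<phi>" "continuous_map Y X \<psi>" and inv: "\<And>y. y \<in> topspace Y \<Longrightarrow> \<phi> (\<psi> y) = y"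
    using hm by (auto simp: homeomorphic_maps_def)
  show "compactin Y (\<phi> ` {x. f x \<noteq> 0})" using image_compactin[OF lccD(3)[OF f] c(1)] .
  fix y
  show "(if y \<in> topspace Y then f (\<psi> y) else 0) \<noteq> 0 \<Longrightarrow> y \<in> \<phi> ` {x. f x \<noteq> 0}"
    using inv[of y] by (metis (mono_tags, lifting) image_eqI mem_Collect_eq)
  assume y: "y \<in> topspace Y"
  then have "\<psi> y \<in> topspace X" using c(2) by (auto simp: continuous_map_def)
  then obtain U where U: "openin X U" "\<psi> y \<in> U" "\<forall>z\<in>U. f z = f (\<psi> y)" using lccD(2)[OF f] by blast
  have "openin Y {z \<in> topspace Y. \<psi> z \<in> U}" using c(2) U(1) by (rule openin_continuous_map_preimage)
  then show "\<exists>V. openin Y V \<and> y \<in> V \<and>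
      (\<forall>z\<in>V. (if z \<in> topspace Y then f (\<psi> z) else 0) = (if y \<in> topspace Y then f (\<psi> y) else 0))"
    using U y by (intro exI[of _ "{z \<in> topspace Y. \<psi> z \<in> U}"]) (metis (mono_tags,
      lifting) mem_Collect_eq)
qed

text \<open>With the inverse and its multiplicativity among the data the situation is symmetric: by
  \<open>sym\<close> every lemma applies to \<open>\<Psi>\<close> too.\<close>

locale gpd_iso = G: hausdorff_ample G + H: hausdorff_ample H
  for G :: "'g tgpd" and H :: "'h tgpd" +
  fixes \<Phi> :: "'g \<Rightarrow> 'h" and \<Psi> :: "'h \<Rightarrow> 'g"
  assumes homeo: "homeomorphic_maps (gtop G) (gtop H) \<Phi> \<Psi>"
    and mult: "composable G g h \<Longrightarrow> composable H (\<Phi> g) (\<Phi> h) \<and> \<Phi> (gmul G g h) = gmul H (\<Phi> g) (\<Phi> h)"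
    and mult': "composable H k l \<Longrightarrow> composable G (\<Psi> k) (\<Psi> l) \<and> \<Psi> (gmul H k l) = gmul G (\<Psi> k) (\<Psi> l)"
begin

lemma sym: "gpd_iso H G \<Psi> \<Phi>"
  using homeo mult mult' homeomorphic_maps_sym by unfold_locales blast+

lemma mem: "g \<in> garr G \<Longrightarrow> \<Phi> g \<in> garr H"
  and left_inv: "g \<in> garr G \<Longrightarrow> \<Psi> (\<Phi> g) = g"
  using homeo by (auto simp: homeomorphic_maps_def G.topspace_garr H.topspace_garr
    continuous_map_def)

lemma unit: assumes "u \<in> gunits G" shows "\<Phi> u \<in> gunits H"
proof -
  have "composable G u u" "gmul G u u = u"
    using G.unitD[OF assms] G.mul_src[of u] by (auto simp: composable_def)
  then show ?thesis using mult H.mul_idem_unit by metis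
qed

lemma src: assumes "g \<in> garr G" shows "gsrc H (\<Phi> g) = \<Phi> (gsrc G g)"
proof -
  have "composable G g (gsrc G g)" using assms by (simp add: composable_def G.src_garr G.rng_src)
  then have "gsrc H (\<Phi> g) = grng H (\<Phi> (gsrc G g))" using mult by (simp add: composable_def)
  then show ?thesis using H.unitD(3)[OF unit[OF G.src_unit[OF assms]]] by simp
qed

lemma rng: assumes "g \<in> garr G" shows "grng H (\<Phi> g) = \<Phi> (grng G g)"
proof -
  have "composable G (grng G g) g" using assms by (simp add: composable_def G.rng_garr G.src_rng)
  then have "grng H (\<Phi> g) = gsrc H (\<Phi> (grng G g))" using mult unfolding composable_def by metis
  then show ?thesis using H.unitD(2)[OF unit[OF G.rng_unit[OF assms]]] by simp
qed

lemma inv: assumes "g \<in> garr G" shows "\<Phi> (ginv G g) = ginv H (\<Phi> g)"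
proof -
  have c: "composable H (\<Phi> g) (\<Phi> (ginv G g))" "gmul H (\<Phi> g) (\<Phi> (ginv G g)) = \<Phi> (grng G g)"
    using mult[OF G.composable_inv(1)[OF assms]] by (auto simp: grng_def)
  have "\<Phi> (ginv G g) = gmul H (ginv H (\<Phi> g)) (grng H (\<Phi> g))"
    using H.inv_mul_cancel[OF c(1)] c(2) rng[OF assms] by simp
  also have "\<dots> = ginv H (\<Phi> g)"
    using H.mul_src[OF H.inv_closed[OF mem[OF assms]]] H.src_inv[OF mem[OF assms]] by simp
  finally show ?thesis .
qed

lemma inv_mul: assumes "g \<in> garr G" "h \<in> garr G" "grng G g = grng G h"
  shows "gmul H (ginv H (\<Phi> g)) (\<Phi> h) = \<Phi> (gmul G (ginv G g) h)"
  using mult[OF G.composable_inv_left[OF assms]] inv[OF assms(1)] by simp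

definition push :: "('g \<Rightarrow> 'r::comm_ring_1) \<Rightarrow> 'h \<Rightarrow> 'r" where
  "push f h = (if h \<in> garr H then f (\<Psi> h) else 0)"

lemma push_lcc: "f \<in> lcc (gtop G) \<Longrightarrow> push f \<in> lcc (gtop H)"
  using lcc_transport[OF homeo] unfolding push_def[abs_def] H.topspace_garr .

lemma push_\<Phi>: "g \<in> garr G \<Longrightarrow> push f (\<Phi> g) = f g"
  by (simp add: push_def mem left_inv)

lemma arr_cases: assumes "h \<in> garr H" obtains g where "g \<in> garr G" "h = \<Phi> g"
  using gpd_iso.mem[OF sym assms] gpd_iso.left_inv[OF sym assms] by metis

lemma push_diag: assumes "f \<in> adiag (steinberg G :: (_, 'r::comm_ring_1) dalg)"
  shows "push f \<in> adiag (steinberg H)"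
proof -
  have "h \<in> gunits H" if "push f h \<noteq> 0" for h
  proof -
    have "h \<in> garr H" using that by (auto simp: push_def split: if_splits)
    then obtain g where "g \<in> garr G" "h = \<Phi> g" using arr_cases by blast
    then show ?thesis using that assms unit by (simp add: G.stb_simps push_\<Phi>)
  qed
  then show ?thesis using assms push_lcc by (auto simp: G.stb_simps H.stb_simps)
qed

text \<open>The isomorphism maps range fibres bijectively onto range fibres, which reindexes the
  sum.\<close>

lemma push_conv: "push (convolution G f k) = convolution H (push f) (push k)"
proof
  fix h
  show "push (convolution G f k) h = convolution H (push f) (push k) h"
  proof (cases "h \<in> garr H")
    case True
    then obtain g where g: "g \<in> garr G" "h = \<Phi> g" by (rule arr_cases)
    let ?A = "{\<alpha> \<in> garr G. grng G \<alpha> = grng G g \<and> f \<alpha> \<noteq> 0}"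
    let ?B = "{\<beta> \<in> garr H. grng H \<beta> = grng H h \<and> push f \<beta> \<noteq> 0}"
    have "inj_on \<Phi> (garr G)" using left_inv by (metis inj_onI)
    moreover have "\<Phi> ` ?A = ?B"
    proof (intro set_eqI iffI)
      fix \<beta> assume "\<beta> \<in> \<Phi> ` ?A"
      then show "\<beta> \<in> ?B" using g mem rng by (auto simp: push_\<Phi>)
    next
      fix \<beta> assume \<beta>: "\<beta> \<in> ?B"
      then obtain \<alpha> where \<alpha>: "\<alpha> \<in> garr G" "\<beta> = \<Phi> \<alpha>" using arr_cases by blast
      have "\<Phi> (grng G \<alpha>) = \<Phi> (grng G g)" using \<beta> \<alpha> g rng by simp
      then have "grng G \<alpha> = grng G g" using left_inv G.rng_garr \<alpha>(1) g(1) by metis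
      then show "\<beta> \<in> \<Phi> ` ?A" using \<beta> \<alpha> by (auto simp: push_\<Phi>)
    qed
    ultimately have bij: "bij_betw \<Phi> ?A ?B"
      by (metis (no_types, lifting) bij_betw_def inj_on_subset mem_Collect_eq subsetI)
    have "convolution H (push f) (push k) h =
        (\<Sum>\<beta>\<in>?B. push f \<beta> * push k (gmul H (ginv H \<beta>) h))"
      using True by (simp add: convolution_def)
    also have "\<dots> = (\<Sum>\<alpha>\<in>?A. push f (\<Phi> \<alpha>) * push k (gmul H (ginv H (\<Phi> \<alpha>)) h))"
      using sum.reindex_bij_betw[OF bij, of "\<lambda>\<beta>. push f \<beta> * push k (gmul H (ginv H \<beta>) h)"] by simp
    also have "\<dots> = (\<Sum>\<alpha>\<in>?A. f \<alpha> * k (gmul G (ginv G \<alpha>) g))"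
      using g by (intro sum.cong) (auto simp: push_\<Phi> inv_mul G.inv_mul_facts)
    also have "\<dots> = push (convolution G f k) h" using g by (simp add: push_\<Phi> convolution_def)
    finally show ?thesis by simp
  qed (simp add: push_def convolution_def)
qed

lemma pull_push: assumes "f \<in> lcc (gtop G)" shows "gpd_iso.push G \<Phi> (push f) = f"
  using G.lcc_garr[OF assms]
  by (auto simp: fun_eq_iff gpd_iso.push_def[OF sym] push_\<Phi>)

end

lemma gpd_isomorphicE:
  fixes G :: "'g tgpd" and H :: "'h tgpd"
  assumes G: "hausdorff_ample G" and H: "hausdorff_ample H" and iso: "gpd_isomorphic G H"
  obtains \<Phi> \<Psi> where "gpd_iso G H \<Phi> \<Psi>"
proof -
  interpret G: hausdorff_ample G by fact
  interpret H: hausdorff_ample H by fact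
  obtain \<Phi> where \<Phi>: "bij_betw \<Phi> (garr G) (garr H)" "homeomorphic_map (gtop G) (gtop H) \<Phi>"
    "\<And>g h. g \<in> garr G \<Longrightarrow> h \<in> garr G \<Longrightarrow> composable G g h \<longleftrightarrow> composable H (\<Phi> g) (\<Phi> h)"
    "\<And>g h. composable G g h \<Longrightarrow> \<Phi> (gmul G g h) = gmul H (\<Phi> g) (\<Phi> h)"
    using iso unfolding gpd_isomorphic_def composable_def by blast
  obtain \<Psi> where \<Psi>: "homeomorphic_maps (gtop G) (gtop H) \<Phi> \<Psi>"
    using \<Phi>(2) by (auto simp: homeomorphic_map_maps)
  have \<Psi>i: "\<Psi> k \<in> garr G" "\<Phi> (\<Psi> k) = k" if "k \<in> garr H" for k
    using \<Psi> that by (auto simp: homeomorphic_maps_def G.topspace_garr H.topspace_garr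
      continuous_map_def)
  have \<Psi>\<Phi>: "\<Psi> (\<Phi> g) = g" if "g \<in> garr G" for g
    using \<Psi> that by (auto simp: homeomorphic_maps_def G.topspace_garr)
  have "gpd_iso G H \<Phi> \<Psi>"
  proof
    show "homeomorphic_maps (gtop G) (gtop H) \<Phi> \<Psi>" by fact
    show "composable H (\<Phi> g) (\<Phi> h) \<and> \<Phi> (gmul G g h) = gmul H (\<Phi> g) (\<Phi> h)" if "composable G g h"
      for g h
      using \<Phi>(3,4) that by (auto simp: composable_def)
    show "composable G (\<Psi> k) (\<Psi> l) \<and> \<Psi> (gmul H k l) = gmul G (\<Psi> k) (\<Psi> l)" if c: "composable H k l"
      for k l
    proof -
      have kl: "k \<in> garr H" "l \<in> garr H" using c by (auto simp: composable_def)
      have c': "composable G (\<Psi> k) (\<Psi> l)" using \<Phi>(3) \<Psi>i kl c by simp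
      then have "\<Psi> (\<Phi> (gmul G (\<Psi> k) (\<Psi> l))) = \<Psi> (gmul H k l)" using \<Phi>(4) \<Psi>i kl by simp
      then show ?thesis using c' \<Psi>\<Phi> G.mul_closed by simp
    qed
  qed
  then show thesis by (rule that)
qed

theorem gpd_iso_imp_alg_iso:
  fixes G :: "'g tgpd" and H :: "'h tgpd"
  assumes G: "hausdorff_ample G" and H: "hausdorff_ample H" and iso: "gpd_isomorphic G H"
  shows "\<exists>\<Phi>. alg_iso (steinberg G :: (_, 'r::comm_ring_1) dalg) (steinberg H) \<Phi> \<and>
    diag_preserving (steinberg G :: (_, 'r) dalg) (steinberg H) \<Phi>"
proof -
  interpret G: hausdorff_ample G by fact
  interpret H: hausdorff_ample H by fact
  obtain \<Phi> \<Psi> where I: "gpd_iso G H \<Phi> \<Psi>" by (rule gpd_isomorphicE[OF G H iso])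
  interpret I: gpd_iso G H \<Phi> \<Psi> by (rule I)
  interpret J: gpd_iso H G \<Psi> \<Phi> by (rule I.sym)
  have "bij_betw I.push (lcc (gtop G) :: ('g \<Rightarrow> 'r) set) (lcc (gtop H))"
    by (rule bij_betw_byWitness[where f' = J.push])
      (auto simp: I.pull_push J.pull_push I.push_lcc J.push_lcc)
  moreover have "I.push ` adiag (steinberg G :: (_, 'r) dalg) = adiag (steinberg H)"
  proof
    show "I.push ` adiag (steinberg G :: (_, 'r) dalg) \<subseteq> adiag (steinberg H)" using I.push_diag
      by blast
    show "adiag (steinberg H) \<subseteq> I.push ` adiag (steinberg G :: (_, 'r) dalg)"
    proof
      fix f :: "'h \<Rightarrow> 'r" assume f: "f \<in> adiag (steinberg H)"
      then have "I.push (J.push f) = f" by (simp add: H.stb_simps J.pull_push)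
      then show "f \<in> I.push ` adiag (steinberg G)" using J.push_diag[OF f] by (metis image_eqI)
    qed
  qed
  ultimately show ?thesis
    by (intro exI[of _ I.push])
      (auto simp: alg_iso_def ring_iso_def diag_preserving_def G.stb_simps(1-4) H.stb_simps(1-4)
        I.push_conv fun_eq_iff I.push_def)
qed

section \<open>The topology on germs\<close>

context paction
begin

lemma openin_gtop_basic: "openin X U \<Longrightarrow> U \<subseteq> dom s \<Longrightarrow> openin (gtop G) (gm s ` U)"
  unfolding germ_gpd_def tgpd.simps by (rule topology_generated_by_Basis) blast

text \<open>Where two generating sets share a germ at \<open>x\<close>, a common lower bound
  \<open>u\<close> of their elements yields a smaller generating set inside both. Hence they form a
  basis and not just a subbasis.\<close>

lemma openin_gtop: "openin (gtop G) W \<longleftrightarrow>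
    (\<forall>g\<in>W. \<exists>s U. openin X U \<and> U \<subseteq> dom s \<and> g \<in> gm s ` U \<and> gm s ` U \<subseteq> W)" (is "_ \<longleftrightarrow> ?base W")
proof
  let ?S = "{{gm s x | x. x \<in> U} | s U. openin X U \<and> U \<subseteq> dom s}"
  assume "openin (gtop G) W"
  then have "generate_topology_on ?S W"
    by (simp add: germ_gpd_def openin_topology_generated_by_iff)
  then show "?base W"
  proof induction
    case (Int A B)
    show ?case
    proof
      fix g assume g: "g \<in> A \<inter> B"
      obtain s U where s: "openin X U" "U \<subseteq> dom s" "g \<in> gm s ` U" "gm s ` U \<subseteq> A"
        using Int.IH(1) g by (meson IntD1)
      obtain t V where t: "openin X V" "V \<subseteq> dom t" "g \<in> gm t ` V" "gm t ` V \<subseteq> B"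
        using Int.IH(2) g by (meson IntD2)
      from s(3) obtain x where x: "x \<in> U" "g = gm s x" by blast
      from t(3) obtain y where y: "y \<in> V" "g = gm t y" by blast
      have dxy: "x \<in> dom s" "y \<in> dom t" using x(1) y(1) s(2) t(2) by blast+
      have "gm s x = gm t y" using x(2) y(2) by simp
      from germ_eq_iff[OF dxy, THEN iffD1, OF this] obtain u
        where u: "le u s" "le u t" "x \<in> dom u" and "x \<in> V" using y(1) by blast
      let ?N = "U \<inter> V \<inter> dom u"
      have "gm u z \<in> A \<inter> B" if z: "z \<in> ?N" for z
      proof -
        have "gm u z = gm s z" "gm u z = gm t z" using z germ_le u by blast+
        moreover have "gm s z \<in> A" "gm t z \<in> B" using z s(4) t(4) by blast+
        ultimately show ?thesis by simp
      qed
      then have "gm u ` ?N \<subseteq> A \<inter> B" by blast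
      moreover have "g \<in> gm u ` ?N" using x u \<open>x \<in> V\<close> germ_le[OF u(1,3)] by auto
      ultimately show "\<exists>s U. openin X U \<and> U \<subseteq> dom s \<and> g \<in> gm s ` U \<and> gm s ` U \<subseteq> A \<inter> B"
        using s t openin_pdom by (intro exI[of _ u] exI[of _ ?N]) auto
    qed
  next
    case (UN K)
    then show ?case by (meson Union_iff Union_upper subset_trans)
  next
    case (Basis A)
    then obtain s U where "A = gm s ` U" "openin X U" "U \<subseteq> dom s" by blast
    then show ?case by blast
  qed simp
next
  assume "?base W"
  then show "openin (gtop G) W" using openin_gtop_basic by (subst openin_subopen) meson
qed

lemma topspace_gtop: "topspace (gtop G) = garr G"
proof
  show "topspace (gtop G) \<subseteq> garr G"
  proof
    fix g assume "g \<in> topspace (gtop G)"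
    then obtain s U where "U \<subseteq> dom s" "g \<in> gm s ` U"
      using openin_gtop[THEN iffD1, OF openin_topspace] by meson
    then show "g \<in> garr G" using germ_garr by blast
  qed
  show "garr G \<subseteq> topspace (gtop G)"
  proof
    fix g assume "g \<in> garr G"
    then obtain s x where "x \<in> dom s" "g = gm s x" by (auto simp: garr_iff)
    then show "g \<in> topspace (gtop G)"
      using openin_subset[OF openin_gtop_basic[OF openin_pdom subset_refl, of s]] by blast
  qed
qed

lemma openin_germ_vimage: assumes W: "openin (gtop G) W" shows "openin X {x \<in> dom s. gm s x \<in> W}"
proof (subst openin_subopen, intro ballI)
  fix x assume x: "x \<in> {x \<in> dom s. gm s x \<in> W}"
  then obtain t V where t: "openin X V" "V \<subseteq> dom t" "gm s x \<in> gm t ` V" "gm t ` V \<subseteq> W"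
    using openin_gtop[THEN iffD1, OF W] by (metis (no_types, lifting) mem_Collect_eq)
  from t(3) obtain y where y: "y \<in> V" "gm s x = gm t y" by blast
  have dxy: "x \<in> dom s" "y \<in> dom t" using x y(1) t(2) by blast+
  from germ_eq_iff[OF dxy, THEN iffD1, OF y(2)] obtain u
    where u: "le u s" "le u t" "x \<in> dom u" and xy: "x = y" by blast
  have "V \<inter> dom u \<subseteq> {x \<in> dom s. gm s x \<in> W}"
  proof
    fix z assume z: "z \<in> V \<inter> dom u"
    then have "gm s z = gm t z" using germ_le[OF u(1)] germ_le[OF u(2)] by auto
    then show "z \<in> {x \<in> dom s. gm s x \<in> W}" using z t le_dom[OF u(1)] by auto
  qed
  then show "\<exists>T. openin X T \<and> x \<in> T \<and> T \<subseteq> {x \<in> dom s. gm s x \<in> W}"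
    using t openin_pdom u y xy by (intro exI[of _ "V \<inter> dom u"]) auto
qed

lemma continuous_germ: "continuous_map (subtopology X (dom s)) (gtop G) (gm s)"
  unfolding continuous_map_def
proof (intro conjI allI impI)
  show "gm s \<in> topspace (subtopology X (dom s)) \<rightarrow> topspace (gtop G)"
    by (auto simp: topspace_gtop germ_garr)
  fix W assume W: "openin (gtop G) W"
  have "{x \<in> topspace (subtopology X (dom s)). gm s x \<in> W} = {x \<in> dom s. gm s x \<in> W}"
    using dom_topspace by auto
  then show "openin (subtopology X (dom s)) {x \<in> topspace (subtopology X (dom s)). gm s x \<in> W}"
    using openin_germ_vimage[OF W, of s] by (auto simp: openin_subtopology)
qed

lemma openin_pt_vimage: assumes V: "openin X V" shows "openin (gtop G) {g \<in> garr G. pt g \<in> V}"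
  unfolding openin_gtop
proof
  fix g assume g: "g \<in> {g \<in> garr G. pt g \<in> V}"
  then obtain s x where "x \<in> dom s" "g = gm s x" by (auto simp: garr_iff)
  then show "\<exists>s U. openin X U \<and> U \<subseteq> dom s \<and> g \<in> gm s ` U \<and> gm s ` U \<subseteq> {g \<in> garr G. pt g \<in> V}"
    using g V openin_pdom by (intro exI[of _ s] exI[of _ "V \<inter> dom s"]) (auto simp: germ_garr)
qed

lemma compactin_germ: assumes "compactin X K" "K \<subseteq> dom s" shows "compactin (gtop G) (gm s ` K)"
  using assms by (intro image_compactin[OF _ continuous_germ]) (simp add: compactin_subtopology)

lemma openin_act_vimage: assumes W: "openin X W" shows "openin X {x \<in> dom s. act s x \<in> W}"
proof -
  have c: "continuous_map (subtopology X (dom s)) (subtopology X (pdom P s)) (act s)"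
    using act_homeo homeomorphic_imp_continuous_map by blast
  have o: "openin (subtopology X (pdom P s)) (W \<inter> pdom P s)" using W
    by (auto simp: openin_subtopology)
  have "{x \<in> topspace (subtopology X (dom s)). act s x \<in> W \<inter> pdom P s} = {x \<in> dom s. act s x \<in> W}"
    using dom_topspace act_dom by auto
  then show ?thesis
    using openin_continuous_map_preimage[OF c o] openin_pdom by (metis openin_open_subtopology)
qed

lemma act_image_vimage: "K \<subseteq> dom s \<Longrightarrow> act s ` K = {y \<in> pdom P s. act (star s) y \<in> K}"
  using act_star act_star' act_dom by (auto simp: image_iff) metis

lemma act_image_openin: "openin X K \<Longrightarrow> K \<subseteq> dom s \<Longrightarrow> openin X (act s ` K)"
  using openin_act_vimage[of K "star s"] by (simp add: act_image_vimage)

lemma act_image_compactin: assumes "compactin X K" "K \<subseteq> dom s" shows "compactin X (act s ` K)"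
proof -
  have "continuous_map (subtopology X (dom s)) (subtopology X (pdom P s)) (act s)"
    using act_homeo homeomorphic_imp_continuous_map by blast
  then have "continuous_map (subtopology X (dom s)) X (act s)"
    by (simp add: continuous_map_in_subtopology)
  then show ?thesis using assms by (intro image_compactin) (auto simp: compactin_subtopology)
qed

lemma bisection_germ: assumes "K \<subseteq> dom s" shows "bisection G (gm s ` K)"
proof -
  have "gsrc G (gm s x) = gsrc G (gm s y) \<longleftrightarrow> x = y" "grng G (gm s x) = grng G (gm s y) \<longleftrightarrow> x = y"
    if "x \<in> dom s" "y \<in> dom s" for x y
  proof -
    have "act s x = act s y \<longleftrightarrow> x = y" using act_star that by metis
    then show "gsrc G (gm s x) = gsrc G (gm s y) \<longleftrightarrow> x = y"
      "grng G (gm s x) = grng G (gm s y) \<longleftrightarrow> x = y"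
      using that by (simp_all add: gsrc_germ grng_germ un_inj dom_topspace)
  qed
  then show ?thesis using assms unfolding bisection_def inj_on_def
    by (auto simp: germ_garr subset_iff)
qed

lemma bis_mul_germ: assumes "K \<subseteq> dom s" "L \<subseteq> dom t"
  shows "bis_mul G (gm s ` K) (gm t ` L) = gm (s \<cdot> t) ` {x \<in> L. act t x \<in> K}"
proof (intro set_eqI iffI)
  fix g assume "g \<in> bis_mul G (gm s ` K) (gm t ` L)"
  then obtain y x where *: "y \<in> K" "x \<in> L" "composable G (gm s y) (gm t x)"
    "g = gmul G (gm s y) (gm t x)"
    unfolding bis_mul_def by blast
  then have "y = act t x" using composable_germ assms by blast
  then show "g \<in> gm (s \<cdot> t) ` {x \<in> L. act t x \<in> K}" proof -
    have x: "x \<in> dom t" "act t x \<in> dom s" using * assms \<open>y = act t x\<close> by auto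
    have "g = gm (s \<cdot> t) x" using gmul_germ[OF x] *(4) \<open>y = act t x\<close> by simp
    then show ?thesis using * \<open>y = act t x\<close> by blast
  qed
next
  fix g assume "g \<in> gm (s \<cdot> t) ` {x \<in> L. act t x \<in> K}"
  then obtain x where x: "x \<in> L" "act t x \<in> K" "g = gm (s \<cdot> t) x" by blast
  have d: "x \<in> dom t" "act t x \<in> dom s" using x assms by auto
  have "g = gmul G (gm s (act t x)) (gm t x)" "composable G (gm s (act t x)) (gm t x)"
    using gmul_germ[OF d] composable_germ[OF d] x(3) by simp_all
  then show "g \<in> bis_mul G (gm s ` K) (gm t ` L)" using x unfolding bis_mul_def by blast
qed

lemma ginv_image_germ: "K \<subseteq> dom s \<Longrightarrow> ginv G ` gm s ` K = gm (star s) ` act s ` K"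
  by (force simp: image_image ginv_germ subset_iff)

end

section \<open>Compact open sets and bisections for almost ample actions\<close>

locale principal_action = paction P for P :: "('s, 'x) pact" +
  assumes almost_ample: "almost_ample P" and top_principal: "top_principal P"
    and Hausdorff_germs: "Hausdorff_space (gtop (germ_gpd P))"
begin

lemma Hausdorff_X: "Hausdorff_space X"
  using almost_ample by (simp add: almost_ample_def)

definition co :: "'x set \<Rightarrow> bool" where "co K \<longleftrightarrow> openin X K \<and> compactin X K"

lemma coD: assumes "co K" shows "openin X K" "compactin X K" "closedin X K"
  using assms compactin_imp_closedin[OF Hausdorff_X] by (auto simp: co_def)

lemma co_Un: "co K \<Longrightarrow> co L \<Longrightarrow> co (K \<union> L)"
  by (auto simp: co_def compactin_Un)

lemma co_Int_clopen: "co K \<Longrightarrow> openin X V \<Longrightarrow> closedin X V \<Longrightarrow> co (K \<inter> V)"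
  unfolding co_def using closed_Int_compactin by (metis Int_commute openin_Int)

lemma co_Int: "co K \<Longrightarrow> co L \<Longrightarrow> co (K \<inter> L)"
  using co_Int_clopen coD by blast

lemma co_subset: "co K \<Longrightarrow> V \<subseteq> K \<Longrightarrow> openin X V \<Longrightarrow> openin X (K - V) \<Longrightarrow> co V"
proof -
  assume a: "co K" "V \<subseteq> K" "openin X V" "openin X (K - V)"
  have K: "K \<subseteq> topspace X" using coD(1)[OF a(1)] openin_subset by blast
  have "topspace X - V = (topspace X - K) \<union> (K - V)" using K a(2) by blast
  moreover have "openin X (topspace X - K)" using coD(3)[OF a(1)] by (simp add: closedin_def)
  ultimately have "closedin X V" using a K by (auto simp: closedin_def)
  then show "co V" using closed_compactin[OF coD(2)[OF a(1)] a(2)] a(3) by (simp add: co_def)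
qed

lemma co_Diff: "co K \<Longrightarrow> co L \<Longrightarrow> co (K - L)"
proof (rule co_subset)
  assume "co K" "co L"
  then show "openin X (K - L)" using coD by blast
  have "K - (K - L) = K \<inter> L" by blast
  then show "openin X (K - (K - L))" using coD \<open>co K\<close> \<open>co L\<close> by auto
qed auto

text \<open>Zero-dimensionality comes from ultraparacompactness: refine the cover of \<open>X\<^sub>e\<close> by a
  relatively compact neighbourhood of \<open>x\<close> and the complement of \<open>x\<close>.\<close>

lemma co_base: assumes U: "openin X U" and x: "x \<in> U" obtains K where "co K" "x \<in> K" "K \<subseteq> U"
proof -
  have xX: "x \<in> topspace X" using U x openin_subset by blast
  then obtain e where e: "e \<in> idm" "x \<in> pdom P e" by (metis topspace_idem)
  have ou: "openin X (U \<inter> pdom P e)" using U openin_pdom by blast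
  have "neighbourhood_base_of (compactin X) X"
    using almost_ample locally_compact_Hausdorff_imp_regular_space[of X]
      locally_compact_space_neighbourhood_base
    by (auto simp: almost_ample_def)
  then obtain V C where VC: "openin X V" "compactin X C" "x \<in> V" "V \<subseteq> C" "C \<subseteq> U \<inter> pdom P e"
    using ou x e unfolding neighbourhood_base_of by (metis IntI)
  let ?T = "subtopology X (pdom P e)"
  have top: "topspace ?T = pdom P e" using pdom_topspace by auto
  have "openin X (pdom P e - {x})"
    using openin_pdom closedin_Hausdorff_singleton[OF Hausdorff_X xX] by (simp add: openin_diff)
  then have op: "\<forall>W\<in>{V, pdom P e - {x}}. openin ?T W"
    using VC openin_pdom by (auto simp: openin_open_subtopology)
  have "ultraparacompact ?T" using almost_ample by (simp add: almost_ample_def)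
  moreover have "topspace ?T \<subseteq> \<Union>{V, pdom P e - {x}}" using top VC by auto
  ultimately obtain \<V> where \<V>: "\<forall>W\<in>\<V>. openin ?T W \<and> closedin ?T W \<and> (\<exists>U\<in>{V, pdom P e - {x}}. W \<subseteq> U)"
     "topspace ?T \<subseteq> \<Union>\<V>" using op unfolding ultraparacompact_def by meson
  then obtain K where K: "K \<in> \<V>" "x \<in> K" using top e by blast
  then have KV: "K \<subseteq> V" using \<V>(1) by blast
  have oK: "openin X K" using \<V>(1) K(1) openin_pdom by (auto simp: openin_open_subtopology)
  \<comment> \<open>The piece \<open>K\<close> is closed only relative to \<open>pdom P e\<close>,
    so compactness is obtained there, inside \<open>C\<close>, and transferred back.\<close>
  have "compactin ?T C" using VC by (simp add: compactin_subtopology)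
  moreover have "K \<subseteq> C" using KV VC(4) by blast
  moreover have "closedin ?T K" using \<V>(1) K(1) by blast
  ultimately have "compactin ?T K" by (rule closed_compactin)
  then have "compactin X K" by (simp add: compactin_subtopology)
  then show thesis using that[of K] oK K KV VC by (auto simp: co_def)
qed

lemma germ_Ga: "co K \<Longrightarrow> K \<subseteq> dom s \<Longrightarrow> gm s ` K \<in> Ga G"
  unfolding Ga_def using bisection_germ openin_gtop_basic compactin_germ co_def by auto

lemma germ_base: assumes W: "openin (gtop G) W" and g: "g \<in> W"
  obtains s K where "co K" "K \<subseteq> dom s" "g \<in> gm s ` K" "gm s ` K \<subseteq> W"
proof -
  have "g \<in> garr G" using assms openin_subset topspace_gtop by blast
  then obtain s x where s: "x \<in> dom s" "g = gm s x" by (auto simp: garr_iff)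
  then obtain K where "co K" "x \<in> K" "K \<subseteq> {x \<in> dom s. gm s x \<in> W}"
    using co_base[OF openin_germ_vimage[OF W, of s]] g by blast
  then show thesis using that[of K s] s by blast
qed

text \<open>Reduces questions about compact open sets of germs to basic sets over a compact open
  \<open>K\<close>, for which products and inverses are explicit.\<close>

lemma compact_open_germs: assumes "openin (gtop G) W" "compactin (gtop G) W"
  obtains F where "finite F" "\<And>s K. (s, K) \<in> F \<Longrightarrow> co K \<and> K \<subseteq> dom s" "W = (\<Union>(s, K)\<in>F. gm s ` K)"
proof -
  let ?B = "{gm s ` K | s K. co K \<and> K \<subseteq> dom s \<and> gm s ` K \<subseteq> W}"
  have "\<forall>B\<in>?B. openin (gtop G) B" using openin_gtop_basic coD by blast
  moreover have "W \<subseteq> \<Union>?B"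
  proof
    fix g assume "g \<in> W"
    then obtain s K where "co K" "K \<subseteq> dom s" "g \<in> gm s ` K" "gm s ` K \<subseteq> W"
      by (rule germ_base[OF assms(1)])
    then show "g \<in> \<Union>?B" by blast
  qed
  ultimately obtain \<F> where F: "finite \<F>" "\<F> \<subseteq> ?B" "W \<subseteq> \<Union>\<F>"
    using assms(2) unfolding compactin_def by meson
  have "\<forall>B\<in>\<F>. \<exists>p. co (snd p) \<and> snd p \<subseteq> dom (fst p) \<and> gm (fst p) ` snd p = B \<and> B \<subseteq> W"
  proof
    fix B assume "B \<in> \<F>"
    then obtain s K where "B = gm s ` K" "co K" "K \<subseteq> dom s" "gm s ` K \<subseteq> W" using F(2) by auto
    then show "\<exists>p. co (snd p) \<and> snd p \<subseteq> dom (fst p) \<and> gm (fst p) ` snd p = B \<and> B \<subseteq> W"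
      by (intro exI[of _ "(s, K)"]) simp
  qed
  then obtain p where p: "\<And>B. B \<in> \<F> \<Longrightarrow> co (snd (p B)) \<and> snd (p B) \<subseteq> dom (fst (p B)) \<and>
      gm (fst (p B)) ` snd (p B) = B \<and> B \<subseteq> W" by metis
  show thesis
  proof (rule that[of "p ` \<F>"])
    show "finite (p ` \<F>)" using F by simp
    show "co K \<and> K \<subseteq> dom s" if sK: "(s, K) \<in> p ` \<F>" for s K
    proof -
      obtain B where B: "B \<in> \<F>" "(s, K) = p B" using sK by blast
      then show ?thesis using p[OF B(1)] by (metis fst_conv snd_conv)
    qed
    have "(\<Union>(s, K)\<in>p ` \<F>. gm s ` K) = (\<Union>B\<in>\<F>. gm (fst (p B)) ` snd (p B))"
      by (simp add: case_prod_beta)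
    also have "\<dots> = (\<Union>B\<in>\<F>. B)" using p by (intro SUP_cong) auto
    also have "\<dots> = \<Union>\<F>" by simp
    also have "\<dots> = W" using F(2,3) by blast
    finally show "W = (\<Union>(s, K)\<in>p ` \<F>. gm s ` K)" by simp
  qed
qed

lemma co_act_vimage: assumes "co K" "co L" "L \<subseteq> dom t" shows "co {x \<in> L. act t x \<in> K}"
proof (rule co_subset[OF assms(2)])
  have "{x \<in> L. act t x \<in> K} = L \<inter> {x \<in> dom t. act t x \<in> K}" using assms(3) by blast
  then show "openin X {x \<in> L. act t x \<in> K}" using openin_act_vimage coD assms by auto
  have "L - {x \<in> L. act t x \<in> K} = L \<inter> {x \<in> dom t. act t x \<in> topspace X - K}"
    using assms(3) dom_topspace by auto
  moreover have "openin X (topspace X - K)" using coD(3)[OF assms(1)] by (simp add: closedin_def)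
  ultimately show "openin X (L - {x \<in> L. act t x \<in> K})"
    using openin_act_vimage[of "topspace X - K" t] coD(1)[OF assms(2)] by (simp add: openin_Int)
qed auto

lemma co_act_image: "co K \<Longrightarrow> K \<subseteq> dom s \<Longrightarrow> co (act s ` K)"
  using act_image_openin act_image_compactin by (simp add: co_def)

lemma finite_UN_compact_open: assumes "finite F" "\<And>i. i \<in> F \<Longrightarrow> A i \<in> Ga G"
  shows "openin (gtop G) (\<Union>i\<in>F. A i)" "compactin (gtop G) (\<Union>i\<in>F. A i)"
  using assms by (auto simp: Ga_def intro!: compactin_Union)

lemma bis_mul_UN: "bis_mul H (\<Union>i\<in>I. A i) (\<Union>j\<in>J. B j) =
  (\<Union>p\<in>I \<times> J. bis_mul H (A (fst p)) (B (snd p)))"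
proof (intro set_eqI iffI)
  fix g assume "g \<in> bis_mul H (\<Union>i\<in>I. A i) (\<Union>j\<in>J. B j)"
  then obtain u v i j where "i \<in> I" "j \<in> J" "u \<in> A i" "v \<in> B j" "composable H u v" "g = gmul H u v"
    unfolding bis_mul_def by blast
  then show "g \<in> (\<Union>p\<in>I \<times> J. bis_mul H (A (fst p)) (B (snd p)))"
    unfolding bis_mul_def by (intro UN_I[of "(i, j)"]) auto
next
  fix g assume "g \<in> (\<Union>p\<in>I \<times> J. bis_mul H (A (fst p)) (B (snd p)))"
  then obtain u v p where "p \<in> I \<times> J" "u \<in> A (fst p)" "v \<in> B (snd p)" "composable H u v"
    "g = gmul H u v"
    unfolding bis_mul_def by blast
  then show "g \<in> bis_mul H (\<Union>i\<in>I. A i) (\<Union>j\<in>J. B j)"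
    unfolding bis_mul_def by (intro CollectI exI[of _ u] exI[of _ v]) auto
qed

text \<open>Products and inverses of compact open bisections are finite unions of basic ones, which
  settles openness and compactness. A union of bisections need not be a bisection, so injectivity of
  source and range is verified on arrows.\<close>

sublocale generic_ample "germ_gpd P"
proof
  show "topspace (gtop G) = garr G" by (rule topspace_gtop)
  show "Hausdorff_space (gtop G)" by (rule Hausdorff_germs)
  show "\<exists>U\<in>Ga G. g \<in> U \<and> U \<subseteq> W" if "openin (gtop G) W" "g \<in> W" for W g
    using germ_base[OF that] germ_Ga by metis
next
  fix U V assume U: "U \<in> Ga G" and V: "V \<in> Ga G"
  obtain F where F: "finite F" "\<And>s K. (s, K) \<in> F \<Longrightarrow> co K \<and> K \<subseteq> dom s" "U = (\<Union>(s, K)\<in>F. gm s ` K)"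
    using U compact_open_germs unfolding Ga_def by blast
  obtain E where E: "finite E" "\<And>t L. (t, L) \<in> E \<Longrightarrow> co L \<and> L \<subseteq> dom t" "V = (\<Union>(t, L)\<in>E. gm t ` L)"
    using V compact_open_germs unfolding Ga_def by blast
  let ?A = "\<lambda>p. bis_mul G (gm (fst (fst p)) ` snd (fst p)) (gm (fst (snd p)) ` snd (snd p))"
  have uv: "bis_mul G U V = (\<Union>p\<in>F \<times> E. ?A p)"
    unfolding F(3) E(3) by (subst bis_mul_UN) (simp add: case_prod_beta)
  have "?A p \<in> Ga G" if p: "p \<in> F \<times> E" for p
  proof -
    obtain s K t L where p': "p = ((s, K), (t, L))" by (metis prod.collapse)
    then have *: "co K" "K \<subseteq> dom s" "co L" "L \<subseteq> dom t" using p F(2) E(2) by auto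
    have "{x \<in> L. act t x \<in> K} \<subseteq> dom (s \<cdot> t)" using *(2,4) by (auto intro!: dom_mult)
    then show ?thesis using p' bis_mul_germ[OF *(2,4)] germ_Ga co_act_vimage[OF *(1,3,4)] by simp
  qed
  then have "openin (gtop G) (bis_mul G U V)" "compactin (gtop G) (bis_mul G U V)"
    unfolding uv using finite_UN_compact_open[of "F \<times> E" ?A] F(1) E(1) by auto
  moreover have "bisection G (bis_mul G U V)"
  proof -
    have b: "U \<subseteq> garr G" "V \<subseteq> garr G" "inj_on (gsrc G) U" "inj_on (grng G) U" "inj_on (gsrc G) V"
      "inj_on (grng G) V"
      using U V by (auto simp: Ga_def bisection_def)
    have "u = u' \<and> v = v'" if *: "u \<in> U" "v \<in> V" "composable G u v" "u' \<in> U" "v' \<in> V"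
      "composable G u' v'"
      "gsrc G v = gsrc G v' \<or> grng G u = grng G u'" for u v u' v'
      using *(7)
    proof
      assume "gsrc G v = gsrc G v'"
      then have "v = v'" using b(5) * by (auto dest: inj_onD)
      moreover have "gsrc G u = gsrc G u'" using *(3,6) calculation by (simp add: composable_def)
      ultimately show ?thesis using b(3) * by (auto dest: inj_onD)
    next
      assume "grng G u = grng G u'"
      then have "u = u'" using b(4) * by (auto dest: inj_onD)
      moreover have "grng G v = grng G v'" using *(3,6) calculation by (simp add: composable_def)
      ultimately show ?thesis using b(6) * by (auto dest: inj_onD)
    qed
    then show ?thesis unfolding bisection_def inj_on_def bis_mul_def
      using mul_closed src_mul rng_mul by (auto, metis+)
  qed
  ultimately show "bis_mul G U V \<in> Ga G" by (simp add: Ga_def)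
next
  fix U assume U: "U \<in> Ga G"
  obtain F where F: "finite F" "\<And>s K. (s, K) \<in> F \<Longrightarrow> co K \<and> K \<subseteq> dom s" "U = (\<Union>(s, K)\<in>F. gm s ` K)"
    using U compact_open_germs unfolding Ga_def by blast
  have u: "ginv G ` U = (\<Union>p\<in>F. ginv G ` gm (fst p) ` snd p)" unfolding F(3) by force
  have "ginv G ` gm (fst p) ` snd p \<in> Ga G" if "p \<in> F" for p
  proof -
    have "co (snd p)" "snd p \<subseteq> dom (fst p)" using F(2)[of "fst p" "snd p"] that by auto
    moreover have "act (fst p) ` snd p \<subseteq> dom (star (fst p))" using calculation act_dom by auto
    ultimately show ?thesis using ginv_image_germ germ_Ga co_act_image by simp
  qed
  then have "openin (gtop G) (ginv G ` U)" "compactin (gtop G) (ginv G ` U)"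
    unfolding u using finite_UN_compact_open[OF F(1)] by auto
  moreover have "bisection G (ginv G ` U)"
  proof -
    have b: "U \<subseteq> garr G" "inj_on (gsrc G) U" "inj_on (grng G) U" using U
      by (auto simp: Ga_def bisection_def)
    have "inj_on (gsrc G \<circ> ginv G) U" "inj_on (grng G \<circ> ginv G) U"
      using b(2,3) inj_on_cong[of U "gsrc G \<circ> ginv G" "grng G"] inj_on_cong[of U "grng G \<circ> ginv G"
        "gsrc G"]
        b(1) src_inv rng_inv by (auto simp: subset_iff)
    then show ?thesis using b(1) inv_closed unfolding bisection_def by (auto intro: inj_on_imageI)
  qed
  ultimately show "ginv G ` U \<in> Ga G" by (simp add: Ga_def)
next
  fix W assume W: "openin (gtop G) W" "W \<noteq> {}"
  then obtain g where g: "g \<in> W" by blast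
  then have "g \<in> garr G" using openin_subset[OF W(1)] topspace_gtop by blast
  then obtain s x where s: "x \<in> dom s" "g = gm s x" by (auto simp: garr_iff)
  let ?U = "{x \<in> dom s. gm s x \<in> W}"
  have "openin X ?U" "x \<in> ?U" using openin_germ_vimage[OF W(1)] s g by auto
  moreover have "x \<in> X closure_of Lambda_set P" using top_principal s dom_topspace
    by (auto simp: top_principal_def)
  ultimately have "\<exists>y. y \<in> Lambda_set P \<and> y \<in> ?U" unfolding in_closure_of by meson
  then obtain y where y: "y \<in> Lambda_set P" "y \<in> ?U" by blast
  \<comment> \<open>At a point of \<open>Lambda_set P\<close>, a germ with source and range there
    has an idempotent below it, hence is the unit.\<close>
  have "h = gsrc G (gm s y)"
    if h: "h \<in> garr G" "gsrc G h = gsrc G (gm s y)" "grng G h = gsrc G (gm s y)" for h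
  proof -
    obtain t z where t: "z \<in> dom t" "h = gm t z" using h by (auto simp: garr_iff)
    have "un z = un y" "un (act t z) = un y" using h t y by (simp_all add: gsrc_germ grng_germ)
    then have z: "z = y" "act t z = y" using un_inj dom_topspace t(1) y(2) by blast+
    then obtain e where e: "e \<in> idm" "y \<in> dom e" "le e t"
      using y(1) t unfolding Lambda_set_def stab_dom_def by blast
    then show ?thesis using germ_le[of e t y] un_eq[of e y] y t z by (simp add: gsrc_germ idem_dom)
  qed
  then show "\<exists>g\<in>W. \<forall>h\<in>garr G. gsrc G h = gsrc G g \<longrightarrow> grng G h = gsrc G g \<longrightarrow> h = gsrc G g"
    using y by blast
qed

end

section \<open>Continuous orbit equivalence\<close>

text \<open>Disjointness of the refinement puts each point in exactly one piece, so one value per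
  piece defines a function, constant on the open pieces.\<close>

lemma ultraparacompact_choice:
  assumes X: "ultraparacompact X"
    and loc: "\<And>x. x \<in> topspace X \<Longrightarrow> \<exists>t U. openin X U \<and> x \<in> U \<and> (\<forall>y\<in>U. R y t)"
  shows "\<exists>f. \<forall>x\<in>topspace X. R x (f x) \<and> (\<exists>U. openin X U \<and> x \<in> U \<and> (\<forall>y\<in>U. f y = f x))"
proof -
  let ?\<U> = "{U. openin X U \<and> (\<exists>t. \<forall>y\<in>U. R y t)}"
  have "(\<forall>U\<in>?\<U>. openin X U) \<and> topspace X \<subseteq> \<Union>?\<U>" using loc by blast
  then obtain \<V> where \<V>: "\<forall>V\<in>\<V>. openin X V \<and> closedin X V \<and> (\<exists>U\<in>?\<U>. V \<subseteq> U)" "pairwise disjnt \<V>"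
    "topspace X \<subseteq> \<Union>\<V>"
    using X unfolding ultraparacompact_def by meson
  have "\<forall>V\<in>\<V>. \<exists>t. \<forall>y\<in>V. R y t" using \<V>(1) by blast
  then obtain \<tau> where \<tau>: "\<And>V y. V \<in> \<V> \<Longrightarrow> y \<in> V \<Longrightarrow> R y (\<tau> V)" by metis
  define f where "f x = \<tau> (SOME V. V \<in> \<V> \<and> x \<in> V)" for x
  have f: "f x = \<tau> V" if "V \<in> \<V>" "x \<in> V" for x V
  proof -
    have "(SOME V. V \<in> \<V> \<and> x \<in> V) = V"
      using that \<V>(2) by (intro some_equality) (auto simp: pairwise_def disjnt_iff)
    then show ?thesis by (simp add: f_def)
  qed
  show ?thesis
  proof (intro exI[of _ f] ballI conjI)
    fix x assume "x \<in> topspace X"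
    then obtain V where V: "V \<in> \<V>" "x \<in> V" using \<V>(3) by blast
    show "R x (f x)" using \<tau> V f by metis
    show "\<exists>U. openin X U \<and> x \<in> U \<and> (\<forall>y\<in>U. f y = f x)"
      using \<V>(1) V f by (intro exI[of _ V]) metis
  qed
qed

context paction
begin

lemma topspace_SX: "topspace (subtopology (prod_topology (discrete_topology UNIV) X) (SX P)) = SX P"
  by (auto simp: SX_def dom_topspace)

text \<open>The semigroup carries the discrete topology, so continuity on \<open>SX P\<close> splits
  into local constancy in \<open>x\<close> for each fixed \<open>s\<close>.\<close>

lemma continuous_SX_iff:
  "continuous_map (subtopology (prod_topology (discrete_topology UNIV) X) (SX P)) (discrete_topology
    UNIV) a
    \<longleftrightarrow> (\<forall>s. \<forall>x\<in>dom s. \<exists>U. openin X U \<and> x \<in> U \<and> U \<subseteq> dom s \<and> (\<forall>y\<in>U. a (s, y) = a (s, x)))"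
    (is "continuous_map ?T _ a \<longleftrightarrow> ?loc")
proof
  assume c: "continuous_map ?T (discrete_topology UNIV) a"
  show ?loc
  proof (intro allI ballI)
    fix s x assume x: "x \<in> dom s"
    have "openin ?T {p \<in> topspace ?T. a p \<in> {a (s, x)}}"
      by (rule openin_continuous_map_preimage[OF c]) simp
    then have "openin ?T {p \<in> SX P. a p = a (s, x)}" unfolding topspace_SX by simp
    then obtain W where W: "openin (prod_topology (discrete_topology UNIV) X) W"
      "{p \<in> SX P. a p = a (s, x)} = W \<inter> SX P" unfolding openin_subtopology by blast
    have "(s, x) \<in> {p \<in> SX P. a p = a (s, x)}" using x by (simp add: SX_def)
    then have "(s, x) \<in> W" using W(2) by blast
    then obtain A U where AU: "s \<in> A" "x \<in> U" "openin X U" "A \<times> U \<subseteq> W"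
      using openin_prod_topology_alt[THEN iffD1, OF W(1)] by meson
    have "a (s, y) = a (s, x)" if "y \<in> U \<inter> dom s" for y
    proof -
      have "(s, y) \<in> W \<inter> SX P" using that AU by (auto simp: SX_def)
      then show ?thesis unfolding W(2)[symmetric] by simp
    qed
    moreover have "openin X (U \<inter> dom s)" using AU(3) openin_pdom by (rule openin_Int)
    ultimately show "\<exists>U. openin X U \<and> x \<in> U \<and> U \<subseteq> dom s \<and> (\<forall>y\<in>U. a (s, y) = a (s, x))"
      using AU(2) x by (intro exI[of _ "U \<inter> dom s"] conjI ballI) blast+
  qed
next
  assume loc: ?loc
  show "continuous_map ?T (discrete_topology UNIV) a"
    unfolding continuous_map_def
  proof (intro conjI allI impI)
    fix W
    show "openin ?T {p \<in> topspace ?T. a p \<in> W}"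
    proof (subst openin_subopen, intro ballI)
      fix p assume p: "p \<in> {p \<in> topspace ?T. a p \<in> W}"
      then obtain s x where sx: "p = (s, x)" "x \<in> dom s" "a (s, x) \<in> W"
        unfolding topspace_SX by (auto simp: SX_def)
      then obtain U where U: "openin X U" "x \<in> U" "U \<subseteq> dom s" "\<forall>y\<in>U. a (s, y) = a (s, x)"
        using loc by blast
      have "{s} \<times> U \<subseteq> SX P" using U by (auto simp: SX_def)
      moreover have "openin (prod_topology (discrete_topology UNIV) X) ({s} \<times> U)"
        using U(1) by (simp add: openin_prod_Times_iff)
      ultimately have "openin ?T ({s} \<times> U)" unfolding openin_subtopology by blast
      moreover have "{s} \<times> U \<subseteq> {p \<in> topspace ?T. a p \<in> W}"
        unfolding topspace_SX using U(3) sx(3) bspec[OF U(4)] by (auto simp: SX_def)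
      ultimately show "\<exists>T. openin ?T T \<and> p \<in> T \<and> T \<subseteq> {p \<in> topspace ?T. a p \<in> W}"
        using sx U by blast
    qed
  qed auto
qed

end

text \<open>The half of an orbit equivalence involving one cocycle; the other half is the same locale
  with the two actions exchanged.\<close>

locale half_coe = P: principal_action P + Q: principal_action Q
  for P :: "('s, 'x) pact" and Q :: "('t, 'y) pact" +
  fixes \<phi> :: "'x \<Rightarrow> 'y" and \<psi> :: "'y \<Rightarrow> 'x" and a :: "'s \<times> 'x \<Rightarrow> 't"
  assumes homeo: "homeomorphic_maps (ptop P) (ptop Q) \<phi> \<psi>"
    and loc: "x \<in> pdom P (pstar P s) \<Longrightarrow>
      \<exists>U. openin (ptop P) U \<and> x \<in> U \<and> U \<subseteq> pdom P (pstar P s) \<and> (\<forall>y\<in>U. a (s, y) = a (s, x))"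
    and a_dom: "x \<in> pdom P (pstar P s) \<Longrightarrow> \<phi> x \<in> pdom Q (pstar Q (a (s, x)))"
    and a_act: "x \<in> pdom P (pstar P s) \<Longrightarrow> pmap Q (a (s, x)) (\<phi> x) = \<phi> (pmap P s x)"
begin

lemma \<phi>_mem: "x \<in> topspace P.X \<Longrightarrow> \<phi> x \<in> topspace Q.X"
  and \<psi>\<phi>: "x \<in> topspace P.X \<Longrightarrow> \<psi> (\<phi> x) = x"
  and \<phi>_cont: "continuous_map P.X Q.X \<phi>"
  using homeo by (auto simp: homeomorphic_maps_def continuous_map_def)

lemma \<phi>_inj: "x \<in> topspace P.X \<Longrightarrow> y \<in> topspace P.X \<Longrightarrow> \<phi> x = \<phi> y \<Longrightarrow> x = y"
  using \<psi>\<phi> by metis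

lemma co_image: assumes "P.co K" shows "Q.co (\<phi> ` K)"
proof -
  have "homeomorphic_map P.X Q.X \<phi>" using homeo homeomorphic_map_maps by blast
  then have "openin Q.X (\<phi> ` K)"
    using P.coD(1)[OF assms] homeomorphic_map_openness openin_subset by metis
  then show ?thesis using image_compactin[OF P.coD(2)[OF assms] \<phi>_cont] by (simp add: Q.co_def)
qed

definition arr :: "'s \<Rightarrow> 'x \<Rightarrow> ('t \<times> 'y) set" where
  "arr s x = Q.gm (a (s, x)) (\<phi> x)"

lemma arr_facts: assumes "x \<in> P.dom s"
  shows "arr s x \<in> garr Q.G" "gsrc Q.G (arr s x) = Q.un (\<phi> x)"
    "grng Q.G (arr s x) = Q.un (\<phi> (P.act s x))"
  using a_dom[OF assms] a_act[OF assms]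
  by (simp_all add: arr_def Q.germ_garr Q.gsrc_germ Q.grng_germ)

lemma const_nbhd: assumes "x \<in> P.dom s" "openin P.X W" "x \<in> W"
  obtains K where "P.co K" "x \<in> K" "K \<subseteq> P.dom s \<inter> W"
    "\<forall>y\<in>K. a (s, y) = a (s, x)" "\<phi> ` K \<subseteq> Q.dom (a (s, x))"
    "arr s ` K = Q.gm (a (s, x)) ` \<phi> ` K"
proof -
  obtain U where U: "openin P.X U" "x \<in> U" "U \<subseteq> P.dom s" "\<forall>y\<in>U. a (s, y) = a (s, x)"
    using loc[OF assms(1)] by blast
  obtain K where K: "P.co K" "x \<in> K" "K \<subseteq> U \<inter> W"
    by (rule P.co_base[of "U \<inter> W" x]) (use U assms in auto)
  have c: "a (s, y) = a (s, x)" if "y \<in> K" for y using that K(3) U(4) by blast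
  have "\<phi> ` K \<subseteq> Q.dom (a (s, x))"
  proof
    fix z assume "z \<in> \<phi> ` K"
    then obtain y where y: "y \<in> K" "z = \<phi> y" by blast
    then have "y \<in> P.dom s" using K U by blast
    from a_dom[OF this] show "z \<in> Q.dom (a (s, x))" using c[OF y(1)] y(2) by simp
  qed
  moreover have "arr s ` K = Q.gm (a (s, x)) ` \<phi> ` K"
    using c by (force simp: arr_def image_image)
  moreover have "K \<subseteq> P.dom s \<inter> W" using K(3) U(3) by blast
  ultimately show thesis using that[of K, OF K(1,2)] c by simp
qed

text \<open>Effectiveness of \<open>T \<ltimes> Y\<close> makes \<open>[a(s,x), \<phi>(x)]\<close> depend only on the germ \<open>[s,x]\<close>.\<close>

lemma arr_cong: assumes x: "x \<in> P.dom s" "x \<in> P.dom t" and eq: "P.gm s x = P.gm t x"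
  shows "arr s x = arr t x"
proof -
  obtain u where u: "ile (smul P) u s" "ile (smul P) u t" "x \<in> P.dom u"
    using P.germ_eq_iff[OF x] eq by blast
  obtain K where K: "P.co K" "x \<in> K" "K \<subseteq> P.dom s \<inter> P.dom u"
    "\<forall>y\<in>K. a (s, y) = a (s, x)" "\<phi> ` K \<subseteq> Q.dom (a (s, x))"
    "arr s ` K = Q.gm (a (s, x)) ` \<phi> ` K"
    by (rule const_nbhd[OF x(1) P.openin_pdom u(3)])
  obtain L where L: "P.co L" "x \<in> L" "L \<subseteq> P.dom t \<inter> K"
    "\<forall>y\<in>L. a (t, y) = a (t, x)" "\<phi> ` L \<subseteq> Q.dom (a (t, x))"
    "arr t ` L = Q.gm (a (t, x)) ` \<phi> ` L"
    by (rule const_nbhd[OF x(2) P.coD(1)[OF K(1)] K(2)])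
  have Ls: "\<phi> ` L \<subseteq> Q.dom (a (s, x))" using L(3) K(5) by blast
  let ?U = "Q.gm (a (s, x)) ` \<phi> ` L" and ?V = "Q.gm (a (t, x)) ` \<phi> ` L"
  have UV: "?U \<in> Ga Q.G" "?V \<in> Ga Q.G"
    using Q.germ_Ga co_image[OF L(1)] Ls L(5) by blast+
  have act: "Q.act (a (s, x)) (\<phi> y) = Q.act (a (t, x)) (\<phi> y)" if y: "y \<in> L" for y
  proof -
    have yd: "y \<in> P.dom s" "y \<in> P.dom t" "y \<in> P.dom u" "y \<in> K"
      using y L(3) K(3) by blast+
    have "Q.act (a (s, x)) (\<phi> y) = \<phi> (P.act s y)" using a_act[OF yd(1)] bspec[OF K(4) yd(4)] by simp
    moreover have "Q.act (a (t, x)) (\<phi> y) = \<phi> (P.act t y)" using a_act[OF yd(2)] bspec[OF L(4) y]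
      by simp
    moreover have "P.act s y = P.act t y" using P.le_act u yd by metis
    ultimately show ?thesis by simp
  qed
  have "tau Q.G (germ Q c ` \<phi> ` L) = {(Q.un (\<phi> y), Q.un (Q.act c (\<phi> y))) | y. y \<in> L}"
    if "\<phi> ` L \<subseteq> Q.dom c" for c
    using that by (force simp: tau_def Q.gsrc_germ Q.grng_germ subset_iff)
  \<comment> \<open>Near \<open>x\<close> the two bisections induce the same partial bijection,
    because \<open>s\<close> and \<open>t\<close> act alike on the domain of
    \<open>u\<close>.\<close>
  then have "tau Q.G ?U = tau Q.G ?V" using Ls L(5) act by fastforce
  then have "?U \<subseteq> ?V" by (rule Q.tau_subset[OF UV])
  then obtain y where y: "y \<in> L" "Q.gm (a (s, x)) (\<phi> x) = Q.gm (a (t, x)) (\<phi> y)" using L(2) by blast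
  have "\<phi> x = \<phi> y" using arg_cong[OF y(2), of Q.pt] Q.pt_germ Ls L(2,5) y(1)
    by (metis image_eqI subsetD)
  then show ?thesis using y(2) by (simp add: arr_def)
qed

text \<open>The map of arrows induced by \<open>a\<close>, evaluated at a chosen representative;
  \<open>arr_cong\<close> makes the choice immaterial.\<close>

definition garrow :: "('s \<times> 'x) set \<Rightarrow> ('t \<times> 'y) set" where
  "garrow g = arr (SOME s. P.pt g \<in> P.dom s \<and> g = P.gm s (P.pt g)) (P.pt g)"

lemma garrow_germ: assumes x: "x \<in> P.dom s" shows "garrow (germ P s x) = arr s x"
proof -
  let ?t = "SOME t. x \<in> P.dom t \<and> P.gm s x = P.gm t x"
  have "x \<in> pdom P (pstar P ?t) \<and> P.gm s x = P.gm ?t x" by (rule someI[of _ s]) (simp add: x)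
  then show ?thesis using arr_cong[of x s ?t] x by (simp add: garrow_def)
qed

lemma garrow_open: assumes "openin (gtop P.G) U" shows "openin (gtop Q.G) (garrow ` U)"
proof (subst openin_subopen, intro ballI)
  fix h assume "h \<in> garrow ` U"
  then obtain g where g: "g \<in> U" "h = garrow g" by blast
  then obtain s x where s: "x \<in> P.dom s" "g = P.gm s x"
    using openin_subset[OF assms] P.topspace_gtop P.garr_iff by blast
  let ?N = "{x \<in> P.dom s. P.gm s x \<in> U}"
  have "x \<in> ?N" using s g by simp
  from P.openin_germ_vimage[OF assms] this obtain K where K: "P.co K" "x \<in> K"
      "K \<subseteq> P.dom s \<inter> ?N" "\<forall>y\<in>K. a (s, y) = a (s, x)"
      "\<phi> ` K \<subseteq> Q.dom (a (s, x))" "arr s ` K = Q.gm (a (s, x)) ` \<phi> ` K"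
    by (rule const_nbhd[OF s(1)])
  have "openin (gtop Q.G) (arr s ` K)"
    unfolding K(6) using Q.coD(1)[OF co_image[OF K(1)]] K(5) by (rule Q.openin_gtop_basic)
  moreover have "h \<in> arr s ` K" using g s garrow_germ K(2) by simp
  moreover have "arr s y \<in> garrow ` U" if "y \<in> K" for y
  proof -
    have y: "y \<in> P.dom s" "P.gm s y \<in> U" using that K(3) by blast+
    show ?thesis using y(2) garrow_germ[OF y(1)] by (metis image_eqI)
  qed
  ultimately show "\<exists>T. openin (gtop Q.G) T \<and> h \<in> T \<and> T \<subseteq> garrow ` U" by blast
qed

lemma garrow_cont: "continuous_map (gtop P.G) (gtop Q.G) garrow"
  unfolding continuous_map_def P.topspace_gtop Q.topspace_gtop
proof (intro conjI allI impI)
  show "garrow \<in> garr P.G \<rightarrow> garr Q.G"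
    using arr_facts(1) by (auto simp: P.garr_iff garrow_germ)
  fix W assume W: "openin (gtop Q.G) W"
  show "openin (gtop P.G) {g \<in> garr P.G. garrow g \<in> W}"
  proof (subst openin_subopen, intro ballI)
    fix g assume g: "g \<in> {g \<in> garr P.G. garrow g \<in> W}"
    then obtain s x where s: "x \<in> P.dom s" "g = P.gm s x" by (auto simp: P.garr_iff)
    let ?V = "{y \<in> topspace P.X. \<phi> y \<in> {y \<in> Q.dom (a (s, x)). Q.gm (a (s, x)) y \<in> W}}"
    have "openin P.X ?V"
      by (rule openin_continuous_map_preimage[OF \<phi>_cont Q.openin_germ_vimage[OF W]])
    moreover have "x \<in> ?V" using g s a_dom[OF s(1)] P.dom_topspace(1)[OF s(1)] garrow_germ[OF s(1)]
      by (simp add: arr_def)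
    ultimately obtain K where K: "P.co K" "x \<in> K" "K \<subseteq> P.dom s \<inter> ?V"
        "\<forall>y\<in>K. a (s, y) = a (s, x)" "\<phi> ` K \<subseteq> Q.dom (a (s, x))"
        "arr s ` K = Q.gm (a (s, x)) ` \<phi> ` K"
      by (rule const_nbhd[OF s(1)])
    have "garrow (germ P s y) \<in> W \<and> P.gm s y \<in> garr P.G" if "y \<in> K" for y
    proof -
      have y: "y \<in> P.dom s" "Q.gm (a (s, x)) (\<phi> y) \<in> W" using that K(3) by blast+
      then show ?thesis using garrow_germ[OF y(1)] bspec[OF K(4) that] P.germ_garr
        by (simp add: arr_def)
    qed
    then have "P.gm s ` K \<subseteq> {g \<in> garr P.G. garrow g \<in> W}" by blast
    moreover have "openin (gtop P.G) (germ P s ` K)"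
      using K(3) by (intro P.openin_gtop_basic[OF P.coD(1)[OF K(1)]]) blast
    ultimately show "\<exists>T. openin (gtop P.G) T \<and> g \<in> T \<and> T \<subseteq> {g \<in> garr P.G. garrow g \<in> W}"
      using K(2) s(2) by blast
  qed
qed

text \<open>The homeomorphism \<open>\<phi>\<close> transported from points to unit germs.\<close>

definition unmap :: "('s \<times> 'x) set \<Rightarrow> ('t \<times> 'y) set" where "unmap u = Q.un (\<phi> (P.pt u))"

lemma garrow_src: "g \<in> garr P.G \<Longrightarrow> gsrc Q.G (garrow g) = unmap (gsrc P.G g)"
  and garrow_rng: "g \<in> garr P.G \<Longrightarrow> grng Q.G (garrow g) = unmap (grng P.G g)"
  using P.dom_topspace
  by (auto simp: P.garr_iff garrow_germ arr_facts P.gsrc_germ P.grng_germ unmap_def)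

lemma unmap_inj: "inj_on unmap (gunits P.G)"
proof (rule inj_onI)
  fix u v assume uv: "u \<in> gunits P.G" "v \<in> gunits P.G" "unmap u = unmap v"
  then obtain x y where "x \<in> topspace P.X" "u = P.un x" "y \<in> topspace P.X" "v = P.un y"
    by (auto simp: P.gunits_eq)
  then show "u = v" using uv(3) \<phi>_inj \<phi>_mem Q.un_inj by (metis P.pt_un unmap_def)
qed

text \<open>Sources of arrows in \<open>U\<close> are distinct and \<open>unmap\<close> is injective
  on units, so the images have distinct sources; ranges behave alike. This makes the image a
  bisection whose partial bijection is the conjugate by \<open>unmap\<close>.\<close>

lemma garrow_Ga: assumes U: "U \<in> Ga P.G"
  shows "garrow ` U \<in> Ga Q.G" "tau Q.G (garrow ` U) = map_prod unmap unmap ` tau P.G U"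
proof -
  have UG: "U \<subseteq> garr P.G" using P.GaD(1)[OF U] .
  have "inj_on (gsrc Q.G) (garrow ` U)"
  proof (rule inj_on_imageI, rule inj_onI)
    fix g h assume gh: "g \<in> U" "h \<in> U" "(gsrc Q.G \<circ> garrow) g = (gsrc Q.G \<circ> garrow) h"
    have G: "g \<in> garr P.G" "h \<in> garr P.G" using gh UG by blast+
    then have "gsrc P.G g = gsrc P.G h"
      using gh(3) garrow_src unmap_inj P.src_unit by (simp add: inj_on_def)
    then show "g = h" using P.Ga_src_eqD[OF U] gh by blast
  qed
  moreover have "inj_on (grng Q.G) (garrow ` U)"
  proof (rule inj_on_imageI, rule inj_onI)
    fix g h assume gh: "g \<in> U" "h \<in> U" "(grng Q.G \<circ> garrow) g = (grng Q.G \<circ> garrow) h"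
    have G: "g \<in> garr P.G" "h \<in> garr P.G" using gh UG by blast+
    then have "grng P.G g = grng P.G h"
      using gh(3) garrow_rng unmap_inj P.rng_unit by (simp add: inj_on_def)
    then show "g = h" using P.Ga_rng_eqD[OF U] gh by blast
  qed
  moreover have "garrow ` U \<subseteq> garr Q.G"
    using openin_subset[OF garrow_open[OF P.GaD(4)[OF U]]] Q.topspace_gtop by simp
  ultimately show "garrow ` U \<in> Ga Q.G"
    using garrow_open[OF P.GaD(4)[OF U]] image_compactin[OF P.GaD(5)[OF U] garrow_cont]
    by (simp add: Ga_def bisection_def)
  show "tau Q.G (garrow ` U) = map_prod unmap unmap ` tau P.G U"
  proof (intro set_eqI iffI)
    fix p assume "p \<in> tau Q.G (garrow ` U)"
    then obtain g where g: "g \<in> U" "p = (gsrc Q.G (garrow g), grng Q.G (garrow g))"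
      unfolding tau_def by blast
    then have "p = map_prod unmap unmap (gsrc P.G g, grng P.G g)"
      using UG garrow_src garrow_rng by auto
    moreover have "(gsrc P.G g, grng P.G g) \<in> tau P.G U"
      using g(1) by (auto simp: tau_def)
    ultimately show "p \<in> map_prod unmap unmap ` tau P.G U" by (rule image_eqI)
  next
    fix p assume "p \<in> map_prod unmap unmap ` tau P.G U"
    then obtain q where q: "q \<in> tau P.G U" "p = map_prod unmap unmap q" by (rule imageE)
    then obtain g where "g \<in> U" "q = (gsrc P.G g, grng P.G g)" by (auto simp: tau_def)
    then have g: "g \<in> U" "p = map_prod unmap unmap (gsrc P.G g, grng P.G g)"
      using q(2) by simp_all
    then have "p = (gsrc Q.G (garrow g), grng Q.G (garrow g))"
      using UG garrow_src garrow_rng by auto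
    then show "p \<in> tau Q.G (garrow ` U)" using g(1) unfolding tau_def by blast
  qed
qed

lemma pseudogroup_units: "f \<in> full_pseudogroup P.G \<Longrightarrow> f \<subseteq> gunits P.G \<times> gunits P.G"
  using P.GaD(1) P.src_unit P.rng_unit unfolding full_pseudogroup_def tau_def by fastforce

lemma conj_mem: assumes "f \<in> full_pseudogroup P.G"
  shows "map_prod unmap unmap ` f \<in> full_pseudogroup Q.G"
proof -
  obtain U where "U \<in> Ga P.G" "f = tau P.G U"
    using assms unfolding full_pseudogroup_def by (rule imageE)
  then show ?thesis using garrow_Ga[of U] unfolding full_pseudogroup_def by (metis image_eqI)
qed

end

text \<open>Each of \<open>a\<close> and \<open>b\<close> shows that conjugation by its unit map
  carries one pseudogroup into the other. The two conjugations are mutually inverse because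
  \<open>\<phi>\<close> and \<open>\<psi>\<close> are, which gives bijectivity without comparing the
  arrow maps.\<close>

theorem coe_imp_full_pseudogroup_iso:
  assumes P: "principal_action P" and Q: "principal_action Q" and coe: "coe P Q"
  shows "sg_isomorphic (full_pseudogroup (germ_gpd P)) pb_mul (full_pseudogroup (germ_gpd Q))
    pb_mul"
proof -
  interpret P: principal_action P by fact
  interpret Q: principal_action Q by fact
  obtain \<phi> \<psi> a b where h: "homeomorphic_maps (ptop P) (ptop Q) \<phi> \<psi>"
    and ca: "continuous_map (subtopology (prod_topology (discrete_topology UNIV) (ptop P)) (SX P))
      (discrete_topology UNIV) a"
    and cb: "continuous_map (subtopology (prod_topology (discrete_topology UNIV) (ptop Q)) (SX Q))
      (discrete_topology UNIV) b"
    and a: "\<forall>(s, x)\<in>SX P. a (s, x) \<in> stab_dom Q (\<phi> x) \<and> \<phi> (pmap P s x) = pmap Q (a (s, x)) (\<phi> x)"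
    and b: "\<forall>(t, y)\<in>SX Q. b (t, y) \<in> stab_dom P (\<psi> y) \<and> \<psi> (pmap Q t y) = pmap P (b (t, y)) (\<psi> y)"
    using coe unfolding coe_def by blast
  interpret A: half_coe P Q \<phi> \<psi> a
  proof
    show "homeomorphic_maps (ptop P) (ptop Q) \<phi> \<psi>" by fact
    fix s x assume x: "x \<in> pdom P (pstar P s)"
    show "\<exists>U. openin (ptop P) U \<and> x \<in> U \<and> U \<subseteq> pdom P (pstar P s) \<and> (\<forall>y\<in>U. a (s, y) = a (s, x))"
      using ca x unfolding P.continuous_SX_iff by blast
    have "(s, x) \<in> SX P" using x by (simp add: SX_def)
    then show "\<phi> x \<in> pdom Q (pstar Q (a (s, x)))" "pmap Q (a (s, x)) (\<phi> x) = \<phi> (pmap P s x)"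
      using a by (auto simp: stab_dom_def)
  qed
  interpret B: half_coe Q P \<psi> \<phi> b
  proof
    show "homeomorphic_maps (ptop Q) (ptop P) \<psi> \<phi>" by (rule homeomorphic_maps_sym[THEN iffD1, OF h])
    fix s x assume x: "x \<in> pdom Q (pstar Q s)"
    show "\<exists>U. openin (ptop Q) U \<and> x \<in> U \<and> U \<subseteq> pdom Q (pstar Q s) \<and> (\<forall>y\<in>U. b (s, y) = b (s, x))"
      using cb x unfolding Q.continuous_SX_iff by blast
    have "(s, x) \<in> SX Q" using x by (simp add: SX_def)
    then show "\<psi> x \<in> pdom P (pstar P (b (s, x)))" "pmap P (b (s, x)) (\<psi> x) = \<psi> (pmap Q s x)"
      using b by (auto simp: stab_dom_def)
  qed
  have BA: "B.unmap (A.unmap u) = u" if "u \<in> gunits (germ_gpd P)" for u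
    using that A.\<phi>_mem A.\<psi>\<phi> by (auto simp: P.gunits_eq A.unmap_def B.unmap_def)
  have AB: "A.unmap (B.unmap u) = u" if "u \<in> gunits (germ_gpd Q)" for u
    using that B.\<phi>_mem B.\<psi>\<phi> by (auto simp: Q.gunits_eq A.unmap_def B.unmap_def)
  let ?A = "\<lambda>f. map_prod A.unmap A.unmap ` f" and ?B = "\<lambda>f. map_prod B.unmap B.unmap ` f"
  have "?B (?A f) = f" if "f \<in> full_pseudogroup (germ_gpd P)" for f
  proof -
    have "(map_prod B.unmap B.unmap \<circ> map_prod A.unmap A.unmap) p = p" if "p \<in> f" for p
      using BA A.pseudogroup_units[OF \<open>f \<in> _\<close>] that by (cases p) auto
    then show ?thesis unfolding image_comp by simp
  qed
  moreover have "?A (?B f) = f" if "f \<in> full_pseudogroup (germ_gpd Q)" for f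
  proof -
    have "(map_prod A.unmap A.unmap \<circ> map_prod B.unmap B.unmap) p = p" if "p \<in> f" for p
      using AB B.pseudogroup_units[OF \<open>f \<in> _\<close>] that by (cases p) auto
    then show ?thesis unfolding image_comp by simp
  qed
  ultimately have "bij_betw ?A (full_pseudogroup (germ_gpd P)) (full_pseudogroup (germ_gpd Q))"
    using A.conj_mem B.conj_mem by (intro bij_betw_byWitness[where f' = ?B]) auto
  moreover have "?A (pb_mul f g) = pb_mul (?A f) (?A g)"
    if fg: "f \<in> full_pseudogroup (germ_gpd P)" "g \<in> full_pseudogroup (germ_gpd P)" for f g
  proof
    show "?A (pb_mul f g) \<subseteq> pb_mul (?A f) (?A g)" unfolding pb_mul_def by fastforce
    show "pb_mul (?A f) (?A g) \<subseteq> ?A (pb_mul f g)"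
    proof
      fix p assume "p \<in> pb_mul (?A f) (?A g)"
      then obtain u v v' w where *: "(u, v) \<in> g" "(v', w) \<in> f" "A.unmap v = A.unmap v'"
        "p = (A.unmap u, A.unmap w)" unfolding pb_mul_def by auto
      \<comment> \<open>The middle points agree after applying \<open>A.unmap\<close>; injectivity
        on units makes them agree before.\<close>
      then have "v = v'" using A.unmap_inj A.pseudogroup_units fg
        by (metis SigmaD1 SigmaD2 inj_onD subsetD)
      then have "(u, w) \<in> pb_mul f g" using * unfolding pb_mul_def by blast
      then show "p \<in> ?A (pb_mul f g)" using *(4) by (metis image_eqI map_prod_simp)
    qed
  qed
  ultimately show ?thesis unfolding sg_isomorphic_def by blast
qed

section \<open>From groupoid isomorphisms to orbit equivalences\<close>

locale germ_iso = P: principal_action P + Q: principal_action Q + gpd_iso "germ_gpd P"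
  "germ_gpd Q" \<Phi> \<Psi>
  for P :: "('s, 'x) pact" and Q :: "('t, 'y) pact" and \<Phi> \<Psi>
begin

definition \<phi> :: "'x \<Rightarrow> 'y" where "\<phi> x = Q.pt (\<Phi> (P.un x))"

lemma \<phi>_un: assumes "x \<in> topspace P.X"
  shows "\<phi> x \<in> topspace Q.X" "\<Phi> (P.un x) = Q.un (\<phi> x)"
proof -
  have "P.un x \<in> gunits P.G" using assms by (simp add: P.gunits_eq)
  then have "\<Phi> (P.un x) \<in> gunits Q.G" by (rule unit)
  then obtain y where y: "\<Phi> (P.un x) = Q.un y" "y \<in> topspace Q.X" unfolding Q.gunits_eq
    by (rule imageE)
  then have "\<phi> x = y" by (simp add: \<phi>_def)
  then show "\<phi> x \<in> topspace Q.X" "\<Phi> (P.un x) = Q.un (\<phi> x)" using y by simp_all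
qed

lemma \<phi>_germ: assumes x: "x \<in> P.dom s" and y: "y \<in> Q.dom t" and eq: "\<Phi> (germ P s x) = Q.gm t y"
  shows "y = \<phi> x" "Q.act t y = \<phi> (P.act s x)"
proof -
  note g = P.germ_garr[OF x]
  have "Q.un y = Q.un (\<phi> x)"
    using src[OF g] P.gsrc_germ[OF x] Q.gsrc_germ[OF y] \<phi>_un(2)[OF P.dom_topspace(1)[OF x]] eq
      by simp
  then show "y = \<phi> x" using Q.un_inj Q.dom_topspace(1)[OF y] \<phi>_un(1)[OF P.dom_topspace(1)[OF x]]
    by blast
  have "Q.un (Q.act t y) = Q.un (\<phi> (P.act s x))"
    using rng[OF g] P.grng_germ[OF x] Q.grng_germ[OF y] \<phi>_un(2)[OF P.dom_topspace(2)[OF x]] eq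
      by simp
  then show "Q.act t y = \<phi> (P.act s x)"
    using Q.un_inj Q.dom_topspace(2)[OF y] \<phi>_un(1)[OF P.dom_topspace(2)[OF x]] by blast
qed

lemma \<Phi>_cont: "continuous_map (gtop P.G) (gtop Q.G) \<Phi>"
  using homeo by (simp add: homeomorphic_maps_def)

lemma \<phi>_cont: "continuous_map P.X Q.X \<phi>"
  unfolding continuous_map_def
proof (intro conjI allI impI)
  show "\<phi> \<in> topspace P.X \<rightarrow> topspace Q.X" using \<phi>_un by blast
  fix V assume V: "openin Q.X V"
  show "openin P.X {x \<in> topspace P.X. \<phi> x \<in> V}"
  proof (subst openin_subopen, intro ballI)
    fix x assume x: "x \<in> {x \<in> topspace P.X. \<phi> x \<in> V}"
    then obtain e where e: "e \<in> idems (smul P)" "x \<in> pdom P e" "x \<in> P.dom e"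
      by (auto elim: P.topspace_idem)
    let ?W = "{g \<in> topspace (gtop P.G). \<Phi> g \<in> {h \<in> garr Q.G. Q.pt h \<in> V}}"
    let ?N = "{y \<in> P.dom e. P.gm e y \<in> ?W}"
    have "openin (gtop P.G) ?W"
      by (rule openin_continuous_map_preimage[OF \<Phi>_cont Q.openin_pt_vimage[OF V]])
    then have "openin P.X ?N" by (rule P.openin_germ_vimage)
    moreover have N: "y \<in> ?N \<longleftrightarrow> y \<in> pdom P e \<and> \<phi> y \<in> V" for y
    proof (cases "y \<in> pdom P e")
      case True
      then have "P.gm e y = P.un y" "P.gm e y \<in> garr P.G"
        using P.un_eq[OF e(1) True] P.germ_garr[of y e] P.idem_dom[OF e(1)] True by simp_all
      then show ?thesis using True e mem by (simp add: P.idem_dom P.topspace_gtop \<phi>_def)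
    qed (simp add: P.idem_dom e)
    moreover have "?N \<subseteq> {x \<in> topspace P.X. \<phi> x \<in> V}"
    proof
      fix y assume "y \<in> ?N"
      then show "y \<in> {x \<in> topspace P.X. \<phi> x \<in> V}" unfolding N using P.pdom_topspace by blast
    qed
    moreover have "x \<in> ?N" unfolding N using x e by blast
    ultimately show "\<exists>T. openin P.X T \<and> x \<in> T \<and> T \<subseteq> {x \<in> topspace P.X. \<phi> x \<in> V}" by blast
  qed
qed

text \<open>For fixed \<open>s\<close>, the germ of \<open>s\<close> at \<open>x\<close> is mapped
  to a germ of some \<open>t\<close>, and by continuity the same \<open>t\<close> works at nearby
  points. \<open>ultraparacompact_choice\<close> on the domain of \<open>s\<close> turns this local
  choice into a locally constant one.\<close>

lemma cocycle: "\<exists>a. continuous_map (subtopology (prod_topology (discrete_topology UNIV) P.X) (SX P))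
  (discrete_topology UNIV) a
    \<and> (\<forall>(s, x)\<in>SX P. a (s, x) \<in> stab_dom Q (\<phi> x) \<and> \<phi> (P.act s x) = Q.act (a (s, x)) (\<phi> x))"
proof -
  let ?R = "\<lambda>s x t. \<phi> x \<in> Q.dom t \<and> \<phi> (P.act s x) = Q.act t (\<phi> x)"
  let ?T = "\<lambda>s. subtopology P.X (P.dom s)"
  have top: "topspace (?T s) = P.dom s" for s using P.dom_topspace by auto
  have "\<exists>f. \<forall>x\<in>topspace (?T s). ?R s x (f x) \<and> (\<exists>U. openin (?T s) U \<and> x \<in> U \<and> (\<forall>y\<in>U. f y = f x))"
    for s
  proof (rule ultraparacompact_choice)
    show "ultraparacompact (?T s)" using P.almost_ample by (simp add: almost_ample_def)
    fix x assume "x \<in> topspace (?T s)"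
    then have x: "x \<in> P.dom s" by (simp add: top)
    then have "\<Phi> (germ P s x) \<in> garr Q.G" using mem P.germ_garr by blast
    then obtain t y where t: "y \<in> Q.dom t" "\<Phi> (germ P s x) = Q.gm t y" by (auto simp: Q.garr_iff)
    let ?W = "{g \<in> topspace (gtop P.G). \<Phi> g \<in> Q.gm t ` Q.dom t}"
    let ?N = "{y \<in> P.dom s. P.gm s y \<in> ?W}"
    have "openin (gtop P.G) ?W"
      by (rule openin_continuous_map_preimage[OF \<Phi>_cont Q.openin_gtop_basic[OF Q.openin_pdom
        subset_refl]])
    then have "openin P.X ?N" by (rule P.openin_germ_vimage)
    then have "openin (?T s) ?N" using P.openin_pdom by (auto simp: openin_open_subtopology)
    moreover have "x \<in> ?N" using x t P.germ_garr P.topspace_gtop by auto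
    moreover have "?R s z t" if z: "z \<in> ?N" for z
    proof -
      have "\<Phi> (germ P s z) \<in> Q.gm t ` Q.dom t" "z \<in> P.dom s" using z by simp_all
      then obtain w where w: "w \<in> Q.dom t" "\<Phi> (germ P s z) = Q.gm t w" "z \<in> P.dom s"
        by blast
      show ?thesis using \<phi>_germ[OF w(3,1,2)] w(1) by simp
    qed
    ultimately show "\<exists>t U. openin (?T s) U \<and> x \<in> U \<and> (\<forall>y\<in>U. ?R s y t)" by blast
  qed
  then obtain f where f: "\<And>s x. x \<in> P.dom s \<Longrightarrow>
      ?R s x (f s x) \<and> (\<exists>U. openin (?T s) U \<and> x \<in> U \<and> (\<forall>y\<in>U. f s y = f s x))"
    unfolding top by metis
  show ?thesis
  proof (intro exI[of _ "\<lambda>(s, x). f s x"] conjI)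
    show "continuous_map (subtopology (prod_topology (discrete_topology UNIV) P.X) (SX P))
      (discrete_topology UNIV) (\<lambda>(s, x). f s x)"
      unfolding P.continuous_SX_iff using f P.openin_pdom
        by (simp add: openin_open_subtopology) meson
    show "\<forall>(s, x)\<in>SX P. (case (s, x) of (s, x) \<Rightarrow> f s x) \<in> stab_dom Q (\<phi> x) \<and>
        \<phi> (P.act s x) = Q.act (case (s, x) of (s, x) \<Rightarrow> f s x) (\<phi> x)"
      using f by (auto simp: SX_def stab_dom_def)
  qed
qed

end

theorem gpd_iso_imp_coe:
  assumes P: "principal_action P" and Q: "principal_action Q"
    and iso: "gpd_isomorphic (germ_gpd P) (germ_gpd Q)"
  shows "coe P Q"
proof -
  interpret P: principal_action P by fact
  interpret Q: principal_action Q by fact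
  obtain \<Phi> \<Psi> where I: "gpd_iso (germ_gpd P) (germ_gpd Q) \<Phi> \<Psi>"
    by (rule gpd_isomorphicE[OF P.hausdorff_ample_axioms Q.hausdorff_ample_axioms iso])
  interpret I: germ_iso P Q \<Phi> \<Psi> using P Q I by (simp add: germ_iso_def)
  interpret J: germ_iso Q P \<Psi> \<Phi> using P Q I.sym by (simp add: germ_iso_def)
  have "J.\<phi> (I.\<phi> x) = x" if "x \<in> topspace (ptop P)" for x
    using I.\<phi>_un[OF that] I.left_inv[OF P.un_garr[OF that]] that by (metis J.\<phi>_def P.pt_un)
  moreover have "I.\<phi> (J.\<phi> x) = x" if "x \<in> topspace (ptop Q)" for x
    using J.\<phi>_un[OF that] J.left_inv[OF Q.un_garr[OF that]] that by (metis I.\<phi>_def Q.pt_un)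
  ultimately have "homeomorphic_maps (ptop P) (ptop Q) I.\<phi> J.\<phi>"
    using I.\<phi>_cont J.\<phi>_cont by (simp add: homeomorphic_maps_def)
  then show ?thesis unfolding coe_def using I.cocycle J.cocycle by meson
qed

section \<open>Crossed products\<close>

text \<open>For a locally constant function the nonzero set is closed, so the closure in
  \<open>AR_space\<close> adds no points.\<close>

lemma AR_space_lcc: "AR_space X = lcc X"
proof (intro set_eqI iffI)
  fix f :: "'a \<Rightarrow> 'b::comm_ring_1" assume f: "f \<in> AR_space X"
  have supp: "{x \<in> topspace X. f x \<noteq> 0} = {x. f x \<noteq> 0}" using f by (auto simp: AR_space_def)
  have c: "continuous_map X (discrete_topology UNIV) f" using f by (simp add: AR_space_def)
  have "compactin X (X closure_of {x. f x \<noteq> 0})" using f supp by (simp add: AR_space_def)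
  moreover have "{x. f x \<noteq> 0} \<subseteq> X closure_of {x. f x \<noteq> 0}"
    by (rule closure_of_subset) (use supp in blast)
  moreover have "\<exists>U. openin X U \<and> x \<in> U \<and> (\<forall>y\<in>U. f y = f x)" if "x \<in> topspace X" for x
    using openin_continuous_map_preimage[OF c, of "{f x}"] that
    by (intro exI[of _ "{y \<in> topspace X. f y \<in> {f x}}"]) simp
  ultimately show "f \<in> lcc X" by (intro lccI[where K = "X closure_of {x. f x \<noteq> 0}"]) blast+
next
  fix f :: "'a \<Rightarrow> 'b::comm_ring_1" assume f: "f \<in> lcc X"
  have supp: "{x \<in> topspace X. f x \<noteq> 0} = {x. f x \<noteq> 0}" using lccD(1)[OF f] by auto
  have "continuous_map X (discrete_topology UNIV) f"
    by (auto simp: continuous_map_def intro: lcc_openin[OF f])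
  moreover have "X closure_of {x \<in> topspace X. f x \<noteq> 0} = {x. f x \<noteq> 0}"
    using closure_of_closedin[OF lcc_support(2)[OF f]] supp by simp
  ultimately show "f \<in> AR_space X" using lccD(1,3)[OF f] by (simp add: AR_space_def)
qed

lemma Dsp_iff: "f \<in> Dsp P s \<longleftrightarrow> f \<in> lcc (ptop P) \<and> (\<forall>x. f x \<noteq> 0 \<longrightarrow> x \<in> pdom P s)"
  by (simp add: Dsp_def AR_space_lcc)

lemma Dsp_add: "a \<in> Dsp P s \<Longrightarrow> b \<in> Dsp P s \<Longrightarrow> (\<lambda>x. a x + b x) \<in> Dsp P s"
  unfolding Dsp_iff by (auto simp: lcc_add) (metis add.right_neutral add_0_left)

lemma Dsp_zero: "(\<lambda>_. 0) \<in> Dsp P s"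
  by (simp add: Dsp_iff lcc_zero)

lemma Dsp_smul: "a \<in> Dsp P s \<Longrightarrow> (\<lambda>x. r * a x) \<in> Dsp P s"
  unfolding Dsp_iff by (auto simp: lcc_smul) (metis mult_zero_right)

lemma Dsp_uminus: "a \<in> Dsp P s \<Longrightarrow> (\<lambda>x. - a x) \<in> Dsp P s"
  unfolding Dsp_iff by (auto simp: lcc_uminus)

lemma LsetI: assumes "finite A" "\<And>s. s \<notin> A \<Longrightarrow> F s = (\<lambda>_. 0)" "\<And>s. F s \<in> Dsp P s" shows "F \<in> Lset P"
proof -
  have "{s. F s \<noteq> (\<lambda>_. 0)} \<subseteq> A" using assms(2) by blast
  then show ?thesis using assms finite_subset unfolding Lset_def by blast
qed

lemma LsetD: "F \<in> Lset P \<Longrightarrow> finite {s. F s \<noteq> (\<lambda>_. 0)}" "F \<in> Lset P \<Longrightarrow> F s \<in> Dsp P s"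
  by (simp_all add: Lset_def)

lemma Ladd_Lset: assumes "F \<in> Lset P" "G \<in> Lset P" shows "Ladd F G \<in> Lset P"
proof (rule LsetI)
  show "finite ({s. F s \<noteq> (\<lambda>_. 0)} \<union> {s. G s \<noteq> (\<lambda>_. 0)})" using assms LsetD(1) by blast
qed (use assms in \<open>auto simp: Ladd_def intro: Dsp_add LsetD(2)\<close>)

lemma Lneg_Lset: assumes "F \<in> Lset P" shows "Lneg F \<in> Lset P"
  by (rule LsetI[OF LsetD(1)[OF assms]]) (use assms in \<open>auto simp: Lneg_def intro: Dsp_uminus
    LsetD(2)\<close>)

lemma Lsmul_Lset: assumes "F \<in> Lset P" shows "Lsmul r F \<in> Lset P"
  by (rule LsetI[OF LsetD(1)[OF assms]]) (use assms in \<open>auto simp: Lsmul_def intro: Dsp_smul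
    LsetD(2)\<close>)

lemma Ldelta_Lset: "a \<in> Dsp P s \<Longrightarrow> Ldelta a s \<in> Lset P"
  by (rule LsetI[of "{s}"]) (auto simp: Ldelta_def Dsp_zero)

lemma zero_Lset: "(\<lambda>_ _. 0) \<in> Lset P"
  by (rule LsetI[of "{}"]) (auto simp: Dsp_zero)

lemma Lset_induct [consumes 1, case_names zero delta add]:
  assumes F: "F \<in> Lset P" and zero: "Pr (\<lambda>_ _. 0)"
    and delta: "\<And>a s. a \<in> Dsp P s \<Longrightarrow> Pr (Ldelta a s)"
    and add: "\<And>F G. F \<in> Lset P \<Longrightarrow> G \<in> Lset P \<Longrightarrow> Pr F \<Longrightarrow> Pr G \<Longrightarrow> Pr (Ladd F G)"
  shows "Pr F"
proof -
  have "Pr F" if "finite A" "{s. F s \<noteq> (\<lambda>_. 0)} \<subseteq> A" "F \<in> Lset P" for A F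
    using that
  proof (induction A arbitrary: F)
    case empty
    then have "F = (\<lambda>_ _. 0)" by auto
    then show ?case using zero by simp
  next
    case (insert s A)
    let ?F = "F(s := \<lambda>_. 0)"
    have F': "?F \<in> Lset P"
      by (rule LsetI[OF LsetD(1)[OF insert.prems(2)]]) (use insert.prems LsetD(2) Dsp_zero in auto)
    have "{t. ?F t \<noteq> (\<lambda>_. 0)} \<subseteq> A" using insert.prems(1) by auto
    then have "Pr ?F" using insert.IH F' by blast
    moreover have "F s \<in> Dsp P s" by (rule LsetD(2)[OF insert.prems(2)])
    moreover have "Ladd ?F (Ldelta (F s) s) = F" by (auto simp: Ladd_def Ldelta_def fun_eq_iff)
    ultimately show ?case using add[OF F' Ldelta_Lset] delta by metis
  qed
  then show ?thesis using F LsetD(1) by blast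
qed

context paction
begin

text \<open>The coefficient in the product of \<open>a\<close> at \<open>s\<close> with some
  \<open>b\<close>: the defining formula of the crossed product after the two maps applied to
  \<open>a\<close> cancel, see \<open>dual_alpha_dprod\<close>.\<close>

definition dprod :: "'s \<Rightarrow> ('x \<Rightarrow> 'r::comm_ring_1) \<Rightarrow> ('x \<Rightarrow> 'r) \<Rightarrow> 'x \<Rightarrow> 'r" where
  "dprod s a b x = (if x \<in> pdom P s then a x * b (act (star s) x) else 0)"

lemma dual_alpha_dprod: "dual_alpha P s (\<lambda>y. dual_alpha P (star s) a y * b y) = dprod s a b"
  by (auto simp: fun_eq_iff dual_alpha_def dprod_def act_dom' act_star')

lemma dprod_Dsp: assumes a: "a \<in> Dsp P s" and b: "b \<in> Dsp P t"
  shows "dprod s a b \<in> Dsp P (s \<cdot> t)"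
proof -
  have al: "a \<in> lcc X" and bl: "b \<in> lcc X" using a b by (simp_all add: Dsp_iff)
  have "dprod s a b \<in> lcc X"
  proof (rule lccI)
    show "compactin X {x. a x \<noteq> 0}" by (rule lccD(3)[OF al])
    fix x
    show "dprod s a b x \<noteq> 0 \<Longrightarrow> x \<in> {x. a x \<noteq> 0}" by (auto simp: dprod_def split: if_splits)
    assume x: "x \<in> topspace X"
    obtain U where U: "openin X U" "x \<in> U" "\<forall>y\<in>U. a y = a x" using lccD(2)[OF al x] by blast
    show "\<exists>U. openin X U \<and> x \<in> U \<and> (\<forall>y\<in>U. dprod s a b y = dprod s a b x)"
    proof (cases "a x = 0")
      case True
      have "dprod s a b y = 0" if "y \<in> U" for y using bspec[OF U(3) that] True
        by (simp add: dprod_def)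
      then show ?thesis using U(1,2) by auto
    next
      case False
      then have xs: "x \<in> pdom P s" using a by (simp add: Dsp_iff)
      obtain V where V: "openin X V" "act (star s) x \<in> V" "\<forall>y\<in>V. b y = b (act (star s) x)"
        using lccD(2)[OF bl dom_topspace(1)[OF act_dom'[OF xs]]] by blast
      let ?N = "U \<inter> {y \<in> dom (star s). act (star s) y \<in> V}"
      have "openin X ?N" using openin_act_vimage[OF V(1)] U(1) by blast
      moreover have "dprod s a b y = dprod s a b x" if y: "y \<in> ?N" for y
      proof -
        have "a y = a x" using U(3) y by blast
        moreover have "b (act (star s) y) = b (act (star s) x)" using V(3) y by blast
        ultimately show ?thesis using y xs by (simp add: dprod_def)
      qed
      moreover have "x \<in> ?N" using U V xs by simp
      ultimately show ?thesis by blast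
    qed
  qed
  moreover have "x \<in> pdom P (s \<cdot> t)" if "dprod s a b x \<noteq> 0" for x
  proof -
    have x: "x \<in> dom (star s)" "b (act (star s) x) \<noteq> 0" using that
      by (auto simp: dprod_def split: if_splits)
    then have "act (star s) x \<in> dom (star t)" using b by (simp add: Dsp_iff)
    then show ?thesis using dom_mult[OF x(1), of "star t"] by (simp add: star_mult)
  qed
  ultimately show ?thesis by (simp add: Dsp_iff)
qed

text \<open>Supports can shrink under addition, so sums over a fixed rectangle are used to compare
  products term by term.\<close>

lemma Lmul_eq:
  assumes "finite A" "finite B" "{s. F s \<noteq> (\<lambda>_. 0)} \<subseteq> A" "{s. H s \<noteq> (\<lambda>_. 0)} \<subseteq> B"
  shows "Lmul P F H u x = (\<Sum>(s, t)\<in>A \<times> B. if s \<cdot> t = u then dprod s (F s) (H t) x else 0)"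
proof -
  have z: "dprod s (F s) (H t) x = 0" if "F s = (\<lambda>_. 0) \<or> H t = (\<lambda>_. 0)" for s t
    using that by (auto simp: dprod_def)
  have "Lmul P F H u x = (\<Sum>(s, t)\<in>{(s, t). s \<cdot> t = u \<and> F s \<noteq> (\<lambda>_. 0) \<and> H t \<noteq> (\<lambda>_. 0)}.
      if s \<cdot> t = u then dprod s (F s) (H t) x else 0)"
    unfolding Lmul_def dual_alpha_dprod by (rule sum.cong) auto
  also have "\<dots> = (\<Sum>(s, t)\<in>A \<times> B. if s \<cdot> t = u then dprod s (F s) (H t) x else 0)"
  proof (rule sum.mono_neutral_left)
    show "finite (A \<times> B)" using assms by simp
    show "{(s, t). s \<cdot> t = u \<and> F s \<noteq> (\<lambda>_. 0) \<and> H t \<noteq> (\<lambda>_. 0)} \<subseteq> A \<times> B" using assms by blast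
    show "\<forall>p\<in>A \<times> B - {(s, t). s \<cdot> t = u \<and> F s \<noteq> (\<lambda>_. 0) \<and> H t \<noteq> (\<lambda>_. 0)}.
        (case p of (s, t) \<Rightarrow> if s \<cdot> t = u then dprod s (F s) (H t) x else 0) = 0"
      using z by (simp split: prod.split) blast
  qed
  finally show ?thesis .
qed

lemma Lmul_add_left: assumes "F \<in> Lset P" "F' \<in> Lset P" "H \<in> Lset P"
  shows "Lmul P (Ladd F F') H = Ladd (Lmul P F H) (Lmul P F' H)"
proof (intro ext)
  fix u x
  let ?A = "{s. F s \<noteq> (\<lambda>_. 0)} \<union> {s. F' s \<noteq> (\<lambda>_. 0)}" and ?B = "{s. H s \<noteq> (\<lambda>_. 0)}"
  have fin: "finite ?A" "finite ?B" using assms LsetD(1) by blast+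
  have *: "Lmul P K H u x = (\<Sum>(s, t)\<in>?A \<times> ?B. if s \<cdot> t = u then dprod s (K s) (H t) x else 0)"
    if "{s. K s \<noteq> (\<lambda>_. 0)} \<subseteq> ?A" for K using Lmul_eq[OF fin that] by simp
  have "{s. Ladd F F' s \<noteq> (\<lambda>_. 0)} \<subseteq> ?A" by (auto simp: Ladd_def)
  from *[OF this] show "Lmul P (Ladd F F') H u x = Ladd (Lmul P F H) (Lmul P F' H) u x"
    using *[of F] *[of F']
    by (auto simp: Ladd_def sum.distrib[symmetric] dprod_def distrib_right intro!: sum.cong)
qed

lemma Lmul_add_right: assumes "F \<in> Lset P" "H \<in> Lset P" "H' \<in> Lset P"
  shows "Lmul P F (Ladd H H') = Ladd (Lmul P F H) (Lmul P F H')"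
proof (intro ext)
  fix u x
  let ?A = "{s. F s \<noteq> (\<lambda>_. 0)}" and ?B = "{s. H s \<noteq> (\<lambda>_. 0)} \<union> {s. H' s \<noteq> (\<lambda>_. 0)}"
  have fin: "finite ?A" "finite ?B" using assms LsetD(1) by blast+
  have *: "Lmul P F K u x = (\<Sum>(s, t)\<in>?A \<times> ?B. if s \<cdot> t = u then dprod s (F s) (K t) x else 0)"
    if "{s. K s \<noteq> (\<lambda>_. 0)} \<subseteq> ?B" for K using Lmul_eq[OF fin _ that] by simp
  have "{s. Ladd H H' s \<noteq> (\<lambda>_. 0)} \<subseteq> ?B" by (auto simp: Ladd_def)
  from *[OF this] show "Lmul P F (Ladd H H') u x = Ladd (Lmul P F H) (Lmul P F H') u x"
    using *[of H] *[of H']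
    by (auto simp: Ladd_def sum.distrib[symmetric] dprod_def distrib_left intro!: sum.cong)
qed

lemma Lmul_zero: "Lmul P (\<lambda>_ _. 0) H = (\<lambda>_ _. 0)" "Lmul P F (\<lambda>_ _. 0) = (\<lambda>_ _. 0)"
  by (simp_all add: Lmul_def fun_eq_iff)

lemma Lmul_delta: "Lmul P (Ldelta a s) (Ldelta b t) = Ldelta (dprod s a b) (s \<cdot> t)"
proof (intro ext)
  fix u x
  have "Lmul P (Ldelta a s) (Ldelta b t) u x =
    (\<Sum>(s', t')\<in>{s} \<times> {t}. if s' \<cdot> t' = u then dprod s' (Ldelta a s s') (Ldelta b t t') x else 0)"
    by (rule Lmul_eq) (auto simp: Ldelta_def)
  then show "Lmul P (Ldelta a s) (Ldelta b t) u x = Ldelta (dprod s a b) (s \<cdot> t) u x"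
    by (simp add: Ldelta_def)
qed

lemma Lmul_Lset: assumes F: "F \<in> Lset P" and H: "H \<in> Lset P" shows "Lmul P F H \<in> Lset P"
  using F
proof (induction rule: Lset_induct)
  case zero then show ?case by (simp add: Lmul_zero zero_Lset)
next
  case (delta a s)
  show ?case using H
  proof (induction rule: Lset_induct)
    case zero then show ?case by (simp add: Lmul_zero zero_Lset)
  next
    case (delta b t)
    then show ?case using dprod_Dsp[OF \<open>a \<in> Dsp P s\<close>] by (simp add: Lmul_delta Ldelta_Lset)
  next
    case (add F H)
    then show ?case using Lmul_add_right[OF Ldelta_Lset[OF delta]] Ladd_Lset by simp
  qed
next
  case (add F F')
  then show ?case using Lmul_add_left[OF add(1,2) H] Ladd_Lset by simp
qed

text \<open>\<open>a \<delta>\<^sub>s\<close> is sent to the function \<open>a \<circ> r\<close> on the bisection of all germs \<open>[s,x]\<close>.\<close>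

definition dgerm :: "'s \<Rightarrow> ('x \<Rightarrow> 'r::comm_ring_1) \<Rightarrow> ('s \<times> 'x) set \<Rightarrow> 'r" where
  "dgerm s a g = (if g \<in> gm s ` dom s then a (act s (pt g)) else 0)"

definition Lpi :: "('s \<Rightarrow> 'x \<Rightarrow> 'r::comm_ring_1) \<Rightarrow> ('s \<times> 'x) set \<Rightarrow> 'r" where
  "Lpi F g = (\<Sum>s | F s \<noteq> (\<lambda>_. 0). dgerm s (F s) g)"

lemma Lpi_eq: "finite A \<Longrightarrow> {s. F s \<noteq> (\<lambda>_. 0)} \<subseteq> A \<Longrightarrow> Lpi F g = (\<Sum>s\<in>A. dgerm s (F s) g)"
  unfolding Lpi_def by (rule sum.mono_neutral_left) (auto simp: dgerm_def)

lemma Lpi_zero: "Lpi (\<lambda>_ _. 0) = (\<lambda>_. 0)"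
  by (simp add: Lpi_def fun_eq_iff)

lemma Lpi_delta: "Lpi (Ldelta a s) = dgerm s a"
proof
  fix g
  have "Lpi (Ldelta a s) g = (\<Sum>t\<in>{s}. dgerm t (Ldelta a s t) g)"
    by (rule Lpi_eq) (auto simp: Ldelta_def)
  then show "Lpi (Ldelta a s) g = dgerm s a g" by (simp add: Ldelta_def)
qed

lemma Lpi_add: assumes "F \<in> Lset P" "H \<in> Lset P"
  shows "Lpi (Ladd F H) = (\<lambda>g. Lpi F g + Lpi H g)"
proof
  fix g
  let ?A = "{s. F s \<noteq> (\<lambda>_. 0)} \<union> {s. H s \<noteq> (\<lambda>_. 0)}"
  have fin: "finite ?A" using assms LsetD(1) by blast
  have "Lpi (Ladd F H) g = (\<Sum>s\<in>?A. dgerm s (Ladd F H s) g)"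
    by (rule Lpi_eq[OF fin]) (auto simp: Ladd_def)
  moreover have "Lpi F g = (\<Sum>s\<in>?A. dgerm s (F s) g)" "Lpi H g = (\<Sum>s\<in>?A. dgerm s (H s) g)"
    by (rule Lpi_eq[OF fin], blast)+
  ultimately show "Lpi (Ladd F H) g = Lpi F g + Lpi H g"
    by (auto simp: sum.distrib[symmetric] dgerm_def Ladd_def intro!: sum.cong)
qed

lemma Lpi_smul: "F \<in> Lset P \<Longrightarrow> Lpi (Lsmul r F) = (\<lambda>g. r * Lpi F g)"
proof
  fix g assume F: "F \<in> Lset P"
  have "Lpi (Lsmul r F) g = (\<Sum>s | F s \<noteq> (\<lambda>_. 0). dgerm s (Lsmul r F s) g)"
    by (rule Lpi_eq[OF LsetD(1)[OF F]]) (auto simp: Lsmul_def)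
  then show "Lpi (Lsmul r F) g = r * Lpi F g"
    by (auto simp: Lpi_def sum_distrib_left dgerm_def Lsmul_def intro!: sum.cong)
qed

lemma Lpi_neg: "F \<in> Lset P \<Longrightarrow> Lpi (Lneg F) = (\<lambda>g. - Lpi F g)"
  using Lpi_smul[of F "-1"] by (simp add: Lneg_def Lsmul_def)

lemma act_inj: "x \<in> dom s \<Longrightarrow> y \<in> dom s \<Longrightarrow> act s x = act s y \<Longrightarrow> x = y"
  using act_star by metis

lemma dgerm_germ: "x \<in> dom s \<Longrightarrow> dgerm s a (gm s x) = a (act s x)"
  by (simp add: dgerm_def)

lemma dgerm_cases: assumes "dgerm s a g \<noteq> 0"
  obtains x where "x \<in> dom s" "g = gm s x" "a (act s x) \<noteq> 0"
  using assms by (auto simp: dgerm_def split: if_splits)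

text \<open>If \<open>dgerm s a\<close> is nonzero at the germ of \<open>s\<close> at
  \<open>x\<close>, then \<open>act s x\<close> lies in \<open>pdom P r\<close>. Pulling it back
  along \<open>r\<close> gives a point of \<open>dom r\<close> with the same image under
  \<open>s\<close>, which is \<open>x\<close> by injectivity, so the germ belongs to
  \<open>r\<close>. This kills the generators of \<open>Nset P\<close>.\<close>

lemma dgerm_le: assumes rs: "le r s" and a: "a \<in> Dsp P r" shows "dgerm r a = dgerm s a"
proof
  fix g
  show "dgerm r a g = dgerm s a g"
  proof (cases "g \<in> gm r ` dom r")
    case True
    then obtain x where x: "x \<in> dom r" "g = gm r x" by blast
    have "g = gm s x" "x \<in> dom s" "act r x = act s x"
      using x germ_le[OF rs] le_dom[OF rs] le_act[OF rs] by auto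
    then show ?thesis using dgerm_germ[OF x(1)] dgerm_germ[of x s a] x(2) by metis
  next
    case False
    have "dgerm s a g = 0"
    proof (rule ccontr)
      assume "dgerm s a g \<noteq> 0"
      then obtain x where x: "x \<in> dom s" "g = gm s x" "a (act s x) \<noteq> 0"
        by (rule dgerm_cases)
      then have y: "act s x \<in> pdom P r" using a by (simp add: Dsp_iff)
      let ?x = "act (star r) (act s x)"
      have x': "?x \<in> dom r" "act r ?x = act s x" using y act_dom' act_star' by blast+
      have "act s ?x = act s x" by (rule trans[OF le_act[OF rs x'(1), symmetric] x'(2)])
      then have eq: "?x = x" by (rule act_inj[OF le_dom[OF rs x'(1)] x(1)])
      have "x \<in> dom r" using x'(1) unfolding eq .
      moreover from germ_le[OF rs this] have "g = gm r x" using x(2) by simp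
      ultimately show False using False by blast
    qed
    then show ?thesis using False by (simp add: dgerm_def)
  qed
qed

end

context principal_action
begin

lemma dgerm_lcc: assumes a: "a \<in> Dsp P s" shows "dgerm s a \<in> lcc (gtop G)"
proof (rule lccI)
  have al: "a \<in> lcc X" and ad: "\<And>x. a x \<noteq> 0 \<Longrightarrow> x \<in> pdom P s" using a by (auto simp: Dsp_iff)
  let ?K = "gm s ` act (star s) ` {x. a x \<noteq> 0}"
  have "compactin X (act (star s) ` {x. a x \<noteq> 0})"
    using ad by (intro act_image_compactin lccD(3)[OF al]) auto
  then show K: "compactin (gtop G) ?K" using ad act_dom' by (intro compactin_germ) auto
  show nz: "g \<in> ?K" if "dgerm s a g \<noteq> 0" for g
  proof -
    obtain x where x: "x \<in> dom s" "g = gm s x" "a (act s x) \<noteq> 0"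
      by (rule dgerm_cases[OF \<open>dgerm s a g \<noteq> 0\<close>])
    have "x \<in> act (star s) ` {x. a x \<noteq> 0}" using act_star[OF x(1)] x(3)
      by (metis (mono_tags) image_eqI mem_Collect_eq)
    then show ?thesis using x(2) by blast
  qed
  fix g assume g: "g \<in> topspace (gtop G)"
  show "\<exists>U. openin (gtop G) U \<and> g \<in> U \<and> (\<forall>h\<in>U. dgerm s a h = dgerm s a g)"
  proof (cases "g \<in> ?K")
    case True
    then obtain y where y: "a y \<noteq> 0" "g = gm s (act (star s) y)" by blast
    let ?x = "act (star s) y"
    have x: "?x \<in> dom s" "act s ?x = y" using ad[OF y(1)] act_dom' act_star' by blast+
    obtain U where U: "openin X U" "y \<in> U" "\<forall>z\<in>U. a z = a y"
      using lccD(2)[OF al lccD(1)[OF al y(1)]] by blast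
    let ?N = "{z \<in> dom s. act s z \<in> U}"
    have "openin (gtop G) (gm s ` ?N)" using openin_act_vimage[OF U(1)]
      by (rule openin_gtop_basic) blast
    moreover have "?x \<in> ?N" using x U(2) by simp
    then have "g \<in> gm s ` ?N" unfolding y(2) by (rule imageI)
    moreover have "dgerm s a h = dgerm s a g" if h: "h \<in> gm s ` ?N" for h
    proof -
      obtain z where z: "z \<in> dom s" "act s z \<in> U" "h = gm s z" using h by blast
      then have "dgerm s a h = a (act s z)" using dgerm_germ by blast
      also have "\<dots> = a y" using U(3) z(2) by blast
      finally show ?thesis using dgerm_germ[OF x(1)] x(2) y(2) by metis
    qed
    ultimately show ?thesis by blast
  next
    case False
    \<comment> \<open>The function vanishes outside the compact set \<open>?K\<close>, and
      Hausdorffness of the germ topology makes the complement open.\<close>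
    have "closedin (gtop G) ?K" using compactin_imp_closedin[OF Hausdorff_germs K] .
    then have "openin (gtop G) (topspace (gtop G) - ?K)" by (simp add: openin_diff)
    moreover have "dgerm s a h = 0" if "h \<notin> ?K" for h using nz that by blast
    ultimately show ?thesis using False g by (intro exI[of _ "topspace (gtop G) - ?K"]) simp
  qed
qed

text \<open>At \<open>\<gamma>\<close> with range \<open>y\<close> the convolution has one possible
  nonzero term, at the germ \<open>\<alpha>\<close> of \<open>s\<close> over \<open>z\<close>, the
  image of \<open>y\<close> under \<open>star s\<close>. It remains to compare membership of
  \<open>gmul G (ginv G \<alpha>) \<gamma>\<close> among the germs of \<open>t\<close> with
  membership of \<open>\<gamma>\<close> among those of \<open>s \<cdot> t\<close>.\<close>

lemma dgerm_mult: assumes a: "a \<in> Dsp P s" and b: "b \<in> Dsp P t"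
  shows "dgerm (s \<cdot> t) (dprod s a b) = convolution G (dgerm s a) (dgerm t b)"
proof
  fix \<gamma>
  show "dgerm (s \<cdot> t) (dprod s a b) \<gamma> = convolution G (dgerm s a) (dgerm t b) \<gamma>"
  proof (cases "\<gamma> \<in> garr G")
    case False
    then have "\<gamma> \<notin> gm (s \<cdot> t) ` dom (s \<cdot> t)" using germ_garr by blast
    then show ?thesis using False by (simp add: dgerm_def conv_outside)
  next
    case \<gamma>: True
    then obtain r x where x: "x \<in> dom r" "\<gamma> = gm r x" by (auto simp: garr_iff)
    define y where "y = act r x"
    have yX: "y \<in> topspace X" and rng\<gamma>: "grng G \<gamma> = un y"
      using x dom_topspace(2)[OF x(1)] grng_germ[OF x(1)] by (simp_all add: y_def)
    have right: "dgerm (s \<cdot> t) (dprod s a b) \<gamma> =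
        (if \<gamma> \<in> gm (s \<cdot> t) ` dom (s \<cdot> t) then dprod s a b y else 0)"
    proof (cases "\<gamma> \<in> gm (s \<cdot> t) ` dom (s \<cdot> t)")
      case True
      then obtain x' where x': "x' \<in> dom (s \<cdot> t)" "\<gamma> = gm (s \<cdot> t) x'" by blast
      then have "x' = x" using pt_germ[OF x(1)] pt_germ[OF x'(1)] x(2) by metis
      then have "act (s \<cdot> t) x = y" using germ_act_eq[of x "s \<cdot> t" r] x x' by (simp add: y_def)
      then show ?thesis using True x'(2) \<open>x' = x\<close> dgerm_germ[of x "s \<cdot> t"] x'(1) by simp
    qed (simp add: dgerm_def)
    show ?thesis
    proof (cases "a y = 0")
      case True
      have "convolution G (dgerm s a) (dgerm t b) \<gamma> = 0"
      proof (rule conv_none, rule ccontr)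
        fix \<alpha> assume \<alpha>: "\<alpha> \<in> garr G" "grng G \<alpha> = grng G \<gamma>" "dgerm s a \<alpha> \<noteq> 0"
        from \<alpha>(3) obtain z where z: "z \<in> dom s" "\<alpha> = gm s z" "a (act s z) \<noteq> 0" by (rule dgerm_cases)
        then have "un (act s z) = un y" using \<alpha>(2) rng\<gamma> grng_germ by simp
        then have "act s z = y" using un_inj[OF dom_topspace(2)[OF z(1)] yX] by blast
        then show False using z(3) True by simp
      qed
      then show ?thesis using right True by (simp add: dprod_def)
    next
      case False
      then have ys: "y \<in> pdom P s" using a by (simp add: Dsp_iff)
      define z where "z = act (star s) y"
      have z: "z \<in> dom s" "act s z = y" using ys act_dom' act_star' by (auto simp: z_def)
      define \<alpha> where "\<alpha> = gm s z"
      have \<alpha>: "\<alpha> \<in> garr G" "grng G \<alpha> = grng G \<gamma>" using z germ_garr grng_germ rng\<gamma>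
        by (simp_all add: \<alpha>_def)
      have "convolution G (dgerm s a) (dgerm t b) \<gamma> = dgerm s a \<alpha> * dgerm t b (gmul G (ginv G \<alpha>) \<gamma>)"
      proof (rule conv_single[OF \<alpha>(1) \<gamma> \<alpha>(2)])
        fix \<beta> assume \<beta>: "\<beta> \<in> garr G" "grng G \<beta> = grng G \<gamma>" "dgerm s a \<beta> \<noteq> 0"
        from \<beta>(3) obtain w where w: "w \<in> dom s" "\<beta> = gm s w" "a (act s w) \<noteq> 0" by (rule dgerm_cases)
        then have "un (act s w) = un y" using \<beta>(2) rng\<gamma> grng_germ by simp
        then have "act s w = y" using un_inj[OF dom_topspace(2)[OF w(1)] yX] by blast
        then show "\<beta> = \<alpha>" using act_inj[OF w(1) z(1)] z(2) w(2) by (simp add: \<alpha>_def)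
      qed
      moreover have "dgerm s a \<alpha> = a y" using dgerm_germ[OF z(1), of a] z(2) by (simp add: \<alpha>_def)
      ultimately have left: "convolution G (dgerm s a) (dgerm t b) \<gamma> =
        a y * dgerm t b (gmul G (ginv G \<alpha>) \<gamma>)"
        by simp
      have dp: "dprod s a b y = a y * b z" using ys by (simp add: dprod_def z_def)
      have to_st: "\<gamma> = gm (s \<cdot> t) x \<and> x \<in> dom (s \<cdot> t) \<and> act t x = z"
        if w: "w \<in> dom t" "gmul G (ginv G \<alpha>) \<gamma> = gm t w" for w
      proof -
        have f: "gsrc G (gm t w) = gsrc G \<gamma>" "grng G (gm t w) = gsrc G \<alpha>"
          using inv_mul_facts[OF \<alpha>(1) \<gamma> \<alpha>(2)] w(2) by simp_all
        have "un w = un x" using f(1) w(1) x gsrc_germ by simp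
        then have wx: "w = x" using un_inj dom_topspace(1) w(1) x(1) by blast
        have "un (act t w) = un z" using f(2) grng_germ[OF w(1)] gsrc_germ[OF z(1)]
          by (simp add: \<alpha>_def)
        then have tz: "act t w = z" using un_inj dom_topspace w(1) z(1) by blast
        have "\<gamma> = gmul G \<alpha> (gm t w)" using mul_inv_mul[OF \<alpha>(1) \<gamma> \<alpha>(2)] w(2) by simp
        also have "\<dots> = gm (s \<cdot> t) w" using gmul_germ[of w t s] w(1) z(1) tz by (simp add: \<alpha>_def)
        finally show ?thesis using wx tz w(1) z(1) dom_mult by simp
      qed
      show ?thesis
      proof (cases "b z = 0")
        case True
        have "dgerm t b (gmul G (ginv G \<alpha>) \<gamma>) = 0"
        proof (rule ccontr)
          assume "dgerm t b (gmul G (ginv G \<alpha>) \<gamma>) \<noteq> 0"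
          then obtain w where w: "w \<in> dom t" "gmul G (ginv G \<alpha>) \<gamma> = gm t w" "b (act t w) \<noteq> 0"
            by (rule dgerm_cases)
          have "un w = un x" using inv_mul_facts(2)[OF \<alpha>(1) \<gamma> \<alpha>(2)] w x gsrc_germ by simp
          then have "w = x" using un_inj dom_topspace(1) w(1) x(1) by blast
          then show False using to_st[OF w(1,2)] w(3) True by simp
        qed
        then show ?thesis using left right dp True by simp
      next
        case False
        then have zt: "z \<in> pdom P t" using b by (simp add: Dsp_iff)
        show ?thesis
        proof (cases "\<gamma> \<in> gm (s \<cdot> t) ` dom (s \<cdot> t)")
          case True
          then obtain x' where x': "x' \<in> dom (s \<cdot> t)" "\<gamma> = gm (s \<cdot> t) x'" by blast
          then have xx: "x' = x" using pt_germ[OF x(1)] pt_germ[OF x'(1)] x(2) by metis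
          have acty: "act (s \<cdot> t) x = y" using germ_act_eq[of x "s \<cdot> t" r] x x' xx
            by (simp add: y_def)
          \<comment> \<open>The action is partial, so \<open>dom (s \<cdot> t)\<close> can exceed
            the domain of the composite. As \<open>b z\<close> is nonzero, \<open>z\<close> lies in
            \<open>pdom P t\<close>, and the point \<open>v\<close> below it turns out to be
            \<open>x\<close>.\<close>
          define v where "v = act (star t) z"
          have v: "v \<in> dom t" "act t v = z" using zt act_dom' act_star' by (auto simp: v_def)
          have "v \<in> dom (s \<cdot> t)" "act (s \<cdot> t) v = y" using v z dom_mult act_mult by auto
          then have vx: "v = x" using act_inj x'(1) xx acty by metis
          have c: "composable G \<alpha> (gm t x)" using v z vx composable_germ by (simp add: \<alpha>_def)
          have "\<gamma> = gmul G \<alpha> (gm t x)" using gmul_germ[of x t s] v z vx x' xx by (simp add: \<alpha>_def)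
          then have "gmul G (ginv G \<alpha>) \<gamma> = gm t x" using inv_mul_cancel[OF c] by simp
          then have "dgerm t b (gmul G (ginv G \<alpha>) \<gamma>) = b z" using dgerm_germ[of x t b] v vx by simp
          then show ?thesis using left right dp True by simp
        next
          case no: False
          have "dgerm t b (gmul G (ginv G \<alpha>) \<gamma>) = 0"
          proof (rule ccontr)
            assume "dgerm t b (gmul G (ginv G \<alpha>) \<gamma>) \<noteq> 0"
            then obtain w where w: "w \<in> dom t" "gmul G (ginv G \<alpha>) \<gamma> = gm t w" "b (act t w) \<noteq> 0"
              by (rule dgerm_cases)
            then show False using to_st[OF w(1,2)] no by blast
          qed
          then show ?thesis using left right no by simp
        qed
      qed
    qed
  qed
qed

lemma Lpi_lcc: assumes "F \<in> Lset P" shows "Lpi F \<in> lcc (gtop G)"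
  using assms
proof (induction rule: Lset_induct)
  case zero show ?case by (simp add: Lpi_zero lcc_zero)
next
  case (delta a s) then show ?case by (simp add: Lpi_delta dgerm_lcc)
next
  case (add F H) then show ?case by (simp add: Lpi_add lcc_add)
qed

lemma Lpi_mult: assumes F: "F \<in> Lset P" and H: "H \<in> Lset P"
  shows "Lpi (Lmul P F H) = convolution G (Lpi F) (Lpi H)"
  using F
proof (induction rule: Lset_induct)
  case zero then show ?case by (simp add: Lmul_zero Lpi_zero conv_zero_left)
next
  case (delta a s)
  show ?case using H
  proof (induction rule: Lset_induct)
    case zero then show ?case by (simp add: Lmul_zero Lpi_zero conv_zero_right)
  next
    case (delta b t)
    then show ?case using dgerm_mult[OF \<open>a \<in> Dsp P s\<close>] by (simp add: Lmul_delta Lpi_delta)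
  next
    case (add H H')
    note d = Ldelta_Lset[OF delta]
    show ?case
      using add by (simp add: Lmul_add_right[OF d] Lpi_add Lmul_Lset[OF d] conv_add_right)
  qed
next
  case (add F F')
  then show ?case
    by (simp add: Lmul_add_left H Lpi_add Lmul_Lset conv_add_left Lpi_lcc)
qed

text \<open>The easy half of the kernel computation: \<open>Lpi\<close> vanishes on the generators
  by \<open>dgerm_le\<close> and is multiplicative, so it vanishes on the ideal.\<close>

lemma Nset_Lset: assumes "F \<in> Nset P" shows "F \<in> Lset P \<and> Lpi F = (\<lambda>_. 0)"
  using assms
proof induction
  case (gen r s a)
  then have "a \<in> Dsp P s" using le_pdom by (auto simp: Dsp_iff)
  then show ?case
    using gen dgerm_le[OF gen] by (simp add: Ladd_Lset Lneg_Lset Ldelta_Lset Lpi_add Lpi_neg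
      Lpi_delta)
next
  case zero then show ?case by (simp add: zero_Lset Lpi_zero)
next
  case (add F H) then show ?case by (simp add: Ladd_Lset Lpi_add)
next
  case (neg F) then show ?case by (simp add: Lneg_Lset Lpi_neg)
next
  case (lmul F H) then show ?case by (simp add: Lmul_Lset Lpi_mult conv_zero_right)
next
  case (rmul F H) then show ?case by (simp add: Lmul_Lset Lpi_mult conv_zero_left)
qed

end

section \<open>The kernel of the map from finite sums to functions on germs\<close>

lemma Nset_sum: assumes "finite B" "\<And>i. i \<in> B \<Longrightarrow> H i \<in> Nset P"
  shows "(\<lambda>t z. \<Sum>i\<in>B. H i t z) \<in> Nset P"
  using assms
proof (induction B)
  case empty then show ?case by (simp add: Nset.zero)
next
  case (insert i B)
  then have "Ladd (H i) (\<lambda>t z. \<Sum>i\<in>B. H i t z) \<in> Nset P" by (intro Nset.add) auto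
  then show ?case using insert by (simp add: Ladd_def)
qed

text \<open>Coefficients are functions of the range point, so under \<open>Lpi\<close> this
  restricts to arrows ending in \<open>W\<close>.\<close>

definition Lres :: "'x set \<Rightarrow> ('s \<Rightarrow> 'x \<Rightarrow> 'r::comm_ring_1) \<Rightarrow> 's \<Rightarrow> 'x \<Rightarrow> 'r" where
  "Lres W F = (\<lambda>s x. if x \<in> W then F s x else 0)"

context paction
begin

text \<open>Germs are indexed here by their range point \<open>x\<close>, as coefficients are. Two
  equal germs have a common lower bound, and \<open>u\<close> is made smaller once for each further
  element.\<close>

lemma germ_common_lower_bound:
  assumes "finite C" "C \<noteq> {}" "\<And>s. s \<in> C \<Longrightarrow> x \<in> pdom P s \<and> gm s (act (star s) x) = g"
  shows "\<exists>u. x \<in> pdom P u \<and> gm u (act (star u) x) = g \<and> (\<forall>s\<in>C. le u s)"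
  using assms
proof (induction C rule: finite_ne_induct)
  case (singleton s)
  then show ?case by (intro exI[of _ s]) (simp add: ile_refl)
next
  case (insert s C)
  then obtain u where u: "x \<in> pdom P u" "gm u (act (star u) x) = g" "\<forall>s\<in>C. le u s" by blast
  have s: "x \<in> pdom P s" "gm s (act (star s) x) = g" using insert.prems by blast+
  let ?y = "act (star u) x"
  have yu: "?y \<in> dom u" and ys: "act (star s) x \<in> dom s" using u s act_dom' by blast+
  have "gm u ?y = gm s (act (star s) x)" using u(2) s(2) by simp
  from germ_eq_iff[OF yu ys, THEN iffD1, OF this]
  obtain v where v: "le v u" "le v s" "?y \<in> dom v" by blast
  have av: "act v ?y = x" using le_act[OF v(1,3)] act_star'[OF u(1)] by simp
  have xv: "x \<in> pdom P v" using act_dom[OF v(3)] by (simp only: av)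
  have "act (star v) x = ?y" using act_star[OF v(3)] by (simp only: av)
  then have "gm v (act (star v) x) = g" using germ_le[OF v(1,3)] u(2) by simp
  moreover have "\<forall>t\<in>insert s C. le v t" using v u(3) ile_trans by blast
  ultimately show ?case using xv by blast
qed

end

context principal_action
begin

lemma indc_Dsp: assumes "co K" "K \<subseteq> pdom P s" shows "indc K c \<in> Dsp P s"
proof -
  have "indc K c \<in> lcc X" using coD[OF assms(1)] by (intro lcc_indc)
  then show ?thesis using assms(2) by (auto simp: Dsp_iff indc_def split: if_splits)
qed

text \<open>Near \<open>x\<close>, arrows with the same germ can be replaced by a common lower bound modulo \<open>\<N>\<close>; the
  coefficients then add up to a value of \<open>Lpi F\<close>.\<close>

lemma kernel_local:
  assumes F: "F \<in> Lset P" and z: "Lpi F = (\<lambda>_. 0)" and x: "x \<in> topspace X"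
  shows "\<exists>W. co W \<and> x \<in> W \<and> (\<forall>W'. co W' \<and> W' \<subseteq> W \<longrightarrow> Lres W' F \<in> Nset P)"
proof -
  let ?A = "{s. F s \<noteq> (\<lambda>_. 0)}"
  \<comment> \<open>The coefficients outside \<open>B\<close> are zero at \<open>x\<close>, hence on
    a neighbourhood of it.\<close>
  define B where "B = {s. F s x \<noteq> 0}"
  have fin: "finite ?A" using F by (rule LsetD(1))
  have BA: "B \<subseteq> ?A" by (auto simp: B_def)
  then have finB: "finite B" using fin finite_subset by blast
  have Fl: "F s \<in> lcc X" for s using LsetD(2)[OF F, of s] by (simp add: Dsp_iff)
  have xB: "x \<in> pdom P s" if "s \<in> B" for s using LsetD(2)[OF F, of s] that
    by (simp add: Dsp_iff B_def)
  define \<gamma> where "\<gamma> s = gm s (act (star s) x)" for s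
  have "\<forall>g\<in>\<gamma> ` B. \<exists>u. x \<in> pdom P u \<and> gm u (act (star u) x) = g \<and> (\<forall>s\<in>{s \<in> B. \<gamma> s = g}. le u s)"
  proof
    fix g assume "g \<in> \<gamma> ` B"
    then show "\<exists>u. x \<in> pdom P u \<and> gm u (act (star u) x) = g \<and> (\<forall>s\<in>{s \<in> B. \<gamma> s = g}. le u s)"
      using finB xB by (intro germ_common_lower_bound) (auto simp: \<gamma>_def)
  qed
  from bchoice[OF this] obtain u where u: "\<forall>g\<in>\<gamma> ` B.
      x \<in> pdom P (u g) \<and> gm (u g) (act (star (u g)) x) = g \<and> (\<forall>s\<in>{s \<in> B. \<gamma> s = g}. le (u g) s)" ..
  \<comment> \<open>All elements of \<open>B\<close> with the same germ over \<open>x\<close> share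
    one lower bound.\<close>
  define v where "v s = u (\<gamma> s)" for s
  have v: "x \<in> pdom P (v s)" "le (v s) s" "gm (v s) (act (star (v s)) x) = \<gamma> s" if "s \<in> B" for s
    using bspec[OF u imageI[OF that]] that by (auto simp: v_def)
  have v_eq: "v s = v t \<longleftrightarrow> \<gamma> s = \<gamma> t" if "s \<in> B" "t \<in> B" for s t
  proof
    assume "v s = v t"
    then have "gm (v s) (act (star (v s)) x) = \<gamma> t" using v(3)[OF that(2)] by (simp only:)
    then show "\<gamma> s = \<gamma> t" using v(3)[OF that(1)] by (simp only:)
  qed (simp add: v_def)
  have "\<forall>s. \<exists>U. openin X U \<and> x \<in> U \<and> (\<forall>y\<in>U. F s y = F s x)" using lccD(2)[OF Fl x] by blast
  then obtain U where U: "\<And>s. openin X (U s)" "\<And>s. x \<in> U s" "\<And>s y. y \<in> U s \<Longrightarrow> F s y = F s x" by metis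
  let ?O = "((\<Inter>s\<in>?A. U s) \<inter> topspace X) \<inter> ((\<Inter>s\<in>B. pdom P (v s)) \<inter> topspace X)"
  have "openin X ?O" using fin finB U(1) openin_pdom by (intro openin_Int openin_INT) auto
  moreover have "x \<in> ?O" using U(2) v(1) x by blast
  ultimately obtain W where W: "co W" "x \<in> W" "W \<subseteq> ?O" by (rule co_base)
  \<comment> \<open>The sum over a class of equal germs is the value of \<open>Lpi F\<close> at that
    germ.\<close>
  have zero_sum: "(\<Sum>s | s \<in> B \<and> \<gamma> s = \<gamma> r. F s x) = 0" if r: "r \<in> B" for r
  proof -
    have yr: "act (star r) x \<in> dom r" using act_dom' xB[OF r] by blast
    have "dgerm s (F s) (\<gamma> r) = (if s \<in> B \<and> \<gamma> s = \<gamma> r then F s x else 0)" for s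
    proof (cases "s \<in> B \<and> \<gamma> s = \<gamma> r")
      case True
      then have "dgerm s (F s) (\<gamma> r) = F s (act s (act (star s) x))"
        using dgerm_germ[OF act_dom'[OF xB], of s "F s"] by (simp add: \<gamma>_def)
      then show ?thesis using True act_star'[OF xB] by simp
    next
      case False
      have "dgerm s (F s) (\<gamma> r) = 0"
      proof (rule ccontr)
        assume "dgerm s (F s) (\<gamma> r) \<noteq> 0"
        then obtain w where w: "w \<in> dom s" "\<gamma> r = gm s w" "F s (act s w) \<noteq> 0" by (rule dgerm_cases)
        then have "act (star r) x = w" using pt_germ[OF yr] pt_germ[OF w(1)] by (simp add: \<gamma>_def)
        then have wr: "w \<in> dom r" "gm s w = gm r w" "act r w = x"
          using yr w(2) act_star'[OF xB[OF r]] by (auto simp: \<gamma>_def)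
        then have sx: "act s w = x" using germ_act_eq[OF w(1) wr(1,2)] by simp
        then have "s \<in> B" using w(3) by (simp add: B_def)
        moreover have "act (star s) x = w" using act_star[OF w(1)] by (simp only: sx)
        then have "\<gamma> s = \<gamma> r" by (simp add: \<gamma>_def w(2)[unfolded \<gamma>_def])
        ultimately show False using False by blast
      qed
      then show ?thesis using False by auto
    qed
    then have "Lpi F (\<gamma> r) = (\<Sum>s\<in>?A. if s \<in> B \<and> \<gamma> s = \<gamma> r then F s x else 0)"
      by (simp add: Lpi_def)
    also have "\<dots> = (\<Sum>s\<in>{s \<in> ?A. s \<in> B \<and> \<gamma> s = \<gamma> r}. F s x)"
      using fin by (simp only: sum.inter_filter)
    also have "{s \<in> ?A. s \<in> B \<and> \<gamma> s = \<gamma> r} = {s. s \<in> B \<and> \<gamma> s = \<gamma> r}" using BA by blast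
    finally show ?thesis using z by simp
  qed
  have "Lres W' F \<in> Nset P" if W': "co W'" "W' \<subseteq> W" for W'
  proof -
    define i where "i s = indc W' (F s x)" for s
    \<comment> \<open>\<open>?H s\<close> places the coefficient \<open>i s\<close> at
      \<open>s\<close> and its negative at \<open>v s\<close>. Summed over \<open>B\<close>, the
      negative terms collect into the vanishing class sums, and what remains is \<open>F\<close> on
      \<open>W'\<close>.\<close>
    let ?H = "\<lambda>s. Lneg (Ladd (Ldelta (i s) (v s)) (Lneg (Ldelta (i s) s)))"
    have iD: "i s \<in> Dsp P (v s)" if "s \<in> B" for s
    proof -
      have "W' \<subseteq> pdom P (v s)" using W'(2) W(3) that by blast
      then show ?thesis using W'(1) by (simp add: i_def indc_Dsp)
    qed
    have "?H s \<in> Nset P" if "s \<in> B" for s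
      using v(2)[OF that] iD[OF that] by (intro Nset.neg Nset.gen)
    then have "(\<lambda>t y. \<Sum>s\<in>B. ?H s t y) \<in> Nset P" using finB by (rule Nset_sum[rotated])
    moreover have "(\<Sum>s\<in>B. ?H s t y) = Lres W' F t y" for t y
    proof (cases "y \<in> W'")
      case False
      then show ?thesis by (simp add: Lneg_def Ladd_def Ldelta_def Lres_def i_def indc_def
        if_distrib[of "\<lambda>f. f y"] cong: if_cong)
    next
      case True
      have iy: "i s y = F s x" for s using True by (simp add: i_def indc_def)
      have "(\<Sum>s\<in>B. ?H s t y) = (\<Sum>s\<in>B. (if s = t then F s x else 0) - (if v s =
        t then F s x else 0))"
        by (intro sum.cong) (auto simp: Lneg_def Ladd_def Ldelta_def iy)
      also have "\<dots> = (\<Sum>s\<in>B. if s = t then F s x else 0) - (\<Sum>s\<in>B. if v s = t then F s x else 0)"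
        by (rule sum_subtractf)
      also have "(\<Sum>s\<in>B. if s = t then F s x else 0) = F t x"
        using finB by (simp add: B_def)
      also have "(\<Sum>s\<in>B. if v s = t then F s x else 0) = (\<Sum>s\<in>{s \<in> B. v s = t}. F s x)"
        using finB by (simp only: sum.inter_filter)
      also have "\<dots> = 0"
      proof (cases "\<exists>r\<in>B. v r = t")
        case True
        then obtain r where r: "r \<in> B" "v r = t" by blast
        have "{s \<in> B. v s = t} = {s. s \<in> B \<and> \<gamma> s = \<gamma> r}" using v_eq r by blast
        then show ?thesis using zero_sum[OF r(1)] by simp
      next
        case False
        then have "{s \<in> B. v s = t} = {}" by blast
        then show ?thesis by (simp only: sum.empty)
      qed
      finally have "(\<Sum>s\<in>B. ?H s t y) = F t x" by simp
      moreover have "F t y = F t x"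
      proof (cases "t \<in> ?A")
        case True
        then have "y \<in> U t" using \<open>y \<in> W'\<close> W'(2) W(3) by blast
        then show ?thesis by (rule U(3))
      qed simp
      ultimately show ?thesis using True by (simp add: Lres_def)
    qed
    ultimately show ?thesis by simp
  qed
  then show ?thesis using W by blast
qed

text \<open>Good sets are stable under finite unions, since \<open>W'\<close> splits into
  \<open>W' \<inter> W\<close> and \<open>W' - W\<close>; this is why goodness refers to all compact
  open subsets. Compactness of the joint support of the coefficients then globalizes
  \<open>kernel_local\<close>.\<close>

lemma kernel: assumes F: "F \<in> Lset P" and z: "Lpi F = (\<lambda>_. 0)" shows "F \<in> Nset P"
proof -
  let ?A = "{s. F s \<noteq> (\<lambda>_. 0)}" and ?good = "\<lambda>W. co W \<and> (\<forall>W'. co W' \<and> W' \<subseteq> W \<longrightarrow> Lres W' F \<in> Nset P)"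
  let ?K = "\<Union>s\<in>?A. {x. F s x \<noteq> 0}"
  have Fl: "F s \<in> lcc X" for s using LsetD(2)[OF F, of s] by (simp add: Dsp_iff)
  have fin: "finite ?A" using F by (rule LsetD(1))
  have K: "co ?K"
    unfolding co_def using fin lccD(3)[OF Fl] lcc_support(1)[OF Fl]
      by (auto intro!: compactin_Union)
  have "?K \<subseteq> \<Union>{W. ?good W}"
  proof
    fix x assume "x \<in> ?K"
    then have "x \<in> topspace X" using lccD(1)[OF Fl] by auto
    then show "x \<in> \<Union>{W. ?good W}" using kernel_local[OF F z] by blast
  qed
  moreover have "\<forall>W\<in>{W. ?good W}. openin X W" using coD by blast
  ultimately obtain \<F> where \<F>: "finite \<F>" "\<F> \<subseteq> {W. ?good W}" "?K \<subseteq> \<Union>\<F>"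
    using coD(2)[OF K] unfolding compactin_def by meson
  have "?good (\<Union>\<F>)" using \<F>(1,2)
  proof (induction \<F>)
    case empty
    have "Lres {} F = (\<lambda>_ _. 0)" by (simp add: Lres_def fun_eq_iff)
    then show ?case by (simp add: co_def Nset.zero)
  next
    case (insert W \<F>)
    then have W: "?good W" and V: "?good (\<Union>\<F>)" by auto
    have "Lres W' F \<in> Nset P" if W': "co W'" "W' \<subseteq> \<Union>(insert W \<F>)" for W'
    proof -
      have "Lres (W' \<inter> W) F \<in> Nset P" using W co_Int[OF W'(1)] by blast
      moreover have "Lres (W' - W) F \<in> Nset P"
      proof -
        have "W' - W \<subseteq> \<Union>\<F>" "co (W' - W)" using W' W co_Diff by auto
        then show ?thesis using V by blast
      qed
      ultimately have "Ladd (Lres (W' \<inter> W) F) (Lres (W' - W) F) \<in> Nset P" by (rule Nset.add)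
      moreover have "Ladd (Lres (W' \<inter> W) F) (Lres (W' - W) F) = Lres W' F"
        by (auto simp: Ladd_def Lres_def fun_eq_iff)
      ultimately show ?thesis by simp
    qed
    moreover have "co (\<Union>(insert W \<F>))" using W V co_Un by simp
    ultimately show ?case by blast
  qed
  then have "Lres ?K F \<in> Nset P" using K \<F>(3) by blast
  moreover have "Lres ?K F = F" by (auto simp: Lres_def fun_eq_iff)
  ultimately show ?thesis by simp
qed

text \<open>Now that the kernel of \<open>Lpi\<close> is \<open>Nset P\<close>, classes are fibres
  of \<open>Lpi\<close>, and a chosen representative \<open>crep\<close> is controlled by its
  image.\<close>

lemma cls_eq: assumes "F \<in> Lset P" shows "cls P F = {H \<in> Lset P. Lpi H = Lpi F}"
proof -
  have "Ladd F (Lneg H) \<in> Nset P \<longleftrightarrow> Lpi H = Lpi F" if H: "H \<in> Lset P" for H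
  proof -
    have L: "Ladd F (Lneg H) \<in> Lset P" using assms H by (simp add: Ladd_Lset Lneg_Lset)
    have "Lpi (Ladd F (Lneg H)) = (\<lambda>g. Lpi F g - Lpi H g)"
      using assms H by (simp add: Lpi_add Lneg_Lset Lpi_neg)
    then have "Lpi (Ladd F (Lneg H)) = (\<lambda>_. 0) \<longleftrightarrow> Lpi H = Lpi F" by (auto simp: fun_eq_iff)
    then show ?thesis using kernel[OF L] Nset_Lset by blast
  qed
  then show ?thesis by (auto simp: cls_def)
qed

section \<open>Identification of the crossed product with the Steinberg algebra\<close>

definition Cpi :: "('s \<Rightarrow> 'x \<Rightarrow> 'r::comm_ring_1) set \<Rightarrow> ('s \<times> 'x) set \<Rightarrow> 'r"
  where "Cpi C = Lpi (crep C)"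

lemma crep_cls: assumes "F \<in> Lset P" shows "crep (cls P F) \<in> Lset P" "Lpi (crep (cls P F)) = Lpi F"
proof -
  have "F \<in> cls P F" using cls_eq[OF assms] assms by simp
  then have "crep (cls P F) \<in> cls P F" unfolding crep_def by (rule someI[of "\<lambda>H. H \<in> cls P F"])
  then show "crep (cls P F) \<in> Lset P" "Lpi (crep (cls P F)) = Lpi F" using cls_eq[OF assms] by auto
qed

lemma Cpi_cls: "F \<in> Lset P \<Longrightarrow> Cpi (cls P F) = Lpi F"
  by (simp add: Cpi_def crep_cls)

lemma indc_germ: assumes "K \<subseteq> dom s" shows "indc (gm s ` K) c = dgerm s (indc (act s ` K) c)"
proof
  fix g
  show "indc (gm s ` K) c g = dgerm s (indc (act s ` K) c) g"
  proof (cases "g \<in> gm s ` dom s")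
    case True
    then obtain x where x: "x \<in> dom s" "g = gm s x" by blast
    have "g \<in> gm s ` K \<longleftrightarrow> x \<in> K"
    proof
      assume "g \<in> gm s ` K"
      then obtain y where y: "y \<in> K" "g = gm s y" by blast
      then have "y = x" using pt_germ[OF x(1)] pt_germ[of y s] assms x(2) by auto
      then show "x \<in> K" using y(1) by simp
    qed (use x in blast)
    moreover have "act s x \<in> act s ` K \<longleftrightarrow> x \<in> K"
    proof
      assume "act s x \<in> act s ` K"
      then obtain y where y: "y \<in> K" "act s x = act s y" by blast
      then have "x = y" using assms by (intro act_inj[OF x(1)]) blast+
      then show "x \<in> K" using y(1) by simp
    qed blast
    moreover have "dgerm s (indc (act s ` K) c) g = indc (act s ` K) c (act s x)"
      unfolding x(2) by (rule dgerm_germ[OF x(1)])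
    ultimately show ?thesis by (simp add: indc_def)
  next
    case False
    then have "g \<notin> gm s ` K" using assms by blast
    then show ?thesis using False by (simp add: indc_def dgerm_def)
  qed
qed

text \<open>Handles the differences \<open>B - V\<close> produced by \<open>lcc_induct\<close>: such
  a set is again the set of germs of \<open>s\<close> over a compact open set.\<close>

lemma germ_Diff_indc: assumes K: "co K" "K \<subseteq> dom s" and V: "openin (gtop G) V" "closedin (gtop G) V"
  obtains a where "a \<in> Dsp P s" "indc (gm s ` K - V) c = dgerm s a"
proof -
  let ?K = "{x \<in> K. gm s x \<notin> V}"
  have op: "openin X (K \<inter> {x \<in> dom s. gm s x \<in> W})" if "openin (gtop G) W" for W
    using openin_germ_vimage[OF that, of s] coD(1)[OF K(1)] by blast
  have "?K = K \<inter> {x \<in> dom s. gm s x \<in> topspace (gtop G) - V}" using K(2) germ_garr topspace_gtop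
    by auto
  then have o1: "openin X ?K" using op[of "topspace (gtop G) - V"] V(2) by (simp add: openin_diff)
  have "K - ?K = K \<inter> {x \<in> dom s. gm s x \<in> V}" using K(2) by blast
  then have "openin X (K - ?K)" using op[OF V(1)] by simp
  then have co: "co ?K" using o1 by (intro co_subset[OF K(1)]) auto
  have sub: "?K \<subseteq> dom s" using K(2) by blast
  have eq: "gm s ` K - V = gm s ` ?K" by blast
  have "co (act s ` ?K)" using co_act_image[OF co sub] .
  moreover have "act s ` ?K \<subseteq> pdom P s" using sub act_dom by blast
  ultimately have "indc (act s ` ?K) c \<in> Dsp P s" by (rule indc_Dsp)
  then show thesis using that indc_germ[OF sub] unfolding eq by blast
qed

lemma germ_basic_nbhd: assumes W: "openin (gtop G) W" and g: "g \<in> W"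
  shows "\<exists>B\<in>{gm s ` K | s K. co K \<and> K \<subseteq> dom s}. g \<in> B \<and> B \<subseteq> W \<and> openin (gtop G) B \<and>
    closedin (gtop G) B"
proof -
  obtain s K where K: "co K" "K \<subseteq> dom s" "g \<in> gm s ` K" "gm s ` K \<subseteq> W" by (rule germ_base[OF W g])
  then show ?thesis using GaD(4,6)[OF germ_Ga[OF K(1,2)]] by blast
qed

lemma Lpi_surj: assumes "f \<in> lcc (gtop G)" shows "\<exists>F\<in>Lset P. Lpi F = f"
  using assms
proof (induction rule: lcc_induct[where \<B> = "{gm s ` K | s K. co K \<and> K \<subseteq> dom s}"])
  case (basis g W) then show ?case by (intro germ_basic_nbhd)
next
  case zero then show ?case using Lpi_zero zero_Lset by blast
next
  case (step g B V c)
  then obtain F where F: "F \<in> Lset P" "Lpi F = g" by blast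
  obtain s K where K: "B = gm s ` K" "co K" "K \<subseteq> dom s" using step(2) by auto
  obtain a where a: "a \<in> Dsp P s" "indc (gm s ` K - V) c = dgerm s a"
    by (rule germ_Diff_indc[OF K(2,3) step(3,4)])
  have "Lpi (Ladd F (Ldelta a s)) = (\<lambda>x. g x + indc (B - V) c x)"
    using F a K(1) by (simp add: Lpi_add Ldelta_Lset Lpi_delta)
  then show ?case using Ladd_Lset[OF F(1) Ldelta_Lset[OF a(1)]] by blast
qed

lemma crossed_diag_facts: assumes "C \<in> crossed_diag P"
  shows "C \<in> cls P ` Lset P" "\<And>g. Cpi C g \<noteq> 0 \<Longrightarrow> g \<in> gunits G"
proof -
  have "C \<in> cls P ` Lset P \<and> (\<forall>g. Cpi C g \<noteq> 0 \<longrightarrow> g \<in> gunits G)"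
    using assms
  proof induction
    case (gen e a)
    have "g \<in> gunits G" if "dgerm e a g \<noteq> 0" for g
    proof -
      obtain x where x: "x \<in> dom e" "g = gm e x" "a (act e x) \<noteq> 0"
        by (rule dgerm_cases[OF \<open>dgerm e a g \<noteq> 0\<close>])
      then have "g = un x" using un_eq[OF gen(1)] idem_dom[OF gen(1)] by simp
      then show ?thesis using gunits_eq dom_topspace(1)[OF x(1)] by blast
    qed
    then show ?case using gen(2) by (simp add: Cpi_cls Ldelta_Lset Lpi_delta)
  next
    case zero
    then show ?case by (simp add: Cpi_cls zero_Lset Lpi_zero)
  next
    case (add C D)
    then have L: "crep C \<in> Lset P" "crep D \<in> Lset P" using crep_cls by blast+
    have "Cpi (cls P (Ladd (crep C) (crep D))) = (\<lambda>g. Cpi C g + Cpi D g)"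
      unfolding Cpi_cls[OF Ladd_Lset[OF L]] using L by (simp add: Lpi_add Cpi_def)
    then have "g \<in> gunits G" if "Cpi (cls P (Ladd (crep C) (crep D))) g \<noteq> 0" for g
      using that add.IH by (cases "Cpi C g = 0") auto
    then show ?case using Ladd_Lset[OF L] by blast
  next
    case (neg C)
    then have L: "crep C \<in> Lset P" using crep_cls by blast
    have "Cpi (cls P (Lneg (crep C))) = (\<lambda>g. - Cpi C g)"
      unfolding Cpi_cls[OF Lneg_Lset[OF L]] using L by (simp add: Lpi_neg Cpi_def)
    then show ?case using neg Lneg_Lset[OF L] by auto
  qed
  then show "C \<in> cls P ` Lset P" "\<And>g. Cpi C g \<noteq> 0 \<Longrightarrow> g \<in> gunits G" by blast+
qed

text \<open>A diagonal \<open>f\<close> is nonzero only at units, and units are germs of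
  idempotents. So the basic sets in \<open>lcc_induct\<close> can be taken over idempotents, and
  each step adds a generator of the diagonal.\<close>

lemma crossed_diag_surj: assumes "f \<in> adiag (stb :: (_, 'r::comm_ring_1) dalg)"
  shows "\<exists>C\<in>crossed_diag P. Cpi C = f"
proof -
  have f: "f \<in> lcc (gtop G)" "\<And>g. f g \<noteq> 0 \<Longrightarrow> g \<in> gunits G" using assms by (auto simp: stb_simps)
  let ?\<B> = "{gm e ` K | e K. e \<in> idm \<and> co K \<and> K \<subseteq> dom e}"
  show ?thesis using f(1)
  proof (induction rule: lcc_induct[where \<B> = ?\<B>])
    case (basis g W)
    then obtain x where x: "x \<in> topspace X" "g = un x" using f(2) gunits_eq by blast
    then obtain e where e: "e \<in> idm" "x \<in> dom e" "un x = gm e x" by (auto elim: topspace_idem)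
    have "openin X {y \<in> dom e. gm e y \<in> W}" by (rule openin_germ_vimage[OF basis(2)])
    moreover have "x \<in> {y \<in> dom e. gm e y \<in> W}" using basis(3) x e by simp
    ultimately obtain K where K: "co K" "x \<in> K" "K \<subseteq> {y \<in> dom e. gm e y \<in> W}" by (rule co_base)
    then have Kd: "K \<subseteq> dom e" by blast
    have "gm e ` K \<in> ?\<B>" using e(1) K(1) Kd by blast
    moreover have "g \<in> gm e ` K" using x(2) e(3) K(2) by simp
    moreover have "gm e ` K \<subseteq> W" using K(3) by blast
    ultimately show ?case using GaD(4,6)[OF germ_Ga[OF K(1) Kd]] by blast
  next
    case zero
    have "Cpi (cls P (\<lambda>_ _. 0)) = (\<lambda>_. 0 :: 'r)" by (simp add: Cpi_cls zero_Lset Lpi_zero)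
    then show ?case using crossed_diag.zero by blast
  next
    case (step g B V c)
    then obtain C where C: "C \<in> crossed_diag P" "Cpi C = g" by blast
    obtain e K where K: "B = gm e ` K" "e \<in> idm" "co K" "K \<subseteq> dom e" using step(2) by auto
    obtain a where a: "a \<in> Dsp P e" "indc (gm e ` K - V) c = dgerm e a"
      by (rule germ_Diff_indc[OF K(3,4) step(3,4)])
    let ?D = "cls P (Ldelta a e)"
    have D: "?D \<in> crossed_diag P" using K(2) a(1) by (rule crossed_diag.gen)
    have L: "crep C \<in> Lset P" "crep ?D \<in> Lset P"
      using crossed_diag_facts(1)[OF C(1)] crep_cls Ldelta_Lset[OF a(1)] by blast+
    have "Cpi (cls P (Ladd (crep C) (crep ?D))) = (\<lambda>x. Cpi C x + Cpi ?D x)"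
      unfolding Cpi_cls[OF Ladd_Lset[OF L]] using L by (simp add: Lpi_add Cpi_def)
    also have "\<dots> = (\<lambda>x. g x + indc (B - V) c x)"
      using C(2) a K(1) by (simp add: Cpi_cls Ldelta_Lset Lpi_delta)
    finally show ?case using crossed_diag.add[OF C(1) D] by blast
  qed
qed

lemma crossed_product_closed: "alg_closed (crossed_product P :: (_, 'r::comm_ring_1) dalg)"
proof -
  have "crep C \<in> Lset P" if "C \<in> cls P ` Lset P" for C :: "('s \<Rightarrow> 'x \<Rightarrow> 'r) set" using that crep_cls
    by blast
  then show ?thesis
    unfolding alg_closed_def using crossed_diag_facts(1)
    by (auto simp: crossed_product_def Ladd_Lset Lmul_Lset Lsmul_Lset)
qed

theorem crossed_product_iso_steinberg:
  "alg_iso (crossed_product P :: (_, 'r::comm_ring_1) dalg) (steinberg G) Cpi"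
  "diag_preserving (crossed_product P :: (_, 'r) dalg) (steinberg G) Cpi"
proof -
  have L: "crep C \<in> Lset P" if "C \<in> cls P ` Lset P" for C :: "('s \<Rightarrow> 'x \<Rightarrow> 'r) set"
    using that crep_cls by blast
  have "bij_betw Cpi (cls P ` Lset P) (lcc (gtop G) :: (_ \<Rightarrow> 'r) set)"
    unfolding bij_betw_def
  proof
    show "inj_on Cpi (cls P ` Lset P :: ('s \<Rightarrow> 'x \<Rightarrow> 'r) set set)"
    proof (rule inj_onI)
      fix C D :: "('s \<Rightarrow> 'x \<Rightarrow> 'r) set" assume CD: "C \<in> cls P ` Lset P" "D \<in> cls P ` Lset P"
        "Cpi C = Cpi D"
      then obtain F H where "F \<in> Lset P" "C = cls P F" "H \<in> Lset P" "D = cls P H" by blast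
      then show "C = D" using CD(3) Cpi_cls[of F] Cpi_cls[of H] cls_eq[of F] cls_eq[of H] by simp
    qed
    show "Cpi ` cls P ` Lset P = (lcc (gtop G) :: (_ \<Rightarrow> 'r) set)"
    proof
      show "Cpi ` cls P ` Lset P \<subseteq> (lcc (gtop G) :: (_ \<Rightarrow> 'r) set)" by (auto simp: Cpi_cls Lpi_lcc)
      show "(lcc (gtop G) :: (_ \<Rightarrow> 'r) set) \<subseteq> Cpi ` cls P ` Lset P"
      proof
        fix f :: "_ \<Rightarrow> 'r" assume "f \<in> lcc (gtop G)"
        then obtain F where "F \<in> Lset P" "Lpi F = f" using Lpi_surj by blast
        then show "f \<in> Cpi ` cls P ` Lset P" using Cpi_cls[of F] by (metis image_eqI)
      qed
    qed
  qed
  then show "alg_iso (crossed_product P :: (_, 'r::comm_ring_1) dalg) (steinberg G) Cpi"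
    unfolding alg_iso_def ring_iso_def
    by (auto simp: crossed_product_def stb_simps(1-4) L Ladd_Lset Lmul_Lset Lsmul_Lset Cpi_cls
        Lpi_add Lpi_mult Lpi_smul Cpi_def[of "cls P _"] crep_cls)
  have "Cpi C \<in> adiag stb" if C: "C \<in> crossed_diag P" for C :: "('s \<Rightarrow> 'x \<Rightarrow> 'r) set"
    using crossed_diag_facts[OF C] Lpi_lcc by (auto simp: stb_simps Cpi_cls)
  then show "diag_preserving (crossed_product P :: (_, 'r) dalg) (steinberg G) Cpi"
    unfolding diag_preserving_def using crossed_diag_surj
      by (auto simp: crossed_product_def image_iff)
qed

end

section \<open>Composition of diagonal-preserving isomorphisms\<close>

lemma ring_iso_comp: "ring_iso A B f \<Longrightarrow> ring_iso B C g \<Longrightarrow> ring_iso A C (g \<circ> f)"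
  unfolding ring_iso_def using bij_betw_trans bij_betwE by (metis comp_apply)

lemma alg_iso_comp: "alg_iso A B f \<Longrightarrow> alg_iso B C g \<Longrightarrow> alg_iso A C (g \<circ> f)"
  unfolding alg_iso_def using ring_iso_comp by (metis bij_betwE comp_apply ring_iso_def)

lemma diag_preserving_comp: "diag_preserving A B f \<Longrightarrow> diag_preserving B C g \<Longrightarrow>
  diag_preserving A C (g \<circ> f)"
  unfolding diag_preserving_def by (metis image_comp)

lemma ring_iso_inv: assumes A: "alg_closed A" and f: "ring_iso A B f"
  shows "ring_iso B A (inv_into (acar A) f)"
proof -
  let ?g = "inv_into (acar A) f"
  have bij: "bij_betw f (acar A) (acar B)" using f by (simp add: ring_iso_def)
  have g: "?g y \<in> acar A" "f (?g y) = y" if "y \<in> acar B" for y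
    using that bij_betw_inv_into_right[OF bij] bij_betwE[OF bij_betw_inv_into[OF bij]] by simp_all
  have gf: "?g (f x) = x" if "x \<in> acar A" for x using bij_betw_inv_into_left[OF bij that] .
  have "?g (aadd B x y) = aadd A (?g x) (?g y) \<and> ?g (amul B x y) = amul A (?g x) (?g y)"
    if "x \<in> acar B" "y \<in> acar B" for x y
  proof -
    have "aadd B x y = f (aadd A (?g x) (?g y))" "amul B x y = f (amul A (?g x) (?g y))"
      using f g that by (simp_all add: ring_iso_def)
    moreover have "aadd A (?g x) (?g y) \<in> acar A" "amul A (?g x) (?g y) \<in> acar A"
      using A g that by (simp_all add: alg_closed_def)
    ultimately show ?thesis using gf by metis
  qed
  then show ?thesis using bij_betw_inv_into[OF bij] by (simp add: ring_iso_def)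
qed

lemma alg_iso_inv: assumes A: "alg_closed A" and f: "alg_iso A B f"
  shows "alg_iso B A (inv_into (acar A) f)"
proof -
  let ?g = "inv_into (acar A) f"
  have bij: "bij_betw f (acar A) (acar B)" using f by (simp add: alg_iso_def ring_iso_def)
  have "?g (asmul B r y) = asmul A r (?g y)" if "y \<in> acar B" for r y
  proof -
    have g: "?g y \<in> acar A" "f (?g y) = y"
      using that bij_betw_inv_into_right[OF bij] bij_betwE[OF bij_betw_inv_into[OF bij]] by simp_all
    then have "asmul B r y = f (asmul A r (?g y))" using f by (simp add: alg_iso_def)
    moreover have "asmul A r (?g y) \<in> acar A" using A g by (simp add: alg_closed_def)
    ultimately show ?thesis using bij_betw_inv_into_left[OF bij] by metis
  qed
  moreover have "ring_iso A B f" using f by (simp add: alg_iso_def)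
  ultimately show ?thesis using ring_iso_inv[OF A] by (simp add: alg_iso_def)
qed

lemma diag_preserving_inv: assumes A: "alg_closed A" and f: "ring_iso A B f" "diag_preserving A B f"
  shows "diag_preserving B A (inv_into (acar A) f)"
proof -
  have bij: "bij_betw f (acar A) (acar B)" using f by (simp add: ring_iso_def)
  have "inv_into (acar A) f ` f ` adiag A = adiag A"
    using A bij by (intro inv_into_image_cancel) (auto simp: bij_betw_def alg_closed_def)
  then show ?thesis using f(2) by (simp add: diag_preserving_def)
qed

text \<open>Composing with \<open>f\<close>, \<open>g\<close> and their inverses translates (6) into
  (5), once for ring isomorphisms and once for algebra isomorphisms.\<close>

lemma diag_iso_transfer:
  assumes A: "alg_closed A" and C: "alg_closed C"
    and f: "alg_iso A B f" "diag_preserving A B f" and g: "alg_iso C D g" "diag_preserving C D g"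
    and B: "alg_closed B"
  shows "(\<exists>h. ring_iso A C h \<and> diag_preserving A C h) \<longleftrightarrow> (\<exists>h. ring_iso B D h \<and>
    diag_preserving B D h)"
    "(\<exists>h. alg_iso A C h \<and> diag_preserving A C h) \<longleftrightarrow> (\<exists>h. alg_iso B D h \<and> diag_preserving B D h)"
proof -
  have rf: "ring_iso A B f" and rg: "ring_iso C D g" using f g by (simp_all add: alg_iso_def)
  note fi = alg_iso_inv[OF A f(1)] ring_iso_inv[OF A rf] diag_preserving_inv[OF A rf f(2)]
  note gi = alg_iso_inv[OF C g(1)] ring_iso_inv[OF C rg] diag_preserving_inv[OF C rg g(2)]
  show "(\<exists>h. ring_iso A C h \<and> diag_preserving A C h) \<longleftrightarrow> (\<exists>h. ring_iso B D h \<and> diag_preserving B D h)"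
  proof (intro iffI; elim exE conjE)
    fix h assume "ring_iso A C h" "diag_preserving A C h"
    then show "\<exists>h. ring_iso B D h \<and> diag_preserving B D h"
      using ring_iso_comp[OF ring_iso_comp[OF fi(2)] rg] diag_preserving_comp[OF
        diag_preserving_comp[OF fi(3)] g(2)]
      by blast
  next
    fix h assume "ring_iso B D h" "diag_preserving B D h"
    then show "\<exists>h. ring_iso A C h \<and> diag_preserving A C h"
      using ring_iso_comp[OF ring_iso_comp[OF rf] gi(2)] diag_preserving_comp[OF
        diag_preserving_comp[OF f(2)] gi(3)]
      by blast
  qed
  show "(\<exists>h. alg_iso A C h \<and> diag_preserving A C h) \<longleftrightarrow> (\<exists>h. alg_iso B D h \<and> diag_preserving B D h)"
  proof (intro iffI; elim exE conjE)
    fix h assume "alg_iso A C h" "diag_preserving A C h"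
    then show "\<exists>h. alg_iso B D h \<and> diag_preserving B D h"
      using alg_iso_comp[OF alg_iso_comp[OF fi(1)] g(1)] diag_preserving_comp[OF
        diag_preserving_comp[OF fi(3)] g(2)]
      by blast
  next
    fix h assume "alg_iso B D h" "diag_preserving B D h"
    then show "\<exists>h. alg_iso A C h \<and> diag_preserving A C h"
      using alg_iso_comp[OF alg_iso_comp[OF f(1)] gi(1)] diag_preserving_comp[OF
        diag_preserving_comp[OF f(2)] gi(3)]
      by blast
  qed
qed

theorem theorem8p15:
  fixes P :: "('s, 'x) pact" and Q :: "('t, 'y) pact"
  assumes R: "indecomposable_ring TYPE('r::comm_ring_1)"
    and actP: "partial_action P" and actQ: "partial_action Q"
    and ampP: "almost_ample P" and ampQ: "almost_ample Q"
    and tpP: "top_principal P" and tpQ: "top_principal Q"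
    and hP: "Hausdorff_space (gtop (germ_gpd P))"
    and hQ: "Hausdorff_space (gtop (germ_gpd Q))"
  shows
    "(coe P Q \<longleftrightarrow> gpd_isomorphic (germ_gpd P) (germ_gpd Q)) \<and>
     (coe P Q \<longleftrightarrow> sg_isomorphic (Ga (germ_gpd P)) (bis_mul (germ_gpd P))
                               (Ga (germ_gpd Q)) (bis_mul (germ_gpd Q))) \<and>
     (coe P Q \<longleftrightarrow> sg_isomorphic (full_pseudogroup (germ_gpd P)) pb_mul
                               (full_pseudogroup (germ_gpd Q)) pb_mul) \<and>
     (coe P Q \<longleftrightarrow> (\<exists>\<Phi>. ring_iso (steinberg (germ_gpd P) :: (_, 'r) dalg) (steinberg (germ_gpd Q)) \<Phi> \<and>
                        diag_preserving (steinberg (germ_gpd P) :: (_, 'r) dalg) (steinberg (germ_gpd Q)) \<Phi>)) \<and>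
     (coe P Q \<longleftrightarrow> (\<exists>\<Phi>. alg_iso (steinberg (germ_gpd P) :: (_, 'r) dalg) (steinberg (germ_gpd Q)) \<Phi> \<and>
                        diag_preserving (steinberg (germ_gpd P) :: (_, 'r) dalg) (steinberg (germ_gpd Q)) \<Phi>)) \<and>
     (coe P Q \<longleftrightarrow> (\<exists>\<Phi>. ring_iso (crossed_product P :: (_, 'r) dalg) (crossed_product Q) \<Phi> \<and>
                        diag_preserving (crossed_product P :: (_, 'r) dalg) (crossed_product Q) \<Phi>)) \<and>
     (coe P Q \<longleftrightarrow> (\<exists>\<Phi>. alg_iso (crossed_product P :: (_, 'r) dalg) (crossed_product Q) \<Phi> \<and>
                        diag_preserving (crossed_product P :: (_, 'r) dalg) (crossed_product Q) \<Phi>))"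
proof -
  interpret P: principal_action P
    using actP ampP tpP hP by unfold_locales
  interpret Q: principal_action Q
    using actQ ampQ tpQ hQ by unfold_locales
  let ?G = "germ_gpd P" and ?H = "germ_gpd Q"
  note PQ = P.principal_action_axioms Q.principal_action_axioms
  note ham = P.hausdorff_ample_axioms Q.hausdorff_ample_axioms
  note gen = P.generic_ample_axioms Q.generic_ample_axioms
  have 14: "sg_isomorphic (full_pseudogroup ?G) pb_mul (full_pseudogroup ?H) pb_mul" if "coe P Q"
    using coe_imp_full_pseudogroup_iso[OF PQ that] .
  have 43: "sg_isomorphic (Ga ?G) (bis_mul ?G) (Ga ?H) (bis_mul ?H) \<longleftrightarrow>
      sg_isomorphic (full_pseudogroup ?G) pb_mul (full_pseudogroup ?H) pb_mul"
    by (rule sg_iso_Ga_iff_full_pseudogroup[OF gen])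
  have 32: "gpd_isomorphic ?G ?H" if "sg_isomorphic (Ga ?G) (bis_mul ?G) (Ga ?H) (bis_mul ?H)"
    by (rule sg_iso_Ga_imp_gpd_iso[OF ham that])
  have 21: "coe P Q" if "gpd_isomorphic ?G ?H"
    by (rule gpd_iso_imp_coe[OF PQ that])
  let ?A = "steinberg ?G :: (_, 'r) dalg" and ?B = "steinberg ?H :: (_, 'r) dalg"
  have 25: "\<exists>\<Phi>. alg_iso ?A ?B \<Phi> \<and> diag_preserving ?A ?B \<Phi>" if "gpd_isomorphic ?G ?H"
    by (rule gpd_iso_imp_alg_iso[OF ham that])
  have 55: "\<exists>\<Phi>. ring_iso ?A ?B \<Phi> \<and> diag_preserving ?A ?B \<Phi>"
    if "\<exists>\<Phi>. alg_iso ?A ?B \<Phi> \<and> diag_preserving ?A ?B \<Phi>"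
    using that by (auto simp: alg_iso_def)
  have 53: "sg_isomorphic (Ga ?G) (bis_mul ?G) (Ga ?H) (bis_mul ?H)"
    if "\<exists>\<Phi>. ring_iso ?A ?B \<Phi> \<and> diag_preserving ?A ?B \<Phi>"
    using that diagonal_ring_iso_imp_sg_iso[OF R gen] by blast
  let ?C = "crossed_product P :: (_, 'r) dalg" and ?D = "crossed_product Q :: (_, 'r) dalg"
  have f: "alg_iso ?C ?A P.Cpi" "diag_preserving ?C ?A P.Cpi"
    and g: "alg_iso ?D ?B Q.Cpi" "diag_preserving ?D ?B Q.Cpi"
    by (rule P.crossed_product_iso_steinberg Q.crossed_product_iso_steinberg)+
  have closed: "alg_closed ?C" "alg_closed ?D" "alg_closed ?A"
    by (rule P.crossed_product_closed Q.crossed_product_closed P.stb_closed)+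
  note 56 = diag_iso_transfer[OF closed(1,2) f g closed(3)]
  \<comment> \<open>With (6) rewritten to (5) by \<open>56\<close>, the implications form the cycle
    (1), (4), (3), (2), (1), to which the path from (2) through algebra and ring isomorphisms to (3)
    is attached.\<close>
  show ?thesis
    unfolding 56 using 14 43 32 21 25 55 53 by blast
qed

end
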